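(* Let $\mathsf{A},\mathsf{E},\mathsf{C}$ be finite-dimensional Hilbert spaces, let $\rho_{AE}$ be a density operator on $\mathsf{A}\otimes\mathsf{E}$ and $\mathcal{T}_{A\to C}$ a quantum channel with Choi state $\omega_{A'C}=(\mathrm{id}_{A'}\otimes\mathcal{T})(\Phi_{A'A})$. Then for every $\alpha\in(0,1)$, \[ \frac12\,\mathbf{E}_{U\sim\mathds{U}(\mathsf{A})}\Big\|\mathcal{T}\big(U_A\rho_{AE}U_A^\dagger\big)-\omega_C\otimes\rho_E\Big\|_1\ge 1-2\exp\!\Big((1-\alpha)\big(H_\alpha^{\downarrow}(A'|C)_\omega+H_\alpha^{\downarrow}(A|E)_\rho+\log\tfrac43\big)\Big). \] Moreover, $\sup_{\alpha\in(0,1)}(\alpha-1)\big(H_\alpha^{\downarrow}(A'|C)_\omega+H_\alpha^{\downarrow}(A|E)_\rho\big)>0$ if and only if $H(A'|C)_\omega+H(A|E)_\rho<0$.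
   Context: $\mathbf{E}_{U\sim\mathds{U}(\mathsf{A})}$ is the Haar average over the unitary group of $\mathsf{A}$; $U_A$ acts as $U_A\otimes\mathds{1}_E$. $\mathsf{A}'\cong\mathsf{A}$, $\Phi_{A'A}$ is the normalized maximally entangled state, $\omega_C=\mathcal{T}(\mathds{1}_A/\dim\mathsf{A})$, $\rho_E=\mathrm{Tr}_A\rho_{AE}$. Logarithms are natural. The Petz–Rényi conditional entropy is $H_\alpha^{\downarrow}(A|B)_\rho:=\frac{1}{1-\alpha}\log\mathrm{Tr}\big[\rho_{AB}^\alpha(\mathds{1}_A\otimes\rho_B)^{1-\alpha}\big]$, and $H(A|B)_\rho=-\mathrm{Tr}[\rho_{AB}(\log\rho_{AB}-\log(\mathds{1}_A\otimes\rho_B))]$ is the conditional von Neumann entropy. *)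

theory Defs
  imports "HOL-Analysis.Analysis" "HOL-Probability.Probability"
begin

text \<open>Operators on a finite-dimensional Hilbert space with orthonormal basis indexed
  by the finite type 'n are complex matrices of type complex^'n^'n.
  Tensor products of spaces correspond to product index types.\<close>

type_synonym 'n cmat = "complex^'n^'n"

definition qtr :: "'n::finite cmat \<Rightarrow> complex" where
  "qtr M = (\<Sum>i\<in>UNIV. M $ i $ i)"

definition adj :: "'n::finite cmat \<Rightarrow> 'n cmat" where
  "adj M = (\<chi> i j. cnj (M $ j $ i))"

definition cscale :: "complex \<Rightarrow> 'n::finite cmat \<Rightarrow> 'n cmat" where
  "cscale c M = (\<chi> i j. c * M $ i $ j)"

definition cinner :: "complex^'n::finite \<Rightarrow> complex^'n \<Rightarrow> complex" where
  "cinner v w = (\<Sum>i\<in>UNIV. cnj (v $ i) * w $ i)"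

definition unitary :: "'n::finite cmat \<Rightarrow> bool" where
  "unitary U \<longleftrightarrow> adj U ** U = mat 1"

definition psd :: "'n::finite cmat \<Rightarrow> bool" where
  "psd M \<longleftrightarrow> (\<forall>v. Im (cinner v (M *v v)) = 0 \<and> Re (cinner v (M *v v)) \<ge> 0)"

definition density :: "'n::finite cmat \<Rightarrow> bool" where
  "density M \<longleftrightarrow> psd M \<and> qtr M = 1"

definition rdiag :: "('n::finite \<Rightarrow> real) \<Rightarrow> 'n cmat" where
  "rdiag d = (\<chi> i j. if i = j then complex_of_real (d i) else 0)"

definition mfun :: "(real \<Rightarrow> real) \<Rightarrow> 'n::finite cmat \<Rightarrow> 'n cmat" where
  "mfun f A = (SOME B. \<exists>U d. unitary U \<and> A = U ** rdiag d ** adj U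
                          \<and> B = U ** rdiag (f \<circ> d) ** adj U)"

definition tensor :: "'a::finite cmat \<Rightarrow> 'b::finite cmat \<Rightarrow> ('a \<times> 'b) cmat" where
  "tensor A B = (\<chi> p q. A $ fst p $ fst q * B $ snd p $ snd q)"

definition ptr1 :: "('a::finite \<times> 'b::finite) cmat \<Rightarrow> 'b cmat" where
  "ptr1 M = (\<chi> k l. \<Sum>i\<in>UNIV. M $ (i, k) $ (i, l))"

definition ptr2 :: "('a::finite \<times> 'b::finite) cmat \<Rightarrow> 'a cmat" where
  "ptr2 M = (\<chi> i j. \<Sum>k\<in>UNIV. M $ (i, k) $ (j, k))"

definition trace_norm :: "'n::finite cmat \<Rightarrow> real" where
  "trace_norm X = Re (qtr (mfun sqrt (adj X ** X)))"

definition clinear_map :: "('a::finite cmat \<Rightarrow> 'c::finite cmat) \<Rightarrow> bool" where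
  "clinear_map T \<longleftrightarrow> (\<forall>X Y. T (X + Y) = T X + T Y) \<and> (\<forall>c X. T (cscale c X) = cscale c (T X))"

definition block_psd :: "nat \<Rightarrow> (nat \<Rightarrow> nat \<Rightarrow> 'n::finite cmat) \<Rightarrow> bool" where
  "block_psd n X \<longleftrightarrow> (\<forall>v :: nat \<Rightarrow> complex^'n.
      Im (\<Sum>k<n. \<Sum>l<n. cinner (v k) (X k l *v v l)) = 0 \<and>
      Re (\<Sum>k<n. \<Sum>l<n. cinner (v k) (X k l *v v l)) \<ge> 0)"

definition completely_positive :: "('a::finite cmat \<Rightarrow> 'c::finite cmat) \<Rightarrow> bool" where
  "completely_positive T \<longleftrightarrow>
     (\<forall>n X. block_psd n X \<longrightarrow> block_psd n (\<lambda>k l. T (X k l)))"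

definition trace_preserving :: "('a::finite cmat \<Rightarrow> 'c::finite cmat) \<Rightarrow> bool" where
  "trace_preserving T \<longleftrightarrow> (\<forall>X. qtr (T X) = qtr X)"

definition channel :: "('a::finite cmat \<Rightarrow> 'c::finite cmat) \<Rightarrow> bool" where
  "channel T \<longleftrightarrow> clinear_map T \<and> completely_positive T \<and> trace_preserving T"

definition map_left :: "('a::finite cmat \<Rightarrow> 'c::finite cmat) \<Rightarrow> ('a \<times> 'e::finite) cmat \<Rightarrow> ('c \<times> 'e) cmat" where
  "map_left T X = (\<chi> p q. T (\<chi> a a'. X $ (a, snd p) $ (a', snd q)) $ fst p $ fst q)"

definition map_right :: "('a::finite cmat \<Rightarrow> 'c::finite cmat) \<Rightarrow> ('r::finite \<times> 'a) cmat \<Rightarrow> ('r \<times> 'c) cmat" where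
  "map_right T X = (\<chi> p q. T (\<chi> a a'. X $ (fst p, a) $ (fst q, a')) $ snd p $ snd q)"

definition max_ent :: "('a::finite \<times> 'a) cmat" where
  "max_ent = (\<chi> p q. if fst p = snd p \<and> fst q = snd q then 1 / of_nat CARD('a) else 0)"

definition choi :: "('a::finite cmat \<Rightarrow> 'c::finite cmat) \<Rightarrow> ('a \<times> 'c) cmat" where
  "choi T = map_right T max_ent"

definition maximally_mixed :: "'a::finite cmat" where
  "maximally_mixed = cscale (1 / of_nat CARD('a)) (mat 1)"

definition haar :: "'n::finite cmat measure" where
  "haar = (SOME \<mu>. prob_space \<mu> \<and> sets \<mu> = sets borel \<and> (AE U in \<mu>. unitary U) \<and>
             (\<forall>V. unitary V \<longrightarrow> distr \<mu> borel (\<lambda>U. V ** U) = \<mu>))"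

definition petz_cond_entropy :: "real \<Rightarrow> ('a::finite \<times> 'b::finite) cmat \<Rightarrow> real" where
  "petz_cond_entropy \<alpha> \<rho> = 1 / (1 - \<alpha>) *
     ln (Re (qtr (mfun (\<lambda>x. x powr \<alpha>) \<rho> **
                   mfun (\<lambda>x. x powr (1 - \<alpha>)) (tensor (mat 1) (ptr1 \<rho>)))))"

definition cond_entropy :: "('a::finite \<times> 'b::finite) cmat \<Rightarrow> real" where
  "cond_entropy \<rho> = - Re (qtr (\<rho> ** (mfun ln \<rho> - mfun ln (tensor (mat 1) (ptr1 \<rho>)))))"

end

theory Submission
  imports Defs
begin

text \<open>Write \<open>\<omega>\<close> for the Choi state, \<open>d\<close> for the dimension of \<open>A\<close> and \<open>K = d \<langle>\<Phi>| U\<close>, so that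
  the channel output is \<open>X = K (\<omega> \<otimes> \<rho>) K\<^sup>\<dagger>\<close>. One minus the trace distance of \<open>X\<close> and
  \<open>Y = \<omega>\<^sub>C \<otimes> \<rho>\<^sub>E\<close> is at most the total error of any test \<open>M\<close> telling \<open>X\<close> from \<open>Y\<close>. Take
  the optimal projection \<open>P\<close> for the discrimination of \<open>\<omega> \<otimes> \<rho>\<close> from \<open>(4 / 3) (1 \<otimes> Y)\<close> and
  let \<open>M\<close> be a ramp function of \<open>K P K\<^sup>\<dagger>\<close>. A duality argument bounds the error of \<open>M\<close> by a
  polynomial of degree two in \<open>U\<close> and two in its conjugate, so that second moments of Haar
  measure suffice: the Gram matrix \<open>K\<^sup>\<dagger> K\<close> has mean 1 and a variance controlled by
  \<open>d\<^sup>2 / (d\<^sup>2 - 1) \<le> 4 / 3\<close> (and zero if \<open>d = 1\<close>). The mean error of \<open>M\<close> is thus at most twice that of \<open>P\<close>, which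
  Audenaert's inequality bounds by \<open>Tr (\<omega> \<otimes> \<rho>)\<^sup>\<alpha> ((4 / 3) (1 \<otimes> Y))\<^sup>1\<^sup>-\<^sup>\<alpha>\<close>, and this trace
  factorizes.

  For the sign of the exponent, \<open>log Tr \<rho>\<^sup>\<alpha> (1 \<otimes> \<rho>\<^sub>E)\<^sup>1\<^sup>-\<^sup>\<alpha>\<close> is the cumulant generating
  function, at \<open>1 - \<alpha>\<close>, of a real random variable whose mean is the conditional entropy; it is
  convex, vanishes at 0 and has that mean as derivative there.\<close>

section \<open>Linear algebra of complex matrices\<close>

text \<open>The obstacle is that \<open>K\<close> is an isometry only on average.
  \<open>K P K\<^sup>\<dagger>\<close> may exceed 1 and so need not be a test, while normalising it
  exactly would bring in inverses of random matrices, whose Haar mean is out of reach. Cutting it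
  off by the ramp gives a test, and duality trades the spectral function for free coefficients in
  the error bound. Taking for them the mean Gram entries, which do not depend on \<open>U\<close>,
  turns the bound into variances and means of entries of \<open>K\<^sup>\<dagger> K\<close> and
  \<open>K\<^sup>\<dagger> Y K\<close>.

  \<open>haar\<close> is a choice among left invariant probability measures on the unitaries, so
  existence has to come first: such a measure is the law of the unitary polar factor of a uniformly
  random matrix in a bounded open set. With left invariance in hand, symmetries acting on rows fix
  the row dependence of the moments, and unitarity fixes the remaining constants, which depend on
  the columns. \<open>mfun\<close> is a choice as well, so each computation with it rests on
  independence of the diagonalisation.\<close>

lemmas mult_if_distribs = if_distrib[where f="\<lambda>x. _ * x"] if_distrib[where f="\<lambda>x. x * _"]

lemma cinner_add_right: "cinner v (w + x) = cinner v w + cinner v x"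
  and cinner_add_left: "cinner (v + w) x = cinner v x + cinner w x"
  and cinner_diff_right: "cinner v (w - x) = cinner v w - cinner v x"
  and cinner_diff_left: "cinner (v - w) x = cinner v x - cinner w x"
  and cinner_scale_right: "cinner v (c *s w) = c * cinner v w"
  and cinner_scale_left: "cinner (c *s v) w = cnj c * cinner v w"
  and cinner_zero_right: "cinner v 0 = 0"
  and cinner_zero_left: "cinner 0 v = 0"
  by (simp_all add: cinner_def algebra_simps sum.distrib sum_subtractf sum_distrib_left)

lemma cinner_sum_right: "cinner v (\<Sum>i\<in>I. f i) = (\<Sum>i\<in>I. cinner v (f i))"
  by (induction I rule: infinite_finite_induct) (simp_all add: cinner_add_right cinner_zero_right)

lemma cinner_sum_left: "cinner (\<Sum>i\<in>I. f i) v = (\<Sum>i\<in>I. cinner (f i) v)"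
  by (induction I rule: infinite_finite_induct) (simp_all add: cinner_add_left cinner_zero_left)

lemma cinner_commute: "cinner w v = cnj (cinner v w)"
  by (simp add: cinner_def mult.commute)

lemma cinner_self: "cinner v v = complex_of_real ((norm v)\<^sup>2)"
  by (simp add: cinner_def norm_vec_def L2_set_def sum_nonneg)
     (simp add: complex_norm_square[symmetric] mult.commute)

lemma norm_sq_vec: "(norm (v :: complex^'n))\<^sup>2 = (\<Sum>i\<in>UNIV. (cmod (v $ i))\<^sup>2)"
  by (simp add: norm_vec_def L2_set_def sum_nonneg)

lemma cinner_adj: "cinner v (A *v w) = cinner (adj A *v v) w"
proof -
  have "cinner v (A *v w) = (\<Sum>i\<in>UNIV. \<Sum>j\<in>UNIV. cnj (v $ i) * A $ i $ j * w $ j)"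
    by (simp add: cinner_def matrix_vector_mult_def sum_distrib_left mult.assoc)
  also have "\<dots> = (\<Sum>j\<in>UNIV. \<Sum>i\<in>UNIV. cnj (v $ i) * A $ i $ j * w $ j)"
    by (rule sum.swap)
  also have "\<dots> = cinner (adj A *v v) w"
    by (simp add: cinner_def matrix_vector_mult_def adj_def sum_distrib_right sum_distrib_left mult_ac)
  finally show ?thesis .
qed

lemma adj_adj [simp]: "adj (adj A) = A"
  by (simp add: adj_def vec_eq_iff)

lemma adj_diff: "adj (A - B) = adj A - adj B"
  by (simp add: adj_def vec_eq_iff)

lemma adj_mult: "adj (A ** B) = adj B ** adj A"
  by (simp add: adj_def vec_eq_iff matrix_matrix_mult_def mult.commute)

lemma adj_mat1 [simp]: "adj (mat 1) = mat 1"
  by (simp add: adj_def vec_eq_iff mat_def)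

lemma adj_rdiag [simp]: "adj (rdiag d) = rdiag d"
  by (simp add: adj_def vec_eq_iff rdiag_def)

lemma rdiag_mult: "rdiag d ** rdiag e = rdiag (\<lambda>i. d i * e i)"
  by (auto simp: rdiag_def vec_eq_iff matrix_matrix_mult_def mult_if_distribs cong: if_cong)

lemma rdiag_diff: "rdiag d - rdiag e = rdiag (\<lambda>i. d i - e i)"
  by (auto simp: rdiag_def vec_eq_iff)

lemma rdiag_one: "rdiag (\<lambda>i. 1) = mat 1"
  by (auto simp: rdiag_def vec_eq_iff mat_def)

lemma rdiag_vec: "(rdiag d *v v) $ k = complex_of_real (d k) * v $ k"
  by (simp add: rdiag_def matrix_vector_mult_def mult_if_distribs cong: if_cong)

lemma unitary_mult_adj: "unitary U \<Longrightarrow> U ** adj U = mat 1"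
  unfolding unitary_def using matrix_left_right_inverse by blast

lemma qtr_mult_commute: "qtr (A ** B) = qtr (B ** A)"
  unfolding qtr_def matrix_matrix_mult_def
  by (simp add: mult.commute) (rule sum.swap)

lemma qtr_add: "qtr (A + B) = qtr A + qtr B"
  and qtr_diff: "qtr (A - B) = qtr A - qtr B"
  by (simp_all add: qtr_def sum.distrib sum_subtractf)

lemma qtr_unitary_conj: "unitary U \<Longrightarrow> qtr (U ** A ** adj U) = qtr A"
  by (metis matrix_mul_assoc matrix_mul_lid qtr_mult_commute unitary_def)

lemma qtr_rdiag: "qtr (rdiag d) = complex_of_real (\<Sum>i\<in>UNIV. d i)"
  by (simp add: qtr_def rdiag_def)

text \<open>Polarisation: varying \<open>c\<close> extracts single matrix entries from the quadratic
  form.\<close>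

lemma axis_form:
  "cinner (axis i 1 + c *s axis j 1) (A *v (axis i 1 + c *s axis j 1)) =
     A $ i $ i + c * A $ i $ j + cnj c * A $ j $ i + (cnj c * c) * A $ j $ j"
proof -
  have ax: "cinner (axis i 1) (A *v axis j 1) = A $ i $ j" for i j
    by (simp add: cinner_def axis_def matrix_vector_mult_def mult_if_distribs if_distrib [where f=cnj] cong: if_cong)
  show ?thesis
    by (simp add: matrix_vector_right_distrib cinner_add_left cinner_add_right cinner_scale_left
        cinner_scale_right vector_scalar_commute ax algebra_simps)
qed

text \<open>\<open>psd\<close> demands a real quadratic form, which over the complex numbers forces
  Hermiticity: \<open>c = 1\<close> makes the imaginary parts of opposite entries cancel, and
  \<open>c = \<i>\<close> makes their real parts agree.\<close>

lemma psd_adj: assumes "psd A" shows "adj A = A"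
proof -
  have im: "Im (A $ i $ i + c * A $ i $ j + cnj c * A $ j $ i + (cnj c * c) * A $ j $ j) = 0" for i j c
    using assms unfolding psd_def axis_form[symmetric] by blast
  have ii: "Im (A $ i $ i) = 0" for i
    using im[of i 0 i] by simp
  have "cnj (A $ j $ i) = A $ i $ j" for i j
    using im[of i 1 j] im[of i \<i> j] ii[of i] ii[of j] by (simp add: complex_eq_iff)
  then show ?thesis
    by (simp add: adj_def vec_eq_iff)
qed

lemma herm_form_real: "adj A = A \<Longrightarrow> Im (cinner v (A *v v)) = 0"
  by (metis cinner_adj cinner_commute complex_cnj_cancel_iff complex_is_Real_iff Reals_cnj_iff)

section \<open>The spectral theorem and functional calculus\<close>

text \<open>A maximiser of the quadratic form on the unit sphere of an invariant subspace
  \<open>W\<close> is an eigenvector: with \<open>l\<close> the maximum, \<open>l - A\<close> is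
  nonnegative on \<open>W\<close> and its form vanishes at \<open>v\<close>, hence it annihilates
  \<open>v\<close>.\<close>

lemma herm_max_eigenvector:
  fixes A :: "'n::finite cmat"
  assumes A: "adj A = A" and W: "\<And>v w. v \<in> W \<Longrightarrow> w \<in> W \<Longrightarrow> v + w \<in> W"
    "\<And>c v. v \<in> W \<Longrightarrow> c *s v \<in> W" and AW: "\<And>v. v \<in> W \<Longrightarrow> A *v v \<in> W"
    and cl: "closed W" and ne: "\<exists>v\<in>W. v \<noteq> 0"
  obtains v l where "v \<in> W" "norm v = 1" "A *v v = complex_of_real l *s v"
proof -
  let ?f = "\<lambda>v. Re (cinner v (A *v v))"
  have cont: "continuous_on X ?f" for X
    unfolding cinner_def matrix_vector_mult_def by (intro continuous_intros)
  have comp: "compact (W \<inter> sphere 0 1)"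
    using cl by (simp add: closed_Int_compact)
  obtain v0 where v0: "v0 \<in> W" "v0 \<noteq> 0" using ne by blast
  have nrm: "norm (complex_of_real c *s v) = \<bar>c\<bar> * norm v" for c :: real and v :: "complex^'n"
    by (simp add: norm_vec_def norm_mult L2_set_right_distrib)
  have "complex_of_real (1 / norm v0) *s v0 \<in> W \<inter> sphere 0 1"
    using v0 W(2) nrm[of "1 / norm v0" v0] by simp
  then have "W \<inter> sphere 0 1 \<noteq> {}" by blast
  then obtain v where v: "v \<in> W \<inter> sphere 0 1" and mx: "\<And>w. w \<in> W \<inter> sphere 0 1 \<Longrightarrow> ?f w \<le> ?f v"
    using continuous_attains_sup[OF comp _ cont] by blast
  define l where "l = ?f v"
  define B where "B = (\<lambda>w. complex_of_real l *s w - A *v w)"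
  have vn: "norm v = 1" "v \<in> W" using v by auto
  have Bherm: "cinner w (B x) = cinner (B w) x" for w x
    using cinner_adj[of w A x] A
    by (simp add: B_def cinner_diff_left cinner_diff_right cinner_scale_left cinner_scale_right)
  have Badd: "B (w + c *s x) = B w + c *s B x" for w c x
    by (simp add: B_def matrix_vector_right_distrib vector_scalar_commute algebra_simps
        vector_add_ldistrib vec_eq_iff)
  have BW: "B w \<in> W" if "w \<in> W" for w
  proof -
    have "B w = complex_of_real l *s w + (-1) *s (A *v w)" by (simp add: B_def vec_eq_iff)
    then show ?thesis using W AW that by metis
  qed
  have Bpos: "Re (cinner w (B w)) \<ge> 0" if "w \<in> W" for w
  proof (cases "w = 0")
    case False
    define u where "u = complex_of_real (1 / norm w) *s w"
    have "u \<in> W \<inter> sphere 0 1" using that W(2) False nrm[of "1 / norm w" w] by (simp add: u_def)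
    then have "?f u \<le> l" using mx l_def by blast
    moreover have "?f u = ?f w / (norm w)\<^sup>2"
      by (simp add: u_def vector_scalar_commute cinner_scale_left cinner_scale_right power2_eq_square
         del: of_real_divide of_real_mult)
    ultimately have "?f w \<le> l * (norm w)\<^sup>2" using False by (simp add: divide_le_eq)
    then show ?thesis
      by (simp add: B_def cinner_diff_right cinner_scale_right cinner_self)
  qed (simp add: cinner_zero_left)
  have Bv0: "cinner v (B v) = 0"
    using herm_form_real[OF A, of v]
    by (simp add: B_def cinner_diff_right cinner_scale_right cinner_self vn l_def complex_eq_iff)
  have "B v = 0"
  proof (rule ccontr)
    assume nz: "B v \<noteq> 0"
    define a where "a = (norm (B v))\<^sup>2"
    define b where "b = Re (cinner (B v) (B (B v)))"
    have a: "a > 0" using nz by (simp add: a_def)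
    have b: "b \<ge> 0" using Bpos BW vn by (simp add: b_def)
    have "0 \<le> Re (cinner (v + complex_of_real t *s B v) (B (v + complex_of_real t *s B v)))" for t :: real
      using Bpos W BW vn by simp
    also have "Re (cinner (v + complex_of_real t *s B v) (B (v + complex_of_real t *s B v))) = 2 * t * a + t\<^sup>2 * b" for t :: real
      using Bherm[of v "B v"] unfolding Badd
      by (simp add: cinner_add_left cinner_add_right cinner_scale_left cinner_scale_right Bv0
          a_def b_def cinner_self power2_eq_square algebra_simps)
    finally have "0 \<le> 2 * t * a + t\<^sup>2 * b" for t .
    \<comment> \<open>The form at \<open>v + t B v\<close> is \<open>2 t a + t^2 b\<close>, linear
      to first order, so a small negative parameter makes it negative. The summand 1 keeps the
      denominator positive when \<open>b = 0\<close>.\<close>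
    moreover define t where "t = a / (b + 1)"
    moreover have "t * (b + 1) = a" "t > 0" using a b by (simp_all add: t_def)
    moreover from this have "a = t * b + t" by (simp add: algebra_simps)
    ultimately have "0 \<le> 2 * (- t) * (t * b + t) + (- t)\<^sup>2 * b" by metis
    also have "\<dots> = - (t\<^sup>2 * b) - 2 * t\<^sup>2" by (simp add: power2_eq_square algebra_simps)
    also have "\<dots> < 0" using mult_nonneg_nonneg[OF zero_le_power2[of t] b] zero_less_power[OF \<open>t > 0\<close>, of 2]
      by linarith
    finally show False by simp
  qed
  then have "A *v v = complex_of_real l *s v" by (simp add: B_def)
  then show ?thesis using that vn by blast
qed

text \<open>Eigenvectors are labelled by the index type itself, so that at \<open>I = UNIV\<close>
  they are the columns of a square matrix. Each step finds one more in the orthogonal complement of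
  those already found.\<close>

lemma herm_partial_eigenbasis:
  fixes A :: "'n::finite cmat"
  assumes A: "adj A = A" and "finite I"
  shows "\<exists>(f::'n \<Rightarrow> complex^'n) d. (\<forall>i\<in>I. \<forall>j\<in>I. cinner (f i) (f j) = (if i = j then 1 else 0)) \<and>
     (\<forall>i\<in>I. A *v f i = complex_of_real (d i) *s f i)"
  using \<open>finite I\<close>
proof (induction I)
  case empty
  then show ?case by simp
next
  case (insert k I)
  then obtain f d where f: "\<And>i j. i \<in> I \<Longrightarrow> j \<in> I \<Longrightarrow> cinner (f i) (f j) = (if i = j then 1 else 0)"
    and d: "\<And>i. i \<in> I \<Longrightarrow> A *v f i = complex_of_real (d i) *s f i" by blast
  define W where "W = {v. \<forall>i\<in>I. cinner (f i) v = 0}"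
  \<comment> \<open>Replaces a dimension count: since \<open>k\<close> is not in \<open>I\<close>,
    row \<open>k\<close> of \<open>M\<close> vanishes, so \<open>M\<close> is singular, and its
    kernel lies in the orthogonal complement \<open>W\<close>.\<close>
  define M :: "'n cmat" where "M = (\<chi> i j. if i \<in> I then cnj (f i $ j) else 0)"
  have "\<exists>v\<in>W. v \<noteq> 0"
  proof (rule ccontr)
    assume "\<not> ?thesis"
    moreover have "v \<in> W" if "M *v v = 0" for v
    proof -
      have "(M *v v) $ i = cinner (f i) v" if "i \<in> I" for i
        using that by (simp add: M_def matrix_vector_mult_def cinner_def)
      then show ?thesis using that by (simp add: W_def)
    qed
    ultimately have "\<forall>v. M *v v = 0 \<longrightarrow> v = 0" by blast
    then obtain B where "B ** M = mat 1" using matrix_left_invertible_ker by blast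
    then have "M ** B = mat 1" using matrix_left_right_inverse by blast
    moreover have "(M ** B) $ k $ k = 0"
      using insert.hyps by (simp add: M_def matrix_matrix_mult_def)
    ultimately show False by (simp add: mat_def)
  qed
  moreover have "closed W"
  proof -
    have "W = (\<Inter>i\<in>I. {v. cinner (f i) v = 0})" by (auto simp: W_def)
    then show ?thesis
      unfolding cinner_def by (auto intro!: closed_INT closed_Collect_eq continuous_intros)
  qed
  moreover have "A *v v \<in> W" if "v \<in> W" for v
    using that A d by (auto simp: W_def cinner_adj cinner_scale_left)
  ultimately obtain v l where v: "v \<in> W" "norm v = 1" "A *v v = complex_of_real l *s v"
    by (rule_tac herm_max_eigenvector[OF A, of W]) (auto simp: W_def cinner_add_right cinner_scale_right)
  have vv: "cinner v v = 1" using v(2) by (simp add: cinner_self)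
  have vf: "cinner (f i) v = 0" "cinner v (f i) = 0" if "i \<in> I" for i
    using v(1) that cinner_commute[of v "f i"] by (auto simp: W_def)
  show ?case
    using insert.hyps f d v vf vv
    by (intro exI[of _ "f(k := v)"] exI[of _ "d(k := l)"]) auto
qed

theorem spectral_theorem:
  fixes A :: "'n::finite cmat"
  assumes A: "adj A = A"
  obtains U d where "unitary U" "A = U ** rdiag d ** adj U"
proof -
  obtain f :: "'n \<Rightarrow> complex^'n" and d where f: "\<And>i j. cinner (f i) (f j) = (if i = j then 1 else 0)"
    and d: "\<And>i. A *v f i = complex_of_real (d i) *s f i"
    using herm_partial_eigenbasis[OF A finite_class.finite_UNIV] by auto
  define U where "U = (\<chi> i j. f j $ i)"
  have U: "unitary U"
    using f unfolding unitary_def adj_def matrix_matrix_mult_def U_def cinner_def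
    by (simp add: vec_eq_iff mat_def)
  have "A ** U = U ** rdiag d"
    using d unfolding U_def matrix_matrix_mult_def matrix_vector_mult_def rdiag_def
    by (simp add: vec_eq_iff mult.commute mult_if_distribs cong: if_cong)
  then have "A = U ** rdiag d ** adj U"
    by (metis U matrix_mul_assoc matrix_mul_rid unitary_mult_adj)
  with U that show ?thesis by blast
qed

lemma spectral_form:
  fixes U :: "'n::finite cmat"
  shows "cinner v ((U ** rdiag d ** adj U) *v v) = complex_of_real (\<Sum>k\<in>UNIV. d k * (cmod ((adj U *v v) $ k))\<^sup>2)"
proof -
  have "cinner v ((U ** rdiag d ** adj U) *v v) = cinner v (U *v (rdiag d *v (adj U *v v)))"
    by (simp add: matrix_vector_mul_assoc matrix_mul_assoc)
  also have "\<dots> = cinner (adj U *v v) (rdiag d *v (adj U *v v))"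
    by (rule cinner_adj)
  also have "\<dots> = complex_of_real (\<Sum>k\<in>UNIV. d k * (cmod ((adj U *v v) $ k))\<^sup>2)"
    unfolding cinner_def rdiag_vec
    by (simp add: complex_norm_square[symmetric] mult_ac flip: of_real_power)
  finally show ?thesis .
qed

lemma herm_spectral: "adj (U ** rdiag d ** adj U) = U ** rdiag d ** adj U"
  by (simp add: adj_mult matrix_mul_assoc)

lemma psd_spectral_iff:
  assumes U: "unitary U"
  shows "psd (U ** rdiag d ** adj U) \<longleftrightarrow> (\<forall>k. d k \<ge> 0)"
proof
  assume L: "psd (U ** rdiag d ** adj U)"
  show "\<forall>k. d k \<ge> 0"
  proof
    fix k
    have "adj U *v (U *v axis k 1) = axis k 1"
      using U by (simp add: matrix_vector_mul_assoc unitary_def)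
    then have "cinner (U *v axis k 1) ((U ** rdiag d ** adj U) *v (U *v axis k 1)) = complex_of_real (d k)"
      unfolding spectral_form by (simp add: axis_def mult_if_distribs if_distrib [where f="\<lambda>x. x ^ _"]
          if_distrib [where f=cmod] cong: if_cong)
    then show "d k \<ge> 0" using L unfolding psd_def by (metis Re_complex_of_real)
  qed
next
  assume "\<forall>k. d k \<ge> 0"
  then show "psd (U ** rdiag d ** adj U)"
    unfolding psd_def spectral_form by (auto intro: sum_nonneg)
qed

lemma psd_spectral:
  assumes "psd A"
  obtains U d where "unitary U" "A = U ** rdiag d ** adj U" "\<And>k. d k \<ge> 0"
  by (metis assms psd_adj psd_spectral_iff spectral_theorem)

text \<open>Makes the choice in \<open>mfun\<close> harmless. Between two diagonalisations the
  unitary \<open>W\<close> intertwines the diagonal matrices, so \<open>W $ i $ j\<close> vanishes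
  unless \<open>d j = e i\<close>, and \<open>W\<close> then intertwines the images under
  \<open>f\<close> too.\<close>

lemma mfun_spectral:
  assumes U: "unitary U" and A: "A = U ** rdiag d ** adj U"
  shows "mfun f A = U ** rdiag (f \<circ> d) ** adj U"
proof -
  let ?P = "\<lambda>B. \<exists>U d. unitary U \<and> A = U ** rdiag d ** adj U \<and> B = U ** rdiag (f \<circ> d) ** adj U"
  have uniq: "V ** rdiag (f \<circ> e) ** adj V = U ** rdiag (f \<circ> d) ** adj U"
    if V: "unitary V" and e: "A = V ** rdiag e ** adj V" for V e
  proof -
    define W where "W = adj V ** U"
    have "W ** rdiag d = adj V ** (U ** rdiag d ** adj U) ** U"
      by (metis U W_def matrix_mul_assoc matrix_mul_rid unitary_def)
    also have "\<dots> = adj V ** (V ** rdiag e ** adj V) ** U" using A e by simp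
    also have "\<dots> = rdiag e ** W"
      by (metis V W_def matrix_mul_assoc matrix_mul_lid unitary_def)
    finally have comm: "W $ i $ j * complex_of_real (d j) = complex_of_real (e i) * W $ i $ j" for i j
      by (simp add: vec_eq_iff matrix_matrix_mult_def rdiag_def mult_if_distribs cong: if_cong)
    have "W $ i $ j = 0 \<or> d j = e i" for i j
      using comm[of i j] by auto
    then have "W $ i $ j * complex_of_real (f (d j)) = complex_of_real (f (e i)) * W $ i $ j" for i j
      by (metis mult.commute mult_zero_left)
    then have "W ** rdiag (f \<circ> d) = rdiag (f \<circ> e) ** W"
      by (simp add: vec_eq_iff matrix_matrix_mult_def rdiag_def mult_if_distribs cong: if_cong)
    then have "V ** (W ** rdiag (f \<circ> d)) ** adj U = V ** (rdiag (f \<circ> e) ** W) ** adj U" by simp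
    moreover have "V ** (W ** rdiag (f \<circ> d)) ** adj U = U ** rdiag (f \<circ> d) ** adj U"
      unfolding W_def by (metis V matrix_mul_assoc matrix_mul_lid unitary_mult_adj)
    moreover have "V ** (rdiag (f \<circ> e) ** W) ** adj U = V ** rdiag (f \<circ> e) ** adj V"
      unfolding W_def by (metis U matrix_mul_assoc matrix_mul_rid unitary_mult_adj)
    ultimately show ?thesis by simp
  qed
  have "?P (mfun f A)" unfolding mfun_def by (rule someI[of ?P]) (use U A in blast)
  then obtain V e where "unitary V" "A = V ** rdiag e ** adj V" "mfun f A = V ** rdiag (f \<circ> e) ** adj V"
    by blast
  then show ?thesis using uniq by simp
qed

section \<open>Traces and positive operators\<close>

lemma unitary_cinner: "unitary U \<Longrightarrow> cinner (adj U *v v) (adj U *v w) = cinner v w"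
  by (metis adj_adj cinner_adj matrix_vector_mul_assoc matrix_vector_mul_lid unitary_mult_adj)

lemma unitary_norm: "unitary U \<Longrightarrow> (\<Sum>k\<in>UNIV. (cmod ((adj U *v v) $ k))\<^sup>2) = (norm v)\<^sup>2"
  by (metis cinner_self norm_sq_vec of_real_eq_iff unitary_cinner)

lemma column_conj: "cinner (column k U) (A *v column l U) = (adj U ** A ** U) $ k $ l"
  by (simp add: cinner_def column_def adj_def matrix_vector_mult_def matrix_matrix_mult_def
      sum_distrib_left sum_distrib_right mult.assoc) (rule sum.swap)

lemma unitary_column: "unitary U \<Longrightarrow> cinner (column k U) (column l U) = (if k = l then 1 else 0)"
  using column_conj[of k U "mat 1" l] by (simp add: unitary_def) (simp add: mat_def)

lemma unitary_column_norm: "unitary U \<Longrightarrow> norm (column k U) = 1"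
  using unitary_column[of U k k] by (simp add: cinner_self) (simp add: abs_square_eq_1 flip: of_real_power)

lemma qtr_spectral_mult:
  "qtr ((U ** rdiag d ** adj U) ** B) = (\<Sum>k\<in>UNIV. complex_of_real (d k) * cinner (column k U) (B *v column k U))"
proof -
  have "qtr ((U ** rdiag d ** adj U) ** B) = qtr (rdiag d ** (adj U ** B ** U))"
    by (metis matrix_mul_assoc qtr_mult_commute)
  also have "\<dots> = (\<Sum>k\<in>UNIV. complex_of_real (d k) * (adj U ** B ** U) $ k $ k)"
    by (simp add: qtr_def matrix_matrix_mult_def rdiag_def mult_if_distribs cong: if_cong)
  finally show ?thesis by (simp add: column_conj)
qed

lemma qtr_spectral: "unitary U \<Longrightarrow> qtr (U ** rdiag d ** adj U) = complex_of_real (\<Sum>k\<in>UNIV. d k)"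
  by (simp add: qtr_unitary_conj qtr_rdiag)

lemma psd_qtr_mult_nonneg:
  assumes "psd A" "psd B"
  shows "Re (qtr (A ** B)) \<ge> 0"
proof -
  obtain U d where U: "unitary U" "A = U ** rdiag d ** adj U" "\<And>k. d k \<ge> 0"
    using psd_spectral assms(1) by blast
  show ?thesis
    using assms(2) U(3) unfolding U(2) qtr_spectral_mult psd_def by (auto intro!: sum_nonneg)
qed

lemma matrix_diff_ldistrib: "A ** (B - C) = A ** B - A ** (C :: 'a::ring_1 ^'n ^'m)"
  and matrix_diff_rdistrib: "(D - E) ** F = D ** F - E ** (F :: 'a ^'n ^'m)"
  by (simp_all add: matrix_matrix_mult_def vec_eq_iff algebra_simps sum_subtractf)

lemma psd_qtr_mono:
  assumes "psd A" "psd (C - B)"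
  shows "Re (qtr (A ** B)) \<le> Re (qtr (A ** C))"
  using psd_qtr_mult_nonneg[OF assms] by (simp add: matrix_diff_ldistrib qtr_diff)

lemma psd_mfun:
  assumes "psd A" "\<And>x. x \<ge> 0 \<Longrightarrow> f x \<ge> 0"
  shows "psd (mfun f A)"
proof -
  obtain U d where U: "unitary U" "A = U ** rdiag d ** adj U" "\<And>k. d k \<ge> 0"
    using psd_spectral assms(1) by blast
  have "psd (U ** rdiag (f \<circ> d) ** adj U)"
    using assms(2) U(1,3) by (simp add: psd_spectral_iff)
  then show ?thesis
    unfolding mfun_spectral[OF U(1,2)] .
qed

lemma mfun_mult:
  assumes "psd A" "\<And>x. x \<ge> 0 \<Longrightarrow> f x * g x = h x"
  shows "mfun f A ** mfun g A = mfun h A"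
proof -
  obtain U d where U: "unitary U" "A = U ** rdiag d ** adj U" "\<And>k. d k \<ge> 0"
    using psd_spectral assms(1) by blast
  have "(U ** rdiag (f \<circ> d) ** adj U) ** (U ** rdiag (g \<circ> d) ** adj U) = U ** (rdiag (f \<circ> d) ** rdiag (g \<circ> d)) ** adj U"
    by (metis U(1) matrix_mul_assoc matrix_mul_lid unitary_def)
  moreover have "(\<lambda>i. (f \<circ> d) i * (g \<circ> d) i) = h \<circ> d"
    using assms(2) U(3) by auto
  ultimately show ?thesis
    by (simp add: mfun_spectral[OF U(1,2)] rdiag_mult)
qed

lemma mfun_id: assumes "psd A" shows "mfun (\<lambda>x. x) A = A"
proof -
  obtain U d where U: "unitary U" "A = U ** rdiag d ** adj U"
    using psd_spectral assms by blast
  then show ?thesis using mfun_spectral[OF U, of "\<lambda>x. x"] by (simp add: comp_def)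
qed

section \<open>Operator monotonicity of powers\<close>

lemma quadratic_le:
  fixes a b :: complex and k :: real
  assumes "k > 0"
  shows "2 * Re (cnj a * b) - k * (cmod b)\<^sup>2 \<le> (cmod a)\<^sup>2 / k"
proof -
  have "0 \<le> (cmod (a - complex_of_real k * b))\<^sup>2" by simp
  also have "\<dots> = (cmod a)\<^sup>2 - 2 * k * Re (cnj a * b) + k\<^sup>2 * (cmod b)\<^sup>2"
    unfolding cmod_power2 by (simp add: power2_eq_square algebra_simps)
  finally show ?thesis using assms by (simp add: field_simps power2_eq_square)
qed

text \<open>The right side is the form of \<open>(A + t)^(-1)\<close> at \<open>v\<close>, and the
  left side is a concave functional of \<open>w\<close> of which it is the maximum. The functional
  decreases in \<open>A\<close>, so the inverse reverses the order.\<close>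

lemma resolvent_upper:
  assumes U: "unitary U" and A: "A = U ** rdiag d ** adj U" and d: "\<And>k. d k \<ge> 0" and t: "t > 0"
  shows "2 * Re (cinner v w) - Re (cinner w (A *v w)) - t * (norm w)\<^sup>2
     \<le> (\<Sum>k\<in>UNIV. (cmod ((adj U *v v) $ k))\<^sup>2 / (d k + t))"
proof -
  let ?v = "adj U *v v" and ?w = "adj U *v w"
  have "2 * Re (cinner v w) - Re (cinner w (A *v w)) - t * (norm w)\<^sup>2
     = 2 * Re (cinner ?v ?w) - (\<Sum>k\<in>UNIV. d k * (cmod (?w $ k))\<^sup>2) - t * (\<Sum>k\<in>UNIV. (cmod (?w $ k))\<^sup>2)"
    unfolding unitary_cinner[OF U] unitary_norm[OF U] A spectral_form by simp
  also have "\<dots> = (\<Sum>k\<in>UNIV. 2 * Re (cnj (?v $ k) * ?w $ k) - (d k + t) * (cmod (?w $ k))\<^sup>2)"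
    by (simp add: cinner_def sum_distrib_left sum.distrib sum_subtractf algebra_simps)
  also have "\<dots> \<le> (\<Sum>k\<in>UNIV. (cmod (?v $ k))\<^sup>2 / (d k + t))"
    using d t by (intro sum_mono quadratic_le) (simp add: add_nonneg_pos)
  finally show ?thesis .
qed

lemma resolvent_attained:
  assumes U: "unitary U" and A: "A = U ** rdiag d ** adj U" and d: "\<And>k. d k \<ge> 0" and t: "t > 0"
  obtains w where "2 * Re (cinner v w) - Re (cinner w (A *v w)) - t * (norm w)\<^sup>2
     = (\<Sum>k\<in>UNIV. (cmod ((adj U *v v) $ k))\<^sup>2 / (d k + t))"
proof -
  let ?v = "adj U *v v"
  define w where "w = U *v (\<chi> k. ?v $ k / complex_of_real (d k + t))"
  have w: "(adj U *v w) $ k = ?v $ k / complex_of_real (d k + t)" for k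
    using U by (simp add: w_def matrix_vector_mul_assoc unitary_def)
  let ?w = "adj U *v w"
  have dt: "d k + t > 0" for k using d t by (simp add: add_nonneg_pos)
  have "2 * Re (cinner v w) - Re (cinner w (A *v w)) - t * (norm w)\<^sup>2
     = 2 * Re (cinner ?v ?w) - (\<Sum>k\<in>UNIV. d k * (cmod (?w $ k))\<^sup>2) - t * (\<Sum>k\<in>UNIV. (cmod (?w $ k))\<^sup>2)"
    unfolding unitary_cinner[OF U] unitary_norm[OF U] A spectral_form by simp
  also have "\<dots> = (\<Sum>k\<in>UNIV. 2 * Re (cnj (?v $ k) * ?w $ k) - (d k + t) * (cmod (?w $ k))\<^sup>2)"
    by (simp add: cinner_def sum_distrib_left sum.distrib sum_subtractf algebra_simps)
  also have "\<dots> = (\<Sum>k\<in>UNIV. (cmod (?v $ k))\<^sup>2 / (d k + t))"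
  proof (rule sum.cong[OF refl])
    fix k
    have "cnj (?v $ k) * ?w $ k = complex_of_real ((cmod (?v $ k))\<^sup>2 / (d k + t))"
      unfolding w using complex_norm_square[of "?v $ k"] by (simp add: mult.commute)
    then have 1: "Re (cnj (?v $ k) * ?w $ k) = (cmod (?v $ k))\<^sup>2 / (d k + t)"
      by (metis Re_complex_of_real)
    have 2: "cmod (?w $ k) = cmod (?v $ k) / (d k + t)"
      using dt[of k] unfolding w norm_divide norm_of_real by simp
    show "2 * Re (cnj (?v $ k) * ?w $ k) - (d k + t) * (cmod (?w $ k))\<^sup>2 = (cmod (?v $ k))\<^sup>2 / (d k + t)"
      unfolding 1 2 using dt[of k] by (simp add: power2_eq_square)
  qed
  finally show ?thesis using that by blast
qed

text \<open>Since \<open>x / (x + t) = 1 - t / (x + t)\<close>, this is the order reversal of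
  resolvents: the maximiser \<open>w\<close> for \<open>B\<close> is inserted in the upper bound for
  \<open>A\<close>.\<close>

lemma resolvent_mono:
  fixes U V :: "'n::finite cmat"
  assumes U: "unitary U" "A = U ** rdiag d ** adj U" "\<And>k. d k \<ge> 0"
    and V: "unitary V" "B = V ** rdiag e ** adj V" "\<And>k. e k \<ge> 0"
    and AB: "psd (B - A)" and t: "t > 0"
  shows "(\<Sum>k\<in>UNIV. d k / (d k + t) * (cmod ((adj U *v v) $ k))\<^sup>2) \<le> (\<Sum>k\<in>UNIV. e k / (e k + t) * (cmod ((adj V *v v) $ k))\<^sup>2)"
proof -
  have split: "(\<Sum>k\<in>UNIV. d k / (d k + t) * (cmod ((adj U *v v) $ k))\<^sup>2) = (norm v)\<^sup>2 - t * (\<Sum>k\<in>UNIV. (cmod ((adj U *v v) $ k))\<^sup>2 / (d k + t))"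
    if "unitary U" "\<And>k. d k \<ge> 0" for U and d :: "'n \<Rightarrow> real" and v :: "complex^'n"
  proof -
    have "d k / (d k + t) * (cmod ((adj U *v v) $ k))\<^sup>2 = (cmod ((adj U *v v) $ k))\<^sup>2 - t * ((cmod ((adj U *v v) $ k))\<^sup>2 / (d k + t))" for k
      using that(2)[of k] t by (simp add: field_simps)
    then show ?thesis
      by (simp add: sum_subtractf sum_distrib_left flip: unitary_norm[OF that(1), of v])
  qed
  obtain w where w: "2 * Re (cinner v w) - Re (cinner w (B *v w)) - t * (norm w)\<^sup>2
     = (\<Sum>k\<in>UNIV. (cmod ((adj V *v v) $ k))\<^sup>2 / (e k + t))"
    using resolvent_attained[OF V t] by blast
  have "Re (cinner w (A *v w)) \<le> Re (cinner w (B *v w))"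
    using AB by (simp add: psd_def matrix_vector_mult_diff_rdistrib cinner_diff_right)
  with resolvent_upper[OF U t, of v w] w
  have "(\<Sum>k\<in>UNIV. (cmod ((adj V *v v) $ k))\<^sup>2 / (e k + t)) \<le> (\<Sum>k\<in>UNIV. (cmod ((adj U *v v) $ k))\<^sup>2 / (d k + t))"
    by linarith
  then show ?thesis
    unfolding split[OF U(1,3)] split[OF V(1,3)] using t by simp
qed

section \<open>Powers as mixtures of resolvent functions\<close>

lemma integrable_exp_density:
  "l > 0 \<Longrightarrow> integrable lborel (exponential_density l)"
proof -
  assume l: "l > 0"
  interpret prob_space "Nonnegative_Lebesgue_Integration.density lborel (exponential_density l)" by (rule prob_space_exponential_density[OF l])
  have "integrable (Nonnegative_Lebesgue_Integration.density lborel (exponential_density l)) (\<lambda>x. 1 :: real)" by simp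
  then show ?thesis
    by (subst (asm) integrable_density) (auto simp: exponential_density_nonneg[OF l])
qed

text \<open>The kernel decays like \<open>exp (- (1 - s) u)\<close> on the right and like
  \<open>exp (s u)\<close> on the left, so two multiples of exponential densities, one of them
  reflected, dominate it.\<close>

lemma integrable_power_kernel:
  fixes s :: real
  assumes s: "0 < s" "s < 1"
  shows "integrable lborel (\<lambda>u. exp (s * u) / (1 + exp u))"
proof (rule Bochner_Integration.integrable_bound)
  show "integrable lborel (\<lambda>u. 1 / (1 - s) * exponential_density (1 - s) u + 1 / s * exponential_density s (0 + (-1) * u))"
    using s by (intro Bochner_Integration.integrable_add integrable_mult_right lborel_integrable_real_affine integrable_exp_density) auto
  show "AE u in lborel. norm (exp (s * u) / (1 + exp u)) \<le> norm (1 / (1 - s) * exponential_density (1 - s) u + 1 / s * exponential_density s (0 + (-1) * u))"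
  proof (rule AE_I2)
    fix u :: real
    have "exp (s * u) / (1 + exp u) \<le> exp (s * u) / exp u"
      by (intro divide_left_mono mult_pos_pos add_pos_pos) auto
    also have "\<dots> = exp (- u * (1 - s))" by (simp add: exp_diff[symmetric] algebra_simps)
    finally have 1: "exp (s * u) / (1 + exp u) \<le> exp (- u * (1 - s))" .
    have "exp (s * u) / (1 + exp u) \<le> exp (s * u) / 1"
      by (intro divide_left_mono mult_pos_pos add_pos_pos) auto
    then have 2: "exp (s * u) / (1 + exp u) \<le> exp (u * s)" by (simp add: mult.commute)
    show "norm (exp (s * u) / (1 + exp u)) \<le> norm (1 / (1 - s) * exponential_density (1 - s) u + 1 / s * exponential_density s (0 + (-1) * u))"
      using s 1 2 by (auto simp: exponential_density_def abs_of_nonneg add_nonneg_nonneg)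
  qed
qed measurable

text \<open>The integral of \<open>t^(s - 1) / (1 + t)\<close> over \<open>t > 0\<close> after
  \<open>t = exp u\<close>, that is \<open>pi / sin (pi s)\<close>. Its positivity allows dividing
  by it.\<close>

definition power_const :: "real \<Rightarrow> real" where
  "power_const s = (\<integral>u. exp (s * u) / (1 + exp u) \<partial>lborel)"

lemma power_const_pos:
  assumes "0 < s" "s < 1"
  shows "power_const s > 0"
proof -
  have "power_const s \<noteq> 0"
  proof
    assume "power_const s = 0"
    then have "AE u in lborel. exp (s * u) / (1 + exp u) = 0"
      unfolding power_const_def
      by (subst (asm) integral_nonneg_eq_0_iff_AE[OF integrable_power_kernel[OF assms]]) (auto simp: add_nonneg_nonneg)
    moreover have "exp (s * u) / (1 + exp u) \<noteq> 0" for u :: real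
      by (simp add: add_pos_pos less_imp_neq[THEN not_sym])
    ultimately have "AE u in (lborel :: real measure). False" by simp
    then show False by (simp add: ae_filter_eq_bot_iff eventually_False)
  qed
  moreover have "power_const s \<ge> 0"
    unfolding power_const_def by (intro integral_nonneg_AE) (auto simp: add_nonneg_nonneg)
  ultimately show ?thesis by simp
qed

text \<open>The translation \<open>u = ln x + w\<close> is the scaling of \<open>t = exp u\<close>
  by \<open>x\<close>, which pulls out the factor \<open>x powr s\<close>.\<close>

lemma power_integral:
  fixes s x :: real
  assumes s: "0 < s" "s < 1" and x: "x \<ge> 0"
  shows "has_bochner_integral lborel (\<lambda>u. exp (s * u) * (x / (x + exp u))) (power_const s * x powr s)"
proof (cases "x = 0")
  case False
  then have x: "x > 0" using x by simp
  let ?f = "\<lambda>u. exp (s * u) * (x / (x + exp u))"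
  have eq: "?f (ln x + 1 * w) = x powr s * (exp (s * w) / (1 + exp w))" for w
  proof -
    have "x / (x + exp (ln x + 1 * w)) = x / (x * (1 + exp w))"
      using x by (simp add: exp_add algebra_simps)
    also have "\<dots> = 1 / (1 + exp w)" using x by (rule_tac nonzero_divide_mult_cancel_left) simp
    finally have e: "x / (x + exp (ln x + 1 * w)) = 1 / (1 + exp w)" .
    have "exp (s * (ln x + 1 * w)) = x powr s * exp (s * w)"
      using x by (simp add: powr_def exp_add algebra_simps)
    then show ?thesis unfolding e by simp
  qed
  have i: "integrable lborel (\<lambda>w. ?f (ln x + 1 * w))"
    unfolding eq by (intro integrable_mult_right integrable_power_kernel s)
  then have "integrable lborel ?f"
    by (subst (asm) lborel_integrable_real_affine_iff) simp_all
  moreover have "integral\<^sup>L lborel ?f = \<bar>1\<bar> *\<^sub>R (\<integral>w. ?f (ln x + 1 * w) \<partial>lborel)"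
    by (rule lborel_integral_real_affine) simp
  ultimately show ?thesis
    unfolding has_bochner_integral_iff eq integral_mult_right_zero by (simp add: power_const_def)
qed (simp add: has_bochner_integral_iff)

text \<open>\<open>x powr s\<close> is a positive mixture of the functions
  \<open>x / (x + t)\<close>, each monotone for the operator order by
  \<open>resolvent_mono\<close>.\<close>

theorem Loewner_Heinz:
  fixes A B :: "'n::finite cmat"
  assumes A: "psd A" and B: "psd B" and AB: "psd (B - A)" and s: "0 < s" "s < 1"
  shows "psd (mfun (\<lambda>x. x powr s) B - mfun (\<lambda>x. x powr s) A)"
proof -
  obtain U d where U: "unitary U" "A = U ** rdiag d ** adj U" "\<And>k. d k \<ge> 0"
    using psd_spectral A by blast
  obtain V e where V: "unitary V" "B = V ** rdiag e ** adj V" "\<And>k. e k \<ge> 0"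
    using psd_spectral B by blast
  let ?p = "\<lambda>x::real. x powr s"
  have int: "has_bochner_integral lborel (\<lambda>u. exp (s * u) * (\<Sum>k\<in>UNIV. d k / (d k + exp u) * (cmod ((adj U *v v) $ k))\<^sup>2))
      (power_const s * Re (cinner v (mfun ?p A *v v)))"
    if U: "unitary U" "A = U ** rdiag d ** adj U" "\<And>k. d k \<ge> 0" for A U :: "'n cmat" and d v
  proof -
    have "has_bochner_integral lborel (\<lambda>u. (\<Sum>k\<in>UNIV. exp (s * u) * (d k / (d k + exp u)) * (cmod ((adj U *v v) $ k))\<^sup>2))
      (\<Sum>k\<in>UNIV. power_const s * d k powr s * (cmod ((adj U *v v) $ k))\<^sup>2)"
      by (intro has_bochner_integral_sum has_bochner_integral_mult_left power_integral s U)
    then show ?thesis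
      by (simp add: mfun_spectral[OF U(1,2)] spectral_form sum_distrib_left mult.assoc)
  qed
  have "power_const s * Re (cinner v (mfun ?p A *v v)) \<le> power_const s * Re (cinner v (mfun ?p B *v v))" for v
    using integral_mono[OF integrable.intros[OF int[OF U, of v]] integrable.intros[OF int[OF V, of v]]]
      resolvent_mono[OF U V AB, of "exp _" v]
      has_bochner_integral_integral_eq[OF int[OF U, of v]] has_bochner_integral_integral_eq[OF int[OF V, of v]] by simp
  then have "Re (cinner v (mfun ?p A *v v)) \<le> Re (cinner v (mfun ?p B *v v))" for v
    using power_const_pos[OF s] by (simp add: mult_le_cancel_left_pos)
  moreover have "psd (mfun ?p A)" "psd (mfun ?p B)" using A B by (auto intro!: psd_mfun)
  ultimately show ?thesis
    by (auto simp: psd_def matrix_vector_mult_diff_rdistrib cinner_diff_right)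
qed

section \<open>The quantum Chernoff bound\<close>

text \<open>The left side is the least total error \<open>Tr A (1 - P) + Tr B P\<close> over
  projections \<open>P\<close>. The positive part \<open>D\<close> of \<open>A - B\<close> gives a
  common upper bound \<open>C = B + D\<close> of \<open>A\<close> and \<open>B\<close>; monotone
  powers replace \<open>A\<close> by \<open>C\<close> in both factors and then
  \<open>C powr s\<close> by \<open>B powr s\<close>, leaving
  \<open>Tr C - Tr B = Tr D\<close>.\<close>

theorem Audenaert_inequality:
  fixes A B :: "'n::finite cmat"
  assumes A: "psd A" and B: "psd B" and s: "0 < s" "s < 1"
    and V: "unitary V" "A - B = V ** rdiag e ** adj V"
  shows "Re (qtr A) - (\<Sum>k\<in>UNIV. max 0 (e k)) \<le> Re (qtr (mfun (\<lambda>x. x powr s) A ** mfun (\<lambda>x. x powr (1 - s)) B))"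
proof -
  define D where "D = V ** rdiag (\<lambda>k. max 0 (e k)) ** adj V"
  define C where "C = B + D"
  let ?p = "\<lambda>s X. mfun (\<lambda>x. x powr s) (X :: 'n cmat)"
  have psd_add: "psd (X + Y)" if "psd X" "psd Y" for X Y :: "'n cmat"
    using that by (auto simp: psd_def matrix_vector_mult_add_rdistrib cinner_add_right)
  have D: "psd D" using V by (simp add: D_def psd_spectral_iff)
  have C: "psd C" using B D psd_add by (simp add: C_def)
  have "C - A = D - (A - B)" by (simp add: C_def)
  also have "\<dots> = V ** rdiag (\<lambda>k. max 0 (e k) - e k) ** adj V"
    unfolding V D_def by (simp add: matrix_diff_ldistrib matrix_diff_rdistrib flip: rdiag_diff)
  finally have CA: "psd (C - A)" using V by (simp add: psd_spectral_iff)
  have CB: "psd (C - B)" using D by (simp add: C_def)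
  have trD: "Re (qtr D) = (\<Sum>k\<in>UNIV. max 0 (e k))"
    using V by (simp add: D_def qtr_spectral)
  have pw: "?p s X ** ?p (1 - s) X = X" if "psd X" for X :: "'n cmat"
  proof -
    have "?p s X ** ?p (1 - s) X = mfun (\<lambda>x. x) X"
      using that by (rule mfun_mult) (simp add: powr_add[symmetric])
    then show ?thesis using mfun_id[OF that] by simp
  qed
  have s': "0 < 1 - s" "1 - s < 1" using s by auto
  have psdp: "psd (?p r X)" if "psd X" for r and X :: "'n cmat" using that by (rule psd_mfun) simp
  have "Re (qtr A) - Re (qtr (?p s A ** ?p (1 - s) B)) = Re (qtr (?p s A ** (?p (1 - s) A - ?p (1 - s) B)))"
    by (simp add: matrix_diff_ldistrib qtr_diff pw[OF A])
  also have "\<dots> \<le> Re (qtr (?p s A ** (?p (1 - s) C - ?p (1 - s) B)))"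
    using Loewner_Heinz[OF A C CA s'] by (intro psd_qtr_mono psdp A) simp
  also have "\<dots> = Re (qtr ((?p (1 - s) C - ?p (1 - s) B) ** ?p s A))"
    by (subst qtr_mult_commute) simp
  also have "\<dots> \<le> Re (qtr ((?p (1 - s) C - ?p (1 - s) B) ** ?p s C))"
    by (intro psd_qtr_mono Loewner_Heinz A B C CA CB s s')
  also have "\<dots> = Re (qtr (?p s C ** ?p (1 - s) C)) - Re (qtr (?p (1 - s) B ** ?p s C))"
    by (simp add: matrix_diff_rdistrib qtr_diff qtr_mult_commute[of "?p (1 - s) C"])
  also have "\<dots> \<le> Re (qtr C) - Re (qtr (?p (1 - s) B ** ?p s B))"
    unfolding pw[OF C] using psd_qtr_mono[OF psdp[OF B] Loewner_Heinz[OF B C CB s]] by simp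
  also have "\<dots> = Re (qtr D)"
    by (simp add: qtr_mult_commute[of "?p (1 - s) B"] pw[OF B] C_def qtr_add)
  finally show ?thesis using trD by simp
qed

section \<open>The trace norm of Hermitian matrices\<close>

lemma trace_norm_spectral:
  assumes U: "unitary U" and D: "D = U ** rdiag d ** adj U"
  shows "trace_norm D = (\<Sum>k\<in>UNIV. \<bar>d k\<bar>)"
proof -
  have "adj D ** D = U ** rdiag (\<lambda>k. d k * d k) ** adj U"
    unfolding D herm_spectral rdiag_mult[symmetric] by (metis U matrix_mul_assoc matrix_mul_lid unitary_def)
  then have "mfun sqrt (adj D ** D) = U ** rdiag (sqrt \<circ> (\<lambda>k. d k * d k)) ** adj U"
    by (rule mfun_spectral[OF U])
  moreover have "sqrt \<circ> (\<lambda>k. d k * d k) = (\<lambda>k. \<bar>d k\<bar>)"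
    by (rule ext) (simp only: comp_def real_sqrt_abs2)
  ultimately show ?thesis
    by (simp add: trace_norm_def qtr_spectral[OF U])
qed

lemma trace_norm_dual:
  assumes D: "adj D = D" and M: "\<And>v. \<bar>Re (cinner v (M *v v))\<bar> \<le> (norm v)\<^sup>2"
  shows "Re (qtr (D ** M)) \<le> trace_norm D"
proof -
  obtain U d where U: "unitary U" "D = U ** rdiag d ** adj U" using spectral_theorem[OF D] by blast
  have "Re (qtr (D ** M)) = (\<Sum>k\<in>UNIV. d k * Re (cinner (column k U) (M *v column k U)))"
    unfolding U(2) qtr_spectral_mult by simp
  also have "\<dots> \<le> (\<Sum>k\<in>UNIV. \<bar>d k\<bar>)"
  proof (rule sum_mono)
    fix k
    have "d k * Re (cinner (column k U) (M *v column k U)) \<le> \<bar>d k\<bar> * \<bar>Re (cinner (column k U) (M *v column k U))\<bar>"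
      by (metis abs_ge_self abs_mult)
    also have "\<dots> \<le> \<bar>d k\<bar> * 1"
      using M[of "column k U"] by (intro mult_left_mono) (simp_all add: unitary_column_norm[OF U(1)])
    finally show "d k * Re (cinner (column k U) (M *v column k U)) \<le> \<bar>d k\<bar>" by simp
  qed
  finally show ?thesis by (simp add: trace_norm_spectral[OF U])
qed

lemma trace_norm_attained:
  fixes D :: "'n::finite cmat"
  assumes D: "adj D = D"
  obtains M :: "'n cmat" where "\<And>v. \<bar>Re (cinner v (M *v v))\<bar> \<le> (norm v)\<^sup>2" "Re (qtr (D ** M)) = trace_norm D"
proof -
  obtain U d where U: "unitary U" "D = U ** rdiag d ** adj U" using spectral_theorem[OF D] by blast
  define M where "M = U ** rdiag (sgn \<circ> d) ** adj U"
  have "\<bar>Re (cinner v (M *v v))\<bar> \<le> (norm v)\<^sup>2" for v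
  proof -
    have "\<bar>Re (cinner v (M *v v))\<bar> \<le> (\<Sum>k\<in>UNIV. \<bar>sgn (d k) * (cmod ((adj U *v v) $ k))\<^sup>2\<bar>)"
      unfolding M_def spectral_form by (simp add: sum_abs)
    also have "\<dots> \<le> (\<Sum>k\<in>UNIV. (cmod ((adj U *v v) $ k))\<^sup>2)"
      by (intro sum_mono) (auto simp: abs_mult sgn_if)
    finally show ?thesis by (simp add: unitary_norm[OF U(1)])
  qed
  moreover have "D ** M = U ** rdiag (\<lambda>k. \<bar>d k\<bar>) ** adj U"
  proof -
    have "D ** M = U ** (rdiag d ** rdiag (sgn \<circ> d)) ** adj U"
      unfolding U(2) M_def by (metis U(1) matrix_mul_assoc matrix_mul_lid unitary_def)
    then show ?thesis by (simp add: rdiag_mult abs_sgn)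
  qed
  ultimately show ?thesis
    using that[of M] by (simp add: trace_norm_spectral[OF U] qtr_spectral[OF U(1)])
qed

text \<open>Each eigenvalue is the form at a unit vector, whose entries have modulus at most 1. This
  crude bound serves to prove continuity.\<close>

lemma trace_norm_le_entries:
  fixes D :: "'n::finite cmat"
  assumes D: "adj D = D"
  shows "trace_norm D \<le> real CARD('n) * (\<Sum>i\<in>UNIV. \<Sum>j\<in>UNIV. cmod (D $ i $ j))"
proof -
  obtain U d where U: "unitary U" "D = U ** rdiag d ** adj U" using spectral_theorem[OF D] by blast
  have "\<bar>d k\<bar> \<le> (\<Sum>i\<in>UNIV. \<Sum>j\<in>UNIV. cmod (D $ i $ j))" for k
  proof -
    let ?u = "column k U"
    have u: "cmod (?u $ i) \<le> 1" for i
      by (metis Finite_Cartesian_Product.norm_nth_le U(1) unitary_column_norm)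
    have "adj U ** D ** U = rdiag d"
      unfolding U(2) by (metis U(1) matrix_mul_assoc matrix_mul_lid matrix_mul_rid unitary_def)
    then have "complex_of_real (d k) = cinner ?u (D *v ?u)"
      by (simp add: column_conj rdiag_def)
    also have "\<dots> = (\<Sum>i\<in>UNIV. \<Sum>j\<in>UNIV. cnj (?u $ i) * (D $ i $ j * ?u $ j))"
      by (simp add: cinner_def matrix_vector_mult_def sum_distrib_left)
    finally have "\<bar>d k\<bar> = cmod (\<Sum>i\<in>UNIV. \<Sum>j\<in>UNIV. cnj (?u $ i) * (D $ i $ j * ?u $ j))"
      by (metis norm_of_real)
    also have "\<dots> \<le> (\<Sum>i\<in>UNIV. \<Sum>j\<in>UNIV. cmod (cnj (?u $ i) * (D $ i $ j * ?u $ j)))"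
      by (intro order_trans[OF norm_sum] sum_mono norm_sum)
    also have "\<dots> \<le> (\<Sum>i\<in>UNIV. \<Sum>j\<in>UNIV. cmod (D $ i $ j))"
    proof (intro sum_mono)
      fix i j
      have "cmod (cnj (?u $ i) * (D $ i $ j * ?u $ j)) = (cmod (?u $ i) * cmod (?u $ j)) * cmod (D $ i $ j)"
        by (simp add: norm_mult)
      also have "\<dots> \<le> 1 * cmod (D $ i $ j)"
        using u by (intro mult_right_mono mult_le_one) auto
      finally show "cmod (cnj (?u $ i) * (D $ i $ j * ?u $ j)) \<le> cmod (D $ i $ j)" by simp
    qed
    finally show ?thesis .
  qed
  then show ?thesis
    using sum_bounded_above[of UNIV "\<lambda>k. \<bar>d k\<bar>"] by (simp add: trace_norm_spectral[OF U])
qed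

lemma trace_norm_diff_le:
  assumes "adj D = D" "adj E = E"
  shows "trace_norm D - trace_norm E \<le> trace_norm (D - E)"
proof -
  obtain M where M: "\<And>v. \<bar>Re (cinner v (M *v v))\<bar> \<le> (norm v)\<^sup>2" "Re (qtr (D ** M)) = trace_norm D"
    using trace_norm_attained[OF assms(1)] by blast
  have "trace_norm D = Re (qtr ((D - E) ** M)) + Re (qtr (E ** M))"
    using M(2) by (simp add: matrix_diff_rdistrib qtr_diff)
  also have "\<dots> \<le> trace_norm (D - E) + trace_norm E"
    using M(1) assms by (intro add_mono trace_norm_dual) (simp_all add: adj_diff)
  finally show ?thesis by simp
qed

text \<open>The triangle inequality combined with the entrywise bound. Together with compactness of
  the unitary group it makes the integrand of the theorem integrable.\<close>

lemma continuous_on_trace_norm: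
  fixes D :: "'a::topological_space \<Rightarrow> 'n::finite cmat"
  assumes h: "\<And>x. x \<in> S \<Longrightarrow> adj (D x) = D x" and cont: "continuous_on S D"
  shows "continuous_on S (\<lambda>x. trace_norm (D x))"
  unfolding continuous_on_def
proof
  fix x assume x: "x \<in> S"
  let ?b = "\<lambda>y. real CARD('n) * (\<Sum>i\<in>UNIV. \<Sum>j\<in>UNIV. cmod ((D y - D x) $ i $ j))"
  have "continuous_on S ?b" by (intro continuous_intros cont)
  then have "(?b \<longlongrightarrow> ?b x) (at x within S)" using x unfolding continuous_on_def by blast
  then have lim: "(?b \<longlongrightarrow> 0) (at x within S)" by simp
  have le: "norm (trace_norm (D y) - trace_norm (D x)) \<le> ?b y" if y: "y \<in> S" for y
  proof -
    have c: "(\<Sum>i\<in>UNIV. \<Sum>j\<in>UNIV. cmod ((D x - D y) $ i $ j)) = (\<Sum>i\<in>UNIV. \<Sum>j\<in>UNIV. cmod ((D y - D x) $ i $ j))"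
      by (simp add: norm_minus_commute)
    show "norm (trace_norm (D y) - trace_norm (D x)) \<le> ?b y"
      using trace_norm_diff_le[OF h[OF x] h[OF y]] trace_norm_diff_le[OF h[OF y] h[OF x]]
        trace_norm_le_entries[of "D x - D y"] trace_norm_le_entries[of "D y - D x"] h[OF x] h[OF y]
      unfolding c by (simp add: adj_diff abs_le_iff norm_minus_commute[of "D x $ _ $ _"])
  qed
  then have "\<forall>\<^sub>F y in at x within S. norm (trace_norm (D y) - trace_norm (D x)) \<le> ?b y"
    by (auto simp: eventually_at_filter)
  then have "((\<lambda>y. trace_norm (D y) - trace_norm (D x)) \<longlongrightarrow> 0) (at x within S)"
    using lim by (rule Lim_null_comparison)
  then show "((\<lambda>y. trace_norm (D y)) \<longlongrightarrow> trace_norm (D x)) (at x within S)"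
    by (simp add: LIM_zero_iff)
qed

text \<open>As \<open>D\<close> has trace zero, \<open>Tr D M\<close> is half of
  \<open>Tr D (2 M - 1)\<close>, and the form of \<open>2 M - 1\<close> lies between -1 and 1 on
  unit vectors.\<close>

lemma trace_norm_test:
  assumes D: "adj D = D" and tr: "qtr D = 0"
    and M: "\<And>v. 0 \<le> Re (cinner v (M *v v))" "\<And>v. Re (cinner v (M *v v)) \<le> (norm v)\<^sup>2"
  shows "Re (qtr (D ** M)) \<le> 1 / 2 * trace_norm D"
proof -
  have "Re (cinner v ((M + M - mat 1) *v v)) = 2 * Re (cinner v (M *v v)) - (norm v)\<^sup>2" for v
    unfolding matrix_vector_mult_diff_rdistrib matrix_vector_mult_add_rdistrib cinner_add_right cinner_diff_right
    by (simp add: cinner_self)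
  then have "\<bar>Re (cinner v ((M + M - mat 1) *v v))\<bar> \<le> (norm v)\<^sup>2" for v
    using M[of v] by (simp add: abs_le_iff)
  then have "Re (qtr (D ** (M + M - mat 1))) \<le> trace_norm D"
    by (rule trace_norm_dual[OF D])
  moreover have "qtr (D ** (M + M - mat 1)) = 2 * qtr (D ** M)"
    unfolding matrix_diff_ldistrib matrix_add_ldistrib qtr_add qtr_diff by (simp add: tr)
  ultimately show ?thesis by simp
qed

section \<open>A test built from a random family of vectors\<close>

text \<open>The frame operator \<open>F F\<^sup>\<dagger>\<close> of the family. The labels form a
  set because later they run over the positive eigenvalues only; with \<open>f k\<close> the image
  under \<open>K\<close> of an orthonormal basis of the range of \<open>P\<close> it is
  \<open>K P K\<^sup>\<dagger>\<close>.\<close>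

definition frame :: "'k set \<Rightarrow> ('k \<Rightarrow> complex^'z::finite) \<Rightarrow> 'z cmat" where
  "frame S f = (\<chi> i j. \<Sum>k\<in>S. f k $ i * cnj (f k $ j))"

lemma frame_vec: "frame S f *v v = (\<Sum>k\<in>S. cinner (f k) v *s f k)"
proof -
  have "(frame S f *v v) $ i = (\<Sum>j\<in>UNIV. \<Sum>k\<in>S. f k $ i * cnj (f k $ j) * v $ j)" for i
    by (simp add: frame_def matrix_vector_mult_def sum_distrib_right)
  also have "\<dots>i = (\<Sum>k\<in>S. \<Sum>j\<in>UNIV. f k $ i * cnj (f k $ j) * v $ j)" for i
    by (rule sum.swap)
  finally show ?thesis
    by (simp add: vec_eq_iff cinner_def sum_distrib_right sum_distrib_left mult_ac)
qed

lemma frame_form: "cinner v (frame S f *v v) = complex_of_real (\<Sum>k\<in>S. (cmod (cinner (f k) v))\<^sup>2)"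
proof -
  have "cinner v (frame S f *v v) = (\<Sum>k\<in>S. cinner (f k) v * cinner v (f k))"
    by (simp add: frame_vec cinner_sum_right cinner_scale_right)
  also have "\<dots> = (\<Sum>k\<in>S. complex_of_real ((cmod (cinner (f k) v))\<^sup>2))"
    by (intro sum.cong refl) (metis cinner_commute complex_norm_square)
  finally show ?thesis by simp
qed

lemma psd_frame: "psd (frame S f)"
  unfolding psd_def frame_form by (simp add: sum_nonneg)

lemma qtr_frame_mult: "qtr (frame S f ** Y) = (\<Sum>k\<in>S. cinner (f k) (Y *v f k))"
proof -
  have "qtr (frame S f ** Y) = (\<Sum>i\<in>UNIV. \<Sum>j\<in>UNIV. \<Sum>k\<in>S. f k $ i * cnj (f k $ j) * Y $ j $ i)"
    by (simp add: qtr_def matrix_matrix_mult_def frame_def sum_distrib_right)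
  also have "\<dots> = (\<Sum>i\<in>UNIV. \<Sum>k\<in>S. \<Sum>j\<in>UNIV. f k $ i * cnj (f k $ j) * Y $ j $ i)"
    by (intro sum.cong refl sum.swap)
  also have "\<dots> = (\<Sum>k\<in>S. \<Sum>i\<in>UNIV. \<Sum>j\<in>UNIV. f k $ i * cnj (f k $ j) * Y $ j $ i)"
    by (rule sum.swap)
  also have "\<dots> = (\<Sum>k\<in>S. \<Sum>j\<in>UNIV. \<Sum>i\<in>UNIV. f k $ i * cnj (f k $ j) * Y $ j $ i)"
    by (intro sum.cong refl sum.swap)
  finally show ?thesis
    by (simp add: cinner_def matrix_vector_mult_def sum_distrib_left sum_distrib_right mult_ac)
qed

text \<open>A smoothed projection onto large eigenvalues. The slope bound \<open>5 / 3\<close> is what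
  produces the constant \<open>4 / 3\<close> in the end: \<open>3 / 4 * (4 / 3) + 5 / 3 = 2 * (4 / 3)\<close>.\<close>

definition ramp :: "real \<Rightarrow> real" where
  "ramp g = max 0 (1 - 6 * (1 - g)\<^sup>2 / (3 + 8 * g))"

lemma ramp_bounds:
  assumes "g \<ge> 0"
  shows "0 \<le> ramp g" "ramp g \<le> 1" "ramp g \<le> 5 / 3 * g" "1 - ramp g \<le> 6 * (1 - g)\<^sup>2 / (3 + 8 * g)"
proof -
  \<comment> \<open>The next line needs \<open>58 / 3 * g^2 - 15 * g + 3 >= 0\<close>, a quadratic
    of discriminant -7; this is that quadratic times \<open>4 * 58 / 3\<close>, with the square
    completed.\<close>
  have "0 \<le> (15 - 116 / 3 * g)\<^sup>2 + 7" by simp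
  then have "3 + 8 * g - 6 * (1 - g)\<^sup>2 \<le> 5 / 3 * g * (3 + 8 * g)"
    by (simp add: power2_eq_square algebra_simps)
  then have "1 - 6 * (1 - g)\<^sup>2 / (3 + 8 * g) \<le> 5 / 3 * g"
    using assms by (simp add: field_simps)
  moreover have "0 \<le> 6 * (1 - g)\<^sup>2 / (3 + 8 * g)" "0 \<le> 5 / 3 * g" using assms by simp_all
  ultimately show "0 \<le> ramp g" "ramp g \<le> 1" "ramp g \<le> 5 / 3 * g" "1 - ramp g \<le> 6 * (1 - g)\<^sup>2 / (3 + 8 * g)"
    unfolding ramp_def by linarith+
qed

lemma Re_mult_le:
  fixes a b :: complex and k :: real
  assumes "k > 0"
  shows "2 * Re (a * b) \<le> (cmod a)\<^sup>2 / k + k * (cmod b)\<^sup>2"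
  using quadratic_le[OF assms, of "cnj a" b] by simp

text \<open>With \<open>F\<close> the matrix of columns \<open>f k\<close>, \<open>p = F\<^sup>\<dagger> \<xi> - x\<close> and \<open>q = \<xi> - F x\<close>, the
  vector \<open>q - F p = (1 - F F\<^sup>\<dagger>) \<xi>\<close> does not depend on \<open>x\<close>; testing it against a suitable
  \<open>w\<close> bounds \<open>p\<close> and \<open>q\<close> from below.\<close>

lemma frame_residual_bound:
  fixes f :: "'k \<Rightarrow> complex^'z::finite"
  assumes V: "unitary V" "frame S f = V ** rdiag g ** adj V" and g: "\<And>k. g k \<ge> 0"
  shows "(\<Sum>k\<in>UNIV. 6 * (1 - g k)\<^sup>2 / (3 + 8 * g k) * (cmod ((adj V *v \<xi>) $ k))\<^sup>2)
    \<le> 3 / 4 * (\<Sum>k\<in>S. (cmod (cinner (f k) \<xi> - x k))\<^sup>2) + 2 * (norm (\<xi> - (\<Sum>k\<in>S. x k *s f k)))\<^sup>2"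
proof -
  define \<theta> where "\<theta> = \<xi> - frame S f *v \<xi>"
  define p where "p k = cinner (f k) \<xi> - x k" for k
  define q where "q = \<xi> - (\<Sum>k\<in>S. x k *s f k)"
  \<comment> \<open>The weights are dual to those of the claim: \<open>4 / 3\<close> is the
    reciprocal of the \<open>3 / 4\<close> at the coefficients \<open>p\<close>, and
    \<open>1 / 2\<close> that of the 2 at \<open>q\<close>. Since
    \<open>4 / 3 * g + 1 / 2 = (3 + 8 * g) / 6\<close>, they give the denominator of
    \<open>ramp\<close>.\<close>
  let ?A = "V ** rdiag (\<lambda>k. 4 / 3 * g k) ** adj V"
  have \<theta>: "\<theta> = q - (\<Sum>k\<in>S. p k *s f k)"
    by (simp add: \<theta>_def q_def p_def frame_vec vec_eq_iff sum_subtractf algebra_simps)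
  obtain w where w: "2 * Re (cinner \<theta> w) - Re (cinner w (?A *v w)) - 1 / 2 * (norm w)\<^sup>2
     = (\<Sum>k\<in>UNIV. (cmod ((adj V *v \<theta>) $ k))\<^sup>2 / (4 / 3 * g k + 1 / 2))"
    using resolvent_attained[OF V(1) refl, of "\<lambda>k. 4 / 3 * g k" "1 / 2" \<theta>] g by auto
  have vt: "(adj V *v \<theta>) $ k = complex_of_real (1 - g k) * (adj V *v \<xi>) $ k" for k
  proof -
    have "adj V *v \<theta> = adj V *v \<xi> - (adj V ** V) *v (rdiag g *v (adj V *v \<xi>))"
      unfolding \<theta>_def V(2) by (simp add: matrix_vector_mult_diff_distrib matrix_vector_mul_assoc matrix_mul_assoc)
    then have "(adj V *v \<theta>) $ k = (adj V *v \<xi>) $ k - (rdiag g *v (adj V *v \<xi>)) $ k"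
      using V(1) by (simp only: unitary_def matrix_vector_mul_lid vector_minus_component)
    then show ?thesis by (simp add: rdiag_vec left_diff_distrib)
  qed
  have rhs: "(cmod ((adj V *v \<theta>) $ k))\<^sup>2 / (4 / 3 * g k + 1 / 2) = 6 * (1 - g k)\<^sup>2 / (3 + 8 * g k) * (cmod ((adj V *v \<xi>) $ k))\<^sup>2" for k
  proof -
    have "4 / 3 * g k + 1 / 2 = (3 + 8 * g k) / 6" by simp
    then show ?thesis
      unfolding vt norm_mult norm_of_real power_mult_distrib power2_abs by (simp only: divide_divide_eq_right) (simp add: mult_ac)
  qed
  have "Re (cinner w (?A *v w)) = 4 / 3 * Re (cinner w (frame S f *v w))"
    unfolding V(2) spectral_form by (simp add: sum_distrib_left mult.assoc)
  then have Aw: "Re (cinner w (?A *v w)) = 4 / 3 * (\<Sum>k\<in>S. (cmod (cinner (f k) w))\<^sup>2)"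
    by (simp add: frame_form)
  have "2 * Re (cinner \<theta> w) = (\<Sum>i\<in>UNIV. 2 * Re (cnj (q $ i) * w $ i)) + (\<Sum>k\<in>S. 2 * Re ((- cnj (p k)) * cinner (f k) w))"
    by (simp add: \<theta> cinner_diff_left cinner_sum_left cinner_scale_left sum_distrib_left cinner_def[of q] algebra_simps flip: sum_negf sum.distrib)
  also have "\<dots> \<le> (\<Sum>i\<in>UNIV. (cmod (cnj (q $ i)))\<^sup>2 / (1 / 2) + 1 / 2 * (cmod (w $ i))\<^sup>2)
     + (\<Sum>k\<in>S. (cmod (- cnj (p k)))\<^sup>2 / (4 / 3) + 4 / 3 * (cmod (cinner (f k) w))\<^sup>2)"
    by (intro add_mono sum_mono Re_mult_le) auto
  also have "\<dots> = 2 * (norm q)\<^sup>2 + 1 / 2 * (norm w)\<^sup>2 + 3 / 4 * (\<Sum>k\<in>S. (cmod (p k))\<^sup>2) + 4 / 3 * (\<Sum>k\<in>S. (cmod (cinner (f k) w))\<^sup>2)"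
    by (simp add: sum.distrib norm_sq_vec sum_distrib_left sum_divide_distrib mult.commute)
  finally have "2 * Re (cinner \<theta> w) - Re (cinner w (?A *v w)) - 1 / 2 * (norm w)\<^sup>2 \<le> 3 / 4 * (\<Sum>k\<in>S. (cmod (p k))\<^sup>2) + 2 * (norm q)\<^sup>2"
    unfolding Aw by simp
  then show ?thesis
    unfolding w rhs p_def q_def .
qed

text \<open>\<open>M\<close> is \<open>ramp\<close> of the frame operator and is fixed before
  \<open>\<xi>\<close> and \<open>x\<close>; the freedom in \<open>x\<close> lets later coefficients
  be independent of the unitary.\<close>

lemma frame_test:
  fixes f :: "'k \<Rightarrow> complex^'z::finite"
  obtains M :: "'z cmat" where
    "\<And>v. 0 \<le> Re (cinner v (M *v v))" "\<And>v. Re (cinner v (M *v v)) \<le> (norm v)\<^sup>2"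
    "\<And>\<xi> x. (norm \<xi>)\<^sup>2 - Re (cinner \<xi> (M *v \<xi>))
       \<le> 3 / 4 * (\<Sum>k\<in>S. (cmod (cinner (f k) \<xi> - x k))\<^sup>2) + 2 * (norm (\<xi> - (\<Sum>k\<in>S. x k *s f k)))\<^sup>2"
    "\<And>Y. psd Y \<Longrightarrow> Re (qtr (Y ** M)) \<le> 5 / 3 * (\<Sum>k\<in>S. Re (cinner (f k) (Y *v f k)))"
proof -
  obtain V g where V: "unitary V" "frame S f = V ** rdiag g ** adj V" and g: "\<And>k. g k \<ge> 0"
    using psd_spectral[OF psd_frame] by blast
  define M where "M = V ** rdiag (ramp \<circ> g) ** adj V"
  note rb = ramp_bounds[OF g]
  have 1: "0 \<le> Re (cinner v (M *v v))" for v
    unfolding M_def spectral_form using rb by (simp add: sum_nonneg)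
  have 2: "Re (cinner v (M *v v)) \<le> (norm v)\<^sup>2" for v
    unfolding M_def spectral_form unitary_norm[OF V(1), symmetric] using rb
    by (simp add: mult_left_le_one_le sum_mono)
  have 3: "(norm \<xi>)\<^sup>2 - Re (cinner \<xi> (M *v \<xi>))
       \<le> 3 / 4 * (\<Sum>k\<in>S. (cmod (cinner (f k) \<xi> - x k))\<^sup>2) + 2 * (norm (\<xi> - (\<Sum>k\<in>S. x k *s f k)))\<^sup>2" for \<xi> x
  proof -
    have "(norm \<xi>)\<^sup>2 - Re (cinner \<xi> (M *v \<xi>)) = (\<Sum>k\<in>UNIV. (1 - ramp (g k)) * (cmod ((adj V *v \<xi>) $ k))\<^sup>2)"
      unfolding M_def spectral_form unitary_norm[OF V(1), symmetric] by (simp add: sum_subtractf algebra_simps)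
    also have "\<dots> \<le> (\<Sum>k\<in>UNIV. 6 * (1 - g k)\<^sup>2 / (3 + 8 * g k) * (cmod ((adj V *v \<xi>) $ k))\<^sup>2)"
      using rb by (intro sum_mono mult_right_mono) auto
    finally show ?thesis using frame_residual_bound[OF V g, of \<xi> x] by linarith
  qed
  have 4: "Re (qtr (Y ** M)) \<le> 5 / 3 * (\<Sum>k\<in>S. Re (cinner (f k) (Y *v f k)))" if Y: "psd Y" for Y
  proof -
    have "Re (qtr (Y ** M)) = (\<Sum>k\<in>UNIV. ramp (g k) * Re (cinner (column k V) (Y *v column k V)))"
      unfolding qtr_mult_commute[of Y] M_def qtr_spectral_mult by simp
    also have "\<dots> \<le> (\<Sum>k\<in>UNIV. 5 / 3 * g k * Re (cinner (column k V) (Y *v column k V)))"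
      using Y rb unfolding psd_def by (intro sum_mono mult_right_mono) auto
    also have "\<dots> = 5 / 3 * Re (qtr (frame S f ** Y))"
      unfolding V(2) qtr_spectral_mult by (simp add: sum_distrib_left mult.assoc)
    finally show ?thesis by (simp add: qtr_frame_mult)
  qed
  show ?thesis using that[of M] 1 2 3 4 by blast
qed

text \<open>Adds both errors of the test: the part of each \<open>\<xi> i\<close> that it misses and
  the part of \<open>Y\<close> that it accepts. The test itself disappears, leaving expressions
  quadratic in inner products of the vectors.\<close>

lemma trace_distance_frame_bound:
  fixes X Y :: "'z::finite cmat" and f :: "'k \<Rightarrow> complex^'z" and \<xi> :: "'i \<Rightarrow> complex^'z"
  assumes "finite I"
    and X: "\<And>a b. X $ a $ b = (\<Sum>i\<in>I. complex_of_real (r i) * (\<xi> i $ a * cnj (\<xi> i $ b)))" and r: "\<And>i. i \<in> I \<Longrightarrow> r i \<ge> 0"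
    and Y: "psd Y" and tr: "qtr X = 1" "qtr Y = 1"
  shows "1 - 1 / 2 * trace_norm (X - Y) \<le>
    (\<Sum>i\<in>I. r i * (3 / 4 * (\<Sum>k\<in>S. (cmod (cinner (f k) (\<xi> i) - x i k))\<^sup>2) + 2 * (norm (\<xi> i - (\<Sum>k\<in>S. x i k *s f k)))\<^sup>2))
    + 5 / 3 * (\<Sum>k\<in>S. Re (cinner (f k) (Y *v f k)))"
proof -
  obtain M :: "'z cmat" where M:
    "\<And>v. 0 \<le> Re (cinner v (M *v v))" "\<And>v. Re (cinner v (M *v v)) \<le> (norm v)\<^sup>2"
    "\<And>\<xi> x. (norm \<xi>)\<^sup>2 - Re (cinner \<xi> (M *v \<xi>))
       \<le> 3 / 4 * (\<Sum>k\<in>S. (cmod (cinner (f k) \<xi> - x k))\<^sup>2) + 2 * (norm (\<xi> - (\<Sum>k\<in>S. x k *s f k)))\<^sup>2"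
    "\<And>Y. psd Y \<Longrightarrow> Re (qtr (Y ** M)) \<le> 5 / 3 * (\<Sum>k\<in>S. Re (cinner (f k) (Y *v f k)))"
    by (rule frame_test[of f S]) (rule that)
  \<comment> \<open>Absorbing the square roots of the weights writes the mixture as a frame
    operator, so the trace formula for frames applies to it.\<close>
  have Xf: "X = frame I (\<lambda>i. complex_of_real (sqrt (r i)) *s \<xi> i)"
  proof -
    have "complex_of_real (r i) = complex_of_real (sqrt (r i)) * complex_of_real (sqrt (r i))" if "i \<in> I" for i
      using r[OF that] by (simp flip: of_real_mult)
    then show ?thesis
      by (simp add: vec_eq_iff X frame_def mult_ac)
  qed
  have XM: "qtr (X ** N) = (\<Sum>i\<in>I. complex_of_real (r i) * cinner (\<xi> i) (N *v \<xi> i))" for N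
    unfolding Xf qtr_frame_mult
  proof (intro sum.cong refl)
    fix i assume "i \<in> I"
    then show "cinner (complex_of_real (sqrt (r i)) *s \<xi> i) (N *v (complex_of_real (sqrt (r i)) *s \<xi> i)) = complex_of_real (r i) * cinner (\<xi> i) (N *v \<xi> i)"
      using r[of i] by (simp add: vector_scalar_commute cinner_scale_left cinner_scale_right)
        (simp flip: mult.assoc of_real_mult)
  qed
  have "adj (X - Y) = X - Y"
    using psd_adj[OF Y] psd_adj[OF psd_frame] by (simp add: adj_diff Xf)
  then have "Re (qtr ((X - Y) ** M)) \<le> 1 / 2 * trace_norm (X - Y)"
    by (rule trace_norm_test) (use M tr in \<open>auto simp: qtr_diff\<close>)
  then have "1 - 1 / 2 * trace_norm (X - Y) \<le> Re (qtr X) - Re (qtr (X ** M)) + Re (qtr (Y ** M))"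
    by (simp add: matrix_diff_rdistrib qtr_diff tr)
  also have "Re (qtr X) - Re (qtr (X ** M)) = (\<Sum>i\<in>I. r i * ((norm (\<xi> i))\<^sup>2 - Re (cinner (\<xi> i) (M *v \<xi> i))))"
    using XM[of M] XM[of "mat 1"] by (simp add: cinner_self sum_subtractf algebra_simps)
  also have "\<dots> \<le> (\<Sum>i\<in>I. r i * (3 / 4 * (\<Sum>k\<in>S. (cmod (cinner (f k) (\<xi> i) - x i k))\<^sup>2) + 2 * (norm (\<xi> i - (\<Sum>k\<in>S. x i k *s f k)))\<^sup>2))"
    using r M(3) by (intro sum_mono mult_left_mono) auto
  finally show ?thesis using M(4)[OF Y] by simp
qed

section \<open>Existence of Haar measure on the unitary group\<close>

text \<open>Both orders of integrating \<open>indicator A (f x) * indicator B (y - f x)\<close> are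
  computed, \<open>B\<close> being the unit ball. One gives the image measure of \<open>A\<close>,
  the other its Lebesgue measure, each times the measure of \<open>B\<close>, which is positive and
  finite and cancels.\<close>

lemma lborel_distr_isometry:
  fixes f :: "'a::euclidean_space \<Rightarrow> 'a"
  assumes f: "orthogonal_transformation f"
  shows "distr lborel borel f = lborel"
proof (rule measure_eqI)
  have lin: "linear f" and nrm: "norm (f x) = norm x" for x
    using f by (auto simp: orthogonal_transformation)
  have add: "f (x + y) = f x + f y" for x y using lin by (rule linear_add)
  have [measurable]: "f \<in> borel_measurable borel"
    by (intro borel_measurable_continuous_onI linear_continuous_on linear_conv_bounded_linear[THEN iffD1] lin)
  obtain g where g: "f (g y) = y" for y
    using orthogonal_transformation_surj[OF f] by (metis surj_f_inv_f)
  have shift: "(\<integral>\<^sup>+x. h (c + x) \<partial>lborel) = (\<integral>\<^sup>+x. h x \<partial>lborel)" if [measurable]: "h \<in> borel_measurable borel" for h and c :: 'a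
    using nn_integral_distr[of "(+) c" lborel borel h] by (simp add: lborel_distr_plus)
  define B where "B = (ball 0 1 :: 'a set)"
  have [measurable]: "B \<in> sets borel" by (simp add: B_def)
  have B_minus: "indicator B (- f x) = (indicator B x :: ennreal)" for x
    by (simp add: B_def indicator_def nrm)
  fix A :: "'a set" assume "A \<in> sets (distr lborel borel f)"
  then have [measurable]: "A \<in> sets borel" by simp
  have "emeasure (distr lborel borel f) A * emeasure lborel B = (\<integral>\<^sup>+x. indicator A (f x) \<partial>lborel) * emeasure lborel B"
    by (simp add: nn_integral_distr flip: nn_integral_indicator)
  also have "\<dots> = (\<integral>\<^sup>+x. indicator A (f x) * emeasure lborel B \<partial>lborel)"
    by (simp add: nn_integral_multc)
  also have "\<dots> = (\<integral>\<^sup>+x. \<integral>\<^sup>+y. indicator A (f x) * indicator B (y - f x) \<partial>lborel \<partial>lborel)"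
  proof -
    have "(\<integral>\<^sup>+y. indicator B (y - f x) \<partial>lborel) = emeasure lborel B" for x
      using shift[OF borel_measurable_indicator[of B], of "- f x"] by simp
    moreover have "(\<integral>\<^sup>+y. indicator A (f x) * indicator B (y - f x) \<partial>lborel) = indicator A (f x) * (\<integral>\<^sup>+y. indicator B (y - f x) \<partial>lborel)" for x
      by (rule nn_integral_cmult) measurable
    ultimately show ?thesis by simp
  qed
  also have "\<dots> = (\<integral>\<^sup>+y. \<integral>\<^sup>+x. indicator A (f x) * indicator B (y - f x) \<partial>lborel \<partial>lborel)"
    by (rule lborel_pair.Fubini') measurable
  \<comment> \<open>Translating \<open>x\<close> by a preimage \<open>g y\<close> of
    \<open>y\<close> turns \<open>y - f x\<close> into \<open>- f x\<close>; the ball is invariant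
    under \<open>f\<close> and reflection, so its factor becomes free of \<open>f\<close>.\<close>
  also have "\<dots> = (\<integral>\<^sup>+y. \<integral>\<^sup>+x. indicator A (f (g y + x)) * indicator B (y - f (g y + x)) \<partial>lborel \<partial>lborel)"
    by (subst shift) simp_all
  also have "\<dots> = (\<integral>\<^sup>+y. \<integral>\<^sup>+x. indicator A (f x + y) * indicator B x \<partial>lborel \<partial>lborel)"
    by (simp add: add g B_minus add.commute)
  also have "\<dots> = (\<integral>\<^sup>+x. \<integral>\<^sup>+y. indicator A (f x + y) * indicator B x \<partial>lborel \<partial>lborel)"
    by (rule lborel_pair.Fubini') measurable
  also have "\<dots> = (\<integral>\<^sup>+x. emeasure lborel A * indicator B x \<partial>lborel)"
  proof -
    have "(\<integral>\<^sup>+y. indicator A (f x + y) \<partial>lborel) = emeasure lborel A" for x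
      using shift[OF borel_measurable_indicator[of A], of "f x"] by simp
    moreover have "(\<integral>\<^sup>+y. indicator A (f x + y) * indicator B x \<partial>lborel) = (\<integral>\<^sup>+y. indicator A (f x + y) \<partial>lborel) * indicator B x" for x
      by (rule nn_integral_multc) measurable
    ultimately show ?thesis by simp
  qed
  also have "\<dots> = emeasure lborel A * emeasure lborel B"
    by (simp add: nn_integral_cmult)
  finally have "emeasure (distr lborel borel f) A * emeasure lborel B = emeasure lborel A * emeasure lborel B" .
  moreover have "emeasure lborel B \<noteq> \<top>" using emeasure_bounded_finite[of B] by (auto simp: B_def)
  moreover have "emeasure lborel B \<noteq> 0"
  proof
    assume "emeasure lborel B = 0"
    then have "negligible B" by (simp add: negligible_iff_null_sets null_sets_completionI null_setsI)
    then show False using open_not_negligible[of B] by (simp add: B_def)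
  qed
  ultimately show "emeasure (distr lborel borel f) A = emeasure lborel A"
    by (metis mult_divide_eq_ennreal)
qed simp

text \<open>The Euclidean norm of the matrix type is the Hilbert-Schmidt norm, hence left
  multiplication by a unitary is an isometry of a real Euclidean space.\<close>

lemma norm_sq_mat: "complex_of_real ((norm M)\<^sup>2) = qtr (adj M ** M)" for M :: "'n::finite cmat"
proof -
  have "(norm M)\<^sup>2 = (\<Sum>i\<in>UNIV. (norm (M $ i))\<^sup>2)"
    unfolding norm_vec_def[of M] L2_set_def by (simp add: sum_nonneg)
  then have "(norm M)\<^sup>2 = (\<Sum>i\<in>UNIV. \<Sum>j\<in>UNIV. (cmod (M $ i $ j))\<^sup>2)"
    by (simp only: norm_sq_vec)
  also have "\<dots> = (\<Sum>j\<in>UNIV. \<Sum>i\<in>UNIV. (cmod (M $ i $ j))\<^sup>2)" by (rule sum.swap)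
  finally have "complex_of_real ((norm M)\<^sup>2) = (\<Sum>j\<in>UNIV. \<Sum>i\<in>UNIV. complex_of_real ((cmod (M $ i $ j))\<^sup>2))"
    by (simp only: of_real_sum)
  then show ?thesis
    unfolding qtr_def matrix_matrix_mult_def adj_def complex_norm_square by (simp add: mult.commute)
qed

lemma unitary_mult_left_gram: "unitary V \<Longrightarrow> adj (V ** M) ** (V ** N) = adj M ** N" for V M N :: "'n::finite cmat"
proof -
  have "adj (V ** M) ** (V ** N) = adj M ** (adj V ** V) ** N" by (simp add: adj_mult matrix_mul_assoc)
  also assume "unitary V"
  then have "adj V ** V = mat 1" by (simp add: unitary_def)
  finally show ?thesis by simp
qed

lemma norm_unitary_mult:
  fixes M :: "'n::finite cmat"
  assumes "unitary V"
  shows "norm (V ** M) = norm M"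
proof -
  have "complex_of_real ((norm (V ** M))\<^sup>2) = complex_of_real ((norm M)\<^sup>2)"
    unfolding norm_sq_mat unitary_mult_left_gram[OF assms] ..
  then have "(norm (V ** M))\<^sup>2 = (norm M)\<^sup>2" by (simp only: of_real_eq_iff)
  then show ?thesis by (simp add: power2_eq_iff_nonneg)
qed

lemma linear_matrix_mult: "linear (\<lambda>M :: 'n::finite cmat. V ** M)"
  by (intro linearI) (simp_all add: matrix_add_ldistrib matrix_matrix_mult_def vec_eq_iff scaleR_sum_right
      distrib_left sum.distrib)

lemma orthogonal_unitary_mult: "unitary V \<Longrightarrow> orthogonal_transformation (\<lambda>M :: 'n::finite cmat. V ** M)"
  by (simp add: orthogonal_transformation linear_matrix_mult norm_unitary_mult)

lemma continuous_on_matrix_mult [continuous_intros]: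
  fixes f g :: "'a::topological_space \<Rightarrow> 'n::finite cmat"
  shows "continuous_on S f \<Longrightarrow> continuous_on S g \<Longrightarrow> continuous_on S (\<lambda>x. f x ** g x)"
  unfolding matrix_matrix_mult_def by (intro continuous_intros)

lemma measurable_mult_left:
  fixes V :: "'n::finite cmat"
  shows "(\<lambda>M :: 'n cmat. V ** M) \<in> borel_measurable borel"
  using continuous_on_matrix_mult[of UNIV "\<lambda>_. V" "\<lambda>x. x"]
  by (intro borel_measurable_continuous_onI) simp

lemma continuous_on_adj [continuous_intros]:
  fixes f :: "'a::topological_space \<Rightarrow> 'n::finite cmat"
  shows "continuous_on S f \<Longrightarrow> continuous_on S (\<lambda>x. adj (f x))"
  unfolding adj_def by (intro continuous_intros)

lemma tendsto_matrix_mult: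
  fixes f g :: "'a \<Rightarrow> 'n::finite cmat"
  shows "(f \<longlongrightarrow> A) F \<Longrightarrow> (g \<longlongrightarrow> B) F \<Longrightarrow> ((\<lambda>x. f x ** g x) \<longlongrightarrow> A ** B) F"
  unfolding matrix_matrix_mult_def by (intro tendsto_intros)

lemma tendsto_rdiag: "(\<And>i. ((\<lambda>x. d x i) \<longlongrightarrow> e i) F) \<Longrightarrow> ((\<lambda>x. rdiag (d x)) \<longlongrightarrow> rdiag e) F"
  unfolding rdiag_def by (intro tendsto_vec_lambda) (auto intro: tendsto_of_real)

lemma closed_unitary: "closed {U :: 'n::finite cmat. unitary U}"
  unfolding unitary_def by (intro closed_Collect_eq continuous_intros)

text \<open>The Newton-Schulz iteration for the unitary polar factor. Its iterates are continuous
  and commute with left multiplication by unitaries, so the limit is Borel measurable and, where it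
  exists, equivariant.\<close>

primrec polar_iter :: "nat \<Rightarrow> 'n::finite cmat \<Rightarrow> 'n cmat" where
  "polar_iter 0 M = M"
| "polar_iter (Suc k) M = polar_iter k M ** ((3 / 2) *\<^sub>R mat 1 - (1 / 2) *\<^sub>R (adj (polar_iter k M) ** polar_iter k M))"

definition polar_unitary :: "'n::finite cmat \<Rightarrow> 'n cmat" where
  "polar_unitary M = lim (\<lambda>k. polar_iter k M)"

lemma polar_iter_equivariant: "unitary V \<Longrightarrow> polar_iter k (V ** M) = V ** polar_iter k M"
proof (induction k)
  case (Suc k)
  then show ?case
    by (simp add: unitary_mult_left_gram) (simp add: matrix_mul_assoc)
qed simp

lemma continuous_polar_iter: "continuous_on UNIV (polar_iter k)"
  by (induction k) (auto intro!: continuous_intros)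

lemma measurable_polar_unitary [measurable]: "polar_unitary \<in> borel_measurable borel"
  unfolding polar_unitary_def
  by (intro borel_measurable_lim_metric borel_measurable_continuous_onI continuous_polar_iter)

text \<open>The same iteration acting on a single singular value.\<close>

primrec sign_iter :: "nat \<Rightarrow> real \<Rightarrow> real" where
  "sign_iter 0 x = x"
| "sign_iter (Suc k) x = sign_iter k x * (3 - (sign_iter k x)\<^sup>2) / 2"

text \<open>The iterates increase and stay at most 1, and 1 is the only positive fixed
  point.\<close>

lemma sign_iter_tendsto:
  assumes x: "0 < x" "x \<le> 1"
  shows "(\<lambda>k. sign_iter k x) \<longlonglongrightarrow> 1"
proof -
  have step: "p \<le> p * (3 - p\<^sup>2) / 2" "p * (3 - p\<^sup>2) / 2 \<le> 1" if "0 < p" "p \<le> 1" for p :: real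
  proof -
    have "p\<^sup>2 \<le> 1" using that by (simp add: power_le_one)
    then have "p * 2 \<le> p * (3 - p\<^sup>2)" using that by (intro mult_left_mono) auto
    then show "p \<le> p * (3 - p\<^sup>2) / 2" by simp
    \<comment> \<open>\<open>(1 - p)^2 * (2 + p) = 2 - 3 p + p^3\<close> is twice the gap between 1
      and the next iterate.\<close>
    have "0 \<le> (1 - p)\<^sup>2 * (2 + p)" using that by simp
    then show "p * (3 - p\<^sup>2) / 2 \<le> 1" by (simp add: power2_eq_square algebra_simps)
  qed
  have b: "x \<le> sign_iter k x \<and> sign_iter k x \<le> 1" for k
  proof (induction k)
    case (Suc k)
    then have "0 < sign_iter k x" "sign_iter k x \<le> 1" "x \<le> sign_iter k x" using x by auto
    then show ?case using step[of "sign_iter k x"] unfolding sign_iter.simps by linarith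
  qed (use x in auto)
  have "incseq (\<lambda>k. sign_iter k x)"
  proof (rule incseq_SucI)
    fix k show "sign_iter k x \<le> sign_iter (Suc k) x"
      using step[of "sign_iter k x"] b[of k] x by auto
  qed
  then obtain L where L: "(\<lambda>k. sign_iter k x) \<longlonglongrightarrow> L"
    using b incseq_convergent[of "\<lambda>k. sign_iter k x" 1] by metis
  have "(\<lambda>k. sign_iter (Suc k) x) \<longlonglongrightarrow> L * (3 - L\<^sup>2) / 2"
    unfolding sign_iter.simps by (intro tendsto_intros L) auto
  moreover have "(\<lambda>k. sign_iter (Suc k) x) \<longlonglongrightarrow> L" using L by (rule LIMSEQ_Suc)
  ultimately have "L = L * (3 - L\<^sup>2) / 2" by (rule LIMSEQ_unique[symmetric])
  moreover have "x \<le> L" by (rule LIMSEQ_le_const[OF L]) (use b in auto)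
  ultimately have "L\<^sup>2 = 1" using x by (simp add: field_simps)
  then have "L = 1" using \<open>x \<le> L\<close> x by (simp add: power2_eq_1_iff)
  then show ?thesis using L by simp
qed

text \<open>Invertibility and norm below 1 put all singular values in \<open>(0, 1]\<close>, where
  the iteration converges. The set is also open, bounded and invariant under left multiplication by
  unitaries.\<close>

definition polar_domain :: "'n::finite cmat set" where
  "polar_domain = {M. norm M < 1 \<and> det M \<noteq> 0}"

lemma scaleR_spectral: "c *\<^sub>R (V ** rdiag h ** adj V) = V ** rdiag (\<lambda>i. c * h i) ** adj V"
  by (simp add: vec_eq_iff scaleR_conv_of_real[where 'a=complex] matrix_matrix_mult_def rdiag_def sum_distrib_left
      sum_distrib_right mult_if_distribs mult_ac cong: if_cong)

text \<open>In an eigenbasis of \<open>adj M ** M\<close> every iterate is \<open>M\<close> times a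
  diagonal matrix, with entries \<open>sign_iter k q / q\<close> at the singular value
  \<open>q = sqrt (d i)\<close>. These tend to \<open>1 / q\<close>, and the limit is
  unitary.\<close>

lemma polar_iter_converges:
  fixes M :: "'n::finite cmat"
  assumes "M \<in> polar_domain"
  obtains W where "unitary W" "(\<lambda>k. polar_iter k M) \<longlonglongrightarrow> W"
proof -
  have M: "norm M < 1" "det M \<noteq> 0" using assms by (auto simp: polar_domain_def)
  have "adj (adj M ** M) = adj M ** M" by (simp add: adj_mult)
  then obtain V d where V: "unitary V" "adj M ** M = V ** rdiag d ** adj V"
    using spectral_theorem by blast
  have VV: "adj V ** V = mat 1" "V ** adj V = mat 1" using V(1) unitary_mult_adj by (auto simp: unitary_def)
  have conj: "adj (M ** A) ** (M ** B) = adj A ** (V ** rdiag d ** adj V) ** B" for A B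
    unfolding V(2)[symmetric] by (simp add: adj_mult matrix_mul_assoc)
  have cancel: "(V ** A ** adj V) ** (V ** B ** adj V) = V ** (A ** B) ** adj V" for A B
  proof -
    have "(V ** A ** adj V) ** (V ** B ** adj V) = V ** A ** (adj V ** V) ** B ** adj V"
      by (simp add: matrix_mul_assoc)
    then show ?thesis by (simp add: VV matrix_mul_assoc)
  qed
  have d_pos: "d k > 0" for k
  proof -
    have nz: "M *v column k V \<noteq> 0"
    proof
      assume "M *v column k V = 0"
      then have "column k V = 0"
        using M(2) invertible_det_nz[of M] inj_matrix_vector_mult[of M] by (metis injD matrix_vector_mult_0_right)
      then show False using unitary_column_norm[OF V(1), of k] by simp
    qed
    have "complex_of_real (d k) = cinner (column k V) ((adj M ** M) *v column k V)"
    proof -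
      have "adj V ** (V ** rdiag d ** adj V) ** V = (adj V ** V) ** rdiag d ** (adj V ** V)"
        by (simp add: matrix_mul_assoc)
      then show ?thesis by (simp add: V(2) column_conj VV) (simp add: rdiag_def)
    qed
    also have "\<dots> = cinner (M *v column k V) (M *v column k V)"
      by (simp add: cinner_adj[of _ "adj M"] flip: matrix_vector_mul_assoc)
    finally have "d k = (norm (M *v column k V))\<^sup>2" by (simp only: cinner_self of_real_eq_iff)
    then show ?thesis using nz by simp
  qed
  have "(norm M)\<^sup>2 = (\<Sum>k\<in>UNIV. d k)"
    using norm_sq_mat[of M] unfolding V(2) qtr_spectral[OF V(1)] of_real_eq_iff .
  then have "(\<Sum>k\<in>UNIV. d k) \<le> 1" using M(1) by (metis norm_ge_zero less_imp_le power_le_one)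
  then have d_le: "d k \<le> 1" for k
    using member_le_sum[of k UNIV d] d_pos by (simp add: less_imp_le order_trans)
  define g where "g k i = sign_iter k (sqrt (d i)) / sqrt (d i)" for k i
  have g_lim: "(\<lambda>k. g k i) \<longlonglongrightarrow> 1 / sqrt (d i)" for i
    unfolding g_def using d_pos[of i] d_le[of i] by (intro tendsto_divide sign_iter_tendsto) auto
  have it: "polar_iter k M = M ** (V ** rdiag (g k) ** adj V)" for k
  proof (induction k)
    case 0
    have "g 0 = (\<lambda>i. 1)" using d_pos by (auto simp: g_def less_imp_neq[THEN not_sym])
    then show ?case by (simp add: rdiag_one VV)
  next
    case (Suc k)
    have one: "mat 1 = V ** rdiag (\<lambda>i. 1) ** adj V" by (simp add: rdiag_one VV)
    note sc = scaleR_spectral[of _ V]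
    have df: "V ** rdiag h ** adj V - V ** rdiag h' ** adj V = V ** rdiag (\<lambda>i. h i - h' i) ** adj V" for h h'
      by (simp add: matrix_diff_ldistrib matrix_diff_rdistrib flip: rdiag_diff)
    have "polar_iter (Suc k) M = M ** (V ** rdiag (g k) ** adj V) ** ((3 / 2) *\<^sub>R mat 1 - (1 / 2) *\<^sub>R (V ** rdiag (\<lambda>i. g k i * d i * g k i) ** adj V))"
      unfolding polar_iter.simps Suc conj by (simp only: herm_spectral cancel rdiag_mult)
    also have "\<dots> = M ** (V ** rdiag (\<lambda>i. g k i * (3 / 2 * 1 - 1 / 2 * (g k i * d i * g k i))) ** adj V)"
      by (simp only: one sc df cancel rdiag_mult matrix_mul_assoc[symmetric, of M])
    also have "(\<lambda>i. g k i * (3 / 2 * 1 - 1 / 2 * (g k i * d i * g k i))) = g (Suc k)"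
    proof
      fix i
      define q where "q = sqrt (d i)"
      have q: "q > 0" "d i = q\<^sup>2" using d_pos[of i] by (auto simp: q_def)
      have "sign_iter k (sqrt (d i)) = g k i * q" using q(1) by (simp add: g_def q_def)
      then show "g k i * (3 / 2 * 1 - 1 / 2 * (g k i * d i * g k i)) = g (Suc k) i"
        using q(1) unfolding g_def[of "Suc k"] sign_iter.simps q_def[symmetric]
        by (simp add: q(2) power2_eq_square field_simps)
    qed
    finally show ?case .
  qed
  define W where "W = M ** (V ** rdiag (\<lambda>i. 1 / sqrt (d i)) ** adj V)"
  have "adj W ** W = V ** rdiag (\<lambda>i. 1 / sqrt (d i) * d i * (1 / sqrt (d i))) ** adj V"
    unfolding W_def conj by (simp only: herm_spectral cancel rdiag_mult)
  also have "(\<lambda>i. 1 / sqrt (d i) * d i * (1 / sqrt (d i))) = (\<lambda>i. 1)"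
    using d_pos by (auto simp: less_imp_le less_imp_neq[THEN not_sym])
  finally have "unitary W" by (simp add: unitary_def rdiag_one VV)
  moreover have "(\<lambda>k. polar_iter k M) \<longlonglongrightarrow> W"
    unfolding it W_def by (intro tendsto_matrix_mult tendsto_const tendsto_rdiag g_lim)
  ultimately show ?thesis using that by blast
qed

lemma polar_unitary_props:
  assumes "M \<in> polar_domain"
  shows "unitary (polar_unitary M)" "unitary V \<Longrightarrow> polar_unitary (V ** M) = V ** polar_unitary M"
proof -
  obtain W where W: "unitary W" "(\<lambda>k. polar_iter k M) \<longlonglongrightarrow> W"
    using polar_iter_converges[OF assms] by blast
  have eq: "polar_unitary M = W" unfolding polar_unitary_def using W(2) by (rule limI)
  then show "unitary (polar_unitary M)" using W(1) by simp
  assume "unitary V"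
  then show "polar_unitary (V ** M) = V ** polar_unitary M"
    unfolding eq unfolding polar_unitary_def polar_iter_equivariant[OF \<open>unitary V\<close>]
    by (intro limI tendsto_matrix_mult tendsto_const W)
qed

lemma open_polar_domain: "open (polar_domain :: 'n::finite cmat set)"
proof -
  have "open {M :: 'n cmat. det M \<noteq> 0}"
    unfolding det_def by (intro open_Collect_neq continuous_intros)
  moreover have "open {M :: 'n cmat. norm M < 1}"
    by (intro open_Collect_less continuous_intros)
  ultimately show ?thesis
    unfolding polar_domain_def by (simp add: Collect_conj_eq open_Int)
qed

lemma polar_domain_nonempty: "polar_domain \<noteq> ({} :: 'n::finite cmat set)"
proof -
  define c where "c = 1 / (norm (mat 1 :: 'n cmat) + 1)"
  have c: "c > 0" by (simp add: c_def add_nonneg_pos)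
  have "norm (c *\<^sub>R (mat 1 :: 'n cmat)) < 1"
    by (simp add: c_def add_nonneg_pos abs_of_pos)
  moreover have "(c *\<^sub>R (mat 1 :: 'n cmat)) ** ((1 / c) *\<^sub>R mat 1) = mat 1"
    using c by (simp add: vec_eq_iff scaleR_conv_of_real[where 'a=complex] matrix_matrix_mult_def mat_def mult_if_distribs cong: if_cong)
  then have "det (c *\<^sub>R (mat 1 :: 'n cmat)) \<noteq> 0"
    using invertible_det_nz invertible_right_inverse by blast
  ultimately show ?thesis unfolding polar_domain_def by blast
qed

lemma polar_domain_unitary: "unitary V \<Longrightarrow> V ** M \<in> polar_domain \<longleftrightarrow> M \<in> polar_domain"
proof -
  assume V: "unitary V"
  then have "det V \<noteq> 0"
    using invertible_det_nz invertible_right_inverse unitary_mult_adj by blast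
  then show ?thesis by (simp add: polar_domain_def det_mul norm_unitary_mult[OF V])
qed

definition is_haar :: "'n::finite cmat measure \<Rightarrow> bool" where
  "is_haar \<mu> \<longleftrightarrow> prob_space \<mu> \<and> sets \<mu> = sets borel \<and> (AE U in \<mu>. unitary U) \<and>
     (\<forall>V. unitary V \<longrightarrow> distr \<mu> borel (\<lambda>U. V ** U) = \<mu>)"

text \<open>The uniform measure on \<open>polar_domain\<close> is invariant under left
  multiplication by unitaries; \<open>polar_unitary\<close> intertwines these actions, so its image
  measure inherits the invariance.\<close>

theorem haar_exists: "\<exists>\<mu> :: 'n::finite cmat measure. is_haar \<mu>"
proof -
  let ?S = "polar_domain :: 'n cmat set"
  have S [measurable]: "?S \<in> sets borel" using open_polar_domain by (rule borel_open)
  have fin: "emeasure lborel ?S \<noteq> \<top>"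
  proof -
    have "bounded ?S" unfolding bounded_iff polar_domain_def by (auto intro!: exI[of _ 1])
    then show ?thesis using emeasure_bounded_finite[of ?S] by auto
  qed
  have pos: "emeasure lborel ?S \<noteq> 0"
  proof
    assume "emeasure lborel ?S = 0"
    then have "negligible ?S" by (simp add: negligible_iff_null_sets null_sets_completionI null_setsI)
    then show False using open_not_negligible[of ?S] open_polar_domain polar_domain_nonempty by blast
  qed
  define \<nu> where "\<nu> = uniform_measure lborel ?S"
  interpret \<nu>: prob_space \<nu>
    unfolding \<nu>_def using pos fin by (intro prob_space_uniform_measure) auto
  have [measurable_cong]: "sets \<nu> = sets borel" by (simp add: \<nu>_def)
  have inS: "AE M in \<nu>. M \<in> ?S"
    unfolding \<nu>_def using pos fin by (subst AE_uniform_measure) (auto simp: less_top zero_less_iff_neq_zero)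
  have mV [measurable]: "(\<lambda>M :: 'n cmat. V ** M) \<in> borel_measurable borel" for V :: "'n cmat"
    by (rule measurable_mult_left)
  have inv: "distr \<nu> borel (\<lambda>M. V ** M) = \<nu>" if V: "unitary V" for V
  proof (rule measure_eqI)
    fix A assume "A \<in> sets (distr \<nu> borel (\<lambda>M. V ** M))"
    then have [measurable]: "A \<in> sets borel" by simp
    have "?S \<inter> ((\<lambda>M. V ** M) -` A) = (\<lambda>M. V ** M) -` (?S \<inter> A)"
      using polar_domain_unitary[OF V] by auto
    then have "emeasure lborel (?S \<inter> ((\<lambda>M. V ** M) -` A)) = emeasure (distr lborel borel (\<lambda>M. V ** M)) (?S \<inter> A)"
      by (subst emeasure_distr) auto
    also have "\<dots> = emeasure lborel (?S \<inter> A)"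
      by (simp add: lborel_distr_isometry orthogonal_unitary_mult[OF V])
    finally show "emeasure (distr \<nu> borel (\<lambda>M. V ** M)) A = emeasure \<nu> A"
      using measurable_sets_borel[OF mV[of V], of A]
      by (subst emeasure_distr) (auto simp: \<nu>_def emeasure_uniform_measure)
  qed (simp add: \<nu>_def)
  define \<mu> where "\<mu> = distr \<nu> borel polar_unitary"
  have "prob_space \<mu>" unfolding \<mu>_def by (rule \<nu>.prob_space_distr) measurable
  moreover have "sets \<mu> = sets borel" by (simp add: \<mu>_def)
  moreover have "AE U in \<mu>. unitary U"
  proof -
    have "{U \<in> space borel. unitary U} \<in> sets (borel :: 'n cmat measure)"
      by (simp add: borel_closed[OF closed_unitary])
    then show ?thesis
      unfolding \<mu>_def using inS by (subst AE_distr_iff) (auto simp: polar_unitary_props)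
  qed
  moreover have "distr \<mu> borel (\<lambda>U. V ** U) = \<mu>" if V: "unitary V" for V
  proof -
    have "distr \<mu> borel (\<lambda>U. V ** U) = distr \<nu> borel (\<lambda>M. V ** polar_unitary M)"
      unfolding \<mu>_def by (subst distr_distr) (auto simp: comp_def)
    also have "\<dots> = distr \<nu> borel (\<lambda>M. polar_unitary (V ** M))"
    proof (rule distr_cong_AE)
      \<comment> \<open>Equivariance is available on \<open>polar_domain\<close>, where the limit
        exists, hence almost everywhere.\<close>
      show "AE M in \<nu>. V ** polar_unitary M = polar_unitary (V ** M)"
        using inS by eventually_elim (simp add: polar_unitary_props(2)[OF _ V])
    qed measurable
    also have "\<dots> = distr (distr \<nu> borel (\<lambda>M. V ** M)) borel polar_unitary"
      by (subst distr_distr) (auto simp: comp_def)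
    finally show ?thesis by (simp add: inv[OF V] \<mu>_def)
  qed
  ultimately show ?thesis unfolding is_haar_def by blast
qed

lemma is_haar_haar: "is_haar haar"
  using someI_ex[OF haar_exists] unfolding haar_def is_haar_def by blast

section \<open>Second moments of Haar measure\<close>

lemma haar_prob_space: "prob_space (haar :: 'n::finite cmat measure)"
  and sets_haar [measurable_cong, simp]: "sets (haar :: 'n cmat measure) = sets borel"
  and AE_haar_unitary: "AE U in (haar :: 'n cmat measure). unitary U"
  and haar_distr: "unitary V \<Longrightarrow> distr (haar :: 'n cmat measure) borel (\<lambda>U. V ** U) = haar"
proof -
  have "is_haar (haar :: 'n cmat measure)" by (rule is_haar_haar)
  then show "prob_space (haar :: 'n cmat measure)" "sets (haar :: 'n cmat measure) = sets borel"
    "AE U in (haar :: 'n cmat measure). unitary U"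
    "unitary V \<Longrightarrow> distr (haar :: 'n cmat measure) borel (\<lambda>U. V ** U) = haar"
    by (auto simp: is_haar_def)
qed

section \<open>Integrals over the compact unitary group\<close>

lemma compact_unitary: "compact {U :: 'n::finite cmat. unitary U}"
proof -
  have "norm U \<le> real CARD('n)" if "unitary U" for U :: "'n cmat"
  proof -
    have "complex_of_real ((norm U)\<^sup>2) = complex_of_real (real CARD('n))"
      unfolding norm_sq_mat using that by (simp add: unitary_def qtr_def mat_def)
    then have "(norm U)\<^sup>2 = real CARD('n)" by (simp only: of_real_eq_iff)
    also have "\<dots> \<le> (real CARD('n))\<^sup>2" by (simp add: power2_eq_square)
    finally show ?thesis by (rule power2_le_imp_le) simp
  qed
  then have "bounded {U :: 'n cmat. unitary U}" by (auto simp: bounded_iff)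
  then show ?thesis using closed_unitary by (simp add: compact_eq_bounded_closed)
qed

lemma haar_integrable:
  fixes g :: "'n::finite cmat \<Rightarrow> 'b::{banach,second_countable_topology}"
  assumes "continuous_on UNIV g"
  shows "integrable haar g"
proof -
  interpret prob_space "haar :: 'n cmat measure" by (rule haar_prob_space)
  have "compact (g ` {U. unitary U})"
    by (rule compact_continuous_image[OF continuous_on_subset[OF assms] compact_unitary]) auto
  then obtain B where B: "\<And>U. unitary U \<Longrightarrow> norm (g U) \<le> B"
    using compact_imp_bounded bounded_iff by (metis (mono_tags, lifting) imageI mem_Collect_eq)
  have "AE U in haar. norm (g U) \<le> B"
    using AE_haar_unitary by eventually_elim (rule B)
  moreover have "g \<in> borel_measurable haar"
    using borel_measurable_continuous_onI[OF assms] by measurable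
  ultimately show ?thesis by (rule integrable_const_bound)
qed

lemma haar_invariant:
  fixes g :: "'n::finite cmat \<Rightarrow> 'b::{banach,second_countable_topology}"
  assumes V: "unitary V" and g: "continuous_on UNIV g"
  shows "(\<integral>U. g (V ** U) \<partial>haar) = (\<integral>U. g U \<partial>haar)"
proof -
  have [measurable]: "(\<lambda>U :: 'n cmat. V ** U) \<in> borel_measurable borel"
    by (rule measurable_mult_left)
  have "(\<integral>U. g U \<partial>haar) = (\<integral>U. g U \<partial>distr haar borel (\<lambda>U. V ** U))" by (simp add: haar_distr[OF V])
  also have "\<dots> = (\<integral>U. g (V ** U) \<partial>haar)"
    using borel_measurable_continuous_onI[OF g] by (intro integral_distr) measurable
  finally show ?thesis by simp
qed

text \<open>Multiplies row \<open>k\<close> by \<open>\<i>\<close>. The phase \<open>\<i>\<close>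
  rather than -1 lets a row occurring twice also be detected, since \<open>\<i>\<close> squared is
  still different from 1.\<close>

definition phase_mat :: "'n::finite \<Rightarrow> 'n cmat" where
  "phase_mat k = (\<chi> i j. if i = j then (if i = k then \<i> else 1) else 0)"

lemma phase_mat: "unitary (phase_mat k)" "(phase_mat k ** U) $ a $ b = (if a = k then \<i> else 1) * U $ a $ b"
  by (auto simp: unitary_def phase_mat_def adj_def matrix_matrix_mult_def vec_eq_iff mat_def
      mult_if_distribs if_distrib[where f=cnj] cong: if_cong)

definition perm_mat :: "('n::finite \<Rightarrow> 'n) \<Rightarrow> 'n cmat" where
  "perm_mat \<pi> = (\<chi> i j. if j = \<pi> i then 1 else 0)"

lemma perm_mat:
  assumes "bij \<pi>"
  shows "unitary (perm_mat \<pi>)" "(perm_mat \<pi> ** U) $ a $ b = U $ (\<pi> a) $ b"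
proof -
  have "(\<Sum>i\<in>UNIV. cnj (if j = \<pi> i then 1 else 0) * (if k = \<pi> i then 1 else 0)) = (if j = k then 1 else (0::complex))" for j k
  proof -
    have "(\<Sum>i\<in>UNIV. cnj (if j = \<pi> i then 1 else 0) * (if k = \<pi> i then 1 else 0)) = (\<Sum>i\<in>UNIV. cnj (if j = i then 1 else 0) * (if k = i then 1 else (0::complex)))"
      using sum.reindex_bij_betw[OF assms, of "\<lambda>i. cnj (if j = i then 1 else 0) * (if k = i then 1 else (0::complex))"] by simp
    then show ?thesis
      by (simp add: mult_if_distribs if_distrib[where f=cnj] cong: if_cong)
  qed
  then show "unitary (perm_mat \<pi>)"
    unfolding unitary_def perm_mat_def adj_def matrix_matrix_mult_def by (simp add: vec_eq_iff mat_def)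
  show "(perm_mat \<pi> ** U) $ a $ b = U $ (\<pi> a) $ b"
    by (simp add: perm_mat_def matrix_matrix_mult_def mult_if_distribs cong: if_cong)
qed

text \<open>For distinct \<open>a\<close> and \<open>e\<close>, the 2 by 2 Hadamard matrix on these
  two coordinates and the identity elsewhere. Mixing two rows links the moments with four equal rows
  to the others, which phases and permutations cannot do.\<close>

definition hadamard_mat :: "'n::finite \<Rightarrow> 'n \<Rightarrow> 'n cmat" where
  "hadamard_mat a e = (\<chi> i j.
     if i = a then (if j = a \<or> j = e then complex_of_real (1 / sqrt 2) else 0)
     else if i = e then (if j = a then complex_of_real (1 / sqrt 2) else if j = e then - complex_of_real (1 / sqrt 2) else 0)
     else if i = j then 1 else 0)"

lemma sum_split2:
  fixes F :: "'n::finite \<Rightarrow> 'b::comm_monoid_add"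
  assumes "a \<noteq> e"
  shows "(\<Sum>i\<in>UNIV. F i) = F a + (F e + (\<Sum>i\<in>UNIV - {a, e}. F i))"
proof -
  have "(\<Sum>i\<in>UNIV. F i) = F a + (\<Sum>i\<in>UNIV - {a}. F i)" by (simp add: sum.remove)
  also have "(\<Sum>i\<in>UNIV - {a}. F i) = F e + (\<Sum>i\<in>UNIV - {a} - {e}. F i)"
    using assms by (intro sum.remove) auto
  also have "UNIV - {a} - {e} = UNIV - {a, e}" by auto
  finally show ?thesis .
qed

lemma hadamard_mat:
  assumes ae: "a \<noteq> e"
  shows "unitary (hadamard_mat a e)"
    "(hadamard_mat a e ** U) $ a $ b = complex_of_real (1 / sqrt 2) * (U $ a $ b + U $ e $ b)"
proof -
  have s: "complex_of_real (1 / sqrt 2) * complex_of_real (1 / sqrt 2) = 1 / 2"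
    by (simp flip: of_real_mult)
  let ?H = "hadamard_mat a e"
  have "(\<Sum>i\<in>UNIV. cnj (?H $ i $ j) * ?H $ i $ k) = (if j = k then 1 else 0)" for j k
  proof -
    have "(\<Sum>i\<in>UNIV - {a, e}. cnj (?H $ i $ j) * ?H $ i $ k) = (\<Sum>i\<in>UNIV - {a, e}. if i = j then (if j = k then 1 else 0) else 0)"
      by (intro sum.cong refl) (auto simp: hadamard_mat_def)
    also have "\<dots> = (if j \<in> {a, e} then 0 else if j = k then 1 else 0)"
      by (simp add: sum.delta)
    finally show ?thesis
      unfolding sum_split2[OF ae] using ae s by (auto simp: hadamard_mat_def)
  qed
  then show "unitary ?H"
    unfolding unitary_def adj_def matrix_matrix_mult_def by (simp add: vec_eq_iff mat_def)
  show "(?H ** U) $ a $ b = complex_of_real (1 / sqrt 2) * (U $ a $ b + U $ e $ b)"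
    using ae unfolding matrix_matrix_mult_def
    by (simp add: sum_split2[OF ae] hadamard_mat_def algebra_simps)
qed

definition moment2 :: "'n::finite \<Rightarrow> 'n \<Rightarrow> 'n \<Rightarrow> 'n \<Rightarrow> complex" where
  "moment2 a b a' b' = (\<integral>U. U $ a $ b * cnj (U $ a' $ b') \<partial>haar)"

text \<open>Column indices come first, as parameters: left multiplication acts on the row indices
  alone.\<close>

definition moment4 :: "'n::finite \<Rightarrow> 'n \<Rightarrow> 'n \<Rightarrow> 'n \<Rightarrow> 'n \<Rightarrow> 'n \<Rightarrow> 'n \<Rightarrow> 'n \<Rightarrow> complex" where
  "moment4 b f b' f' a e a' e' = (\<integral>U. U $ a $ b * U $ e $ f * cnj (U $ a' $ b') * cnj (U $ e' $ f') \<partial>haar)"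

lemma moment2_invariant:
  "unitary V \<Longrightarrow> moment2 a b a' b' = (\<integral>U. (V ** U) $ a $ b * cnj ((V ** U) $ a' $ b') \<partial>haar)"
  unfolding moment2_def by (subst haar_invariant[symmetric, of V]) (auto intro!: continuous_intros)

lemma moment4_invariant:
  "unitary V \<Longrightarrow> moment4 b f b' f' a e a' e' =
    (\<integral>U. (V ** U) $ a $ b * (V ** U) $ e $ f * cnj ((V ** U) $ a' $ b') * cnj ((V ** U) $ e' $ f') \<partial>haar)"
  unfolding moment4_def by (subst haar_invariant[symmetric, of V]) (auto intro!: continuous_intros)

lemma unitary_rows:
  assumes "unitary U"
  shows "(\<Sum>a\<in>UNIV. U $ a $ b * cnj (U $ a $ b')) = (if b = b' then 1 else 0)"
proof -
  have "(\<Sum>a\<in>UNIV. U $ a $ b * cnj (U $ a $ b')) = (adj U ** U) $ b' $ b"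
    by (simp add: matrix_matrix_mult_def adj_def mult.commute)
  then show ?thesis using assms by (simp add: unitary_def mat_def)
qed

text \<open>A phase kills unequal rows, permutations make the value independent of the row, and
  summing over rows gives the orthonormality of columns.\<close>

lemma moment2_eq:
  fixes a a' b b' :: "'n::finite"
  shows "moment2 a b a' b' = (if a = a' \<and> b = b' then 1 / of_nat CARD('n) else 0)"
proof (cases "a = a'")
  case False
  have "moment2 a b a' b' = \<i> * moment2 a b a' b'"
    using moment2_invariant[OF phase_mat(1)[of a], of a b a' b'] False
    by (simp add: phase_mat(2) moment2_def mult.assoc)
  then have "(1 - \<i>) * moment2 a b a' b' = 0" by (simp add: left_diff_distrib)
  moreover have "1 - \<i> \<noteq> 0" by (simp add: complex_eq_iff)
  ultimately have "moment2 a b a' b' = 0" by simp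
  then show ?thesis using False by simp
next
  case True
  have const: "moment2 c b c b' = moment2 a b a b'" for c
  proof -
    have bij: "bij (Transposition.transpose a c)" by simp
    show ?thesis
      using moment2_invariant[OF perm_mat(1)[OF bij], of a b a b'] by (simp add: perm_mat(2)[OF bij] moment2_def)
  qed
  interpret prob_space "haar :: 'n cmat measure" by (rule haar_prob_space)
  have "of_nat CARD('n) * moment2 a b a b' = (\<Sum>c\<in>UNIV. moment2 c b c b')"
    by (subst sum.cong[OF refl const]) simp_all
  also have "\<dots> = (\<integral>U. (\<Sum>c\<in>UNIV. U $ c $ b * cnj (U $ c $ b')) \<partial>haar)"
    unfolding moment2_def by (intro Bochner_Integration.integral_sum[symmetric] haar_integrable continuous_intros)
  also have "\<dots> = (\<integral>U. (if b = b' then 1 else 0) \<partial>(haar :: 'n cmat measure))"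
  proof (rule integral_cong_AE)
    show "AE U in (haar :: 'n cmat measure). (\<Sum>c\<in>UNIV. U $ c $ b * cnj (U $ c $ b')) = (if b = b' then 1 else 0)"
      using AE_haar_unitary by eventually_elim (rule unitary_rows)
  qed (auto intro!: borel_measurable_integrable haar_integrable continuous_intros)
  also have "\<dots> = (if b = b' then 1 else 0)" by (simp add: prob_space)
  finally show ?thesis using True by (auto simp: field_simps)
qed

lemma moment4_phase:
  assumes "\<not> (a = a' \<and> e = e')" "\<not> (a = e' \<and> e = a')"
  shows "moment4 b f b' f' a e a' e' = 0"
proof -
  let ?m = "moment4 b f b' f' a e a' e'"
  let ?c = "\<lambda>k i. if i = k then \<i> else (1::complex)"
  have ph: "?m = (?c k a * ?c k e * cnj (?c k a') * cnj (?c k e')) * ?m" for k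
  proof -
    have "?m = (\<integral>U. (?c k a * ?c k e * cnj (?c k a') * cnj (?c k e')) * (U $ a $ b * U $ e $ f * cnj (U $ a' $ b') * cnj (U $ e' $ f')) \<partial>haar)"
      unfolding moment4_invariant[OF phase_mat(1)[of k]] phase_mat(2)
      by (intro arg_cong[where f="integral\<^sup>L haar"] ext) simp
    then show ?thesis by (simp add: moment4_def)
  qed
  have "\<exists>k. ?c k a * ?c k e * cnj (?c k a') * cnj (?c k e') \<noteq> 1"
  proof (cases "a = a' \<or> a = e'")
    case True
    then show ?thesis using assms by (intro exI[of _ e]) (auto simp: complex_eq_iff)
  next
    case False
    then show ?thesis by (intro exI[of _ a]) (auto simp: complex_eq_iff)
  qed
  then obtain k z where z: "z = ?c k a * ?c k e * cnj (?c k a') * cnj (?c k e')" "z \<noteq> 1" by blast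
  have "?m = z * ?m" using ph[of k] by (simp only: z(1))
  then have "(z - 1) * ?m = 0" by (simp add: left_diff_distrib)
  then show ?thesis using z(2) by simp
qed

lemma moment4_perm: "bij \<pi> \<Longrightarrow> moment4 b f b' f' (\<pi> a) (\<pi> e) (\<pi> a') (\<pi> e') = moment4 b f b' f' a e a' e'"
  using moment4_invariant[OF perm_mat(1), of \<pi> b f b' f' a e a' e'] by (simp add: perm_mat(2) moment4_def)

lemma bij_two_points:
  assumes "a \<noteq> e" "c \<noteq> g"
  obtains \<pi> :: "'n \<Rightarrow> 'n" where "bij \<pi>" "\<pi> a = c" "\<pi> e = g"
proof -
  let ?e = "Transposition.transpose a c e"
  let ?\<pi> = "Transposition.transpose ?e g \<circ> Transposition.transpose a c"
  have "?e \<noteq> c" using assms by (auto simp: Transposition.transpose_def)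
  then have "?\<pi> a = c" "?\<pi> e = g" using assms by (auto simp: Transposition.transpose_def)
  moreover have "bij ?\<pi>" by (intro bij_comp) auto
  ultimately show ?thesis using that by blast
qed

text \<open>Of the sixteen terms of the expansion phases kill ten. Exchanging \<open>a\<close> and
  \<open>e\<close> pairs the other six, which leaves
  \<open>x = (2 x + 2 p + 2 s) / 4\<close>.\<close>

lemma moment4_hadamard:
  assumes ae: "a \<noteq> e"
  shows "moment4 b f b' f' a a a a = moment4 b f b' f' a e a e + moment4 b f b' f' a e e a"
proof -
  let ?m = "moment4 b f b' f'"
  let ?I = "\<lambda>p q r s. (\<lambda>U. U $ p $ b * U $ q $ f * cnj (U $ r $ b') * cnj (U $ s $ f'))"
  have int: "integrable haar (?I p q r s)" for p q r s
    by (intro haar_integrable continuous_intros)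
  have s: "complex_of_real (1 / sqrt 2) * complex_of_real (1 / sqrt 2) = 1 / 2"
    by (simp flip: of_real_mult)
  have "?m a a a a = (\<integral>U. 1 / 4 * (\<Sum>p\<in>{a, e}. \<Sum>q\<in>{a, e}. \<Sum>r\<in>{a, e}. \<Sum>s\<in>{a, e}. ?I p q r s U) \<partial>haar)"
    unfolding moment4_invariant[OF hadamard_mat(1)[OF ae]] hadamard_mat(2)[OF ae]
  proof (intro arg_cong[where f="integral\<^sup>L haar"] ext)
    fix U :: "'a cmat"
    define s where "s = complex_of_real (1 / sqrt 2)"
    have s: "s * s = 1 / 2" "cnj s = s" unfolding s_def by (simp_all flip: of_real_mult)
    have "s * (U $ a $ b + U $ e $ b) * (s * (U $ a $ f + U $ e $ f)) * cnj (s * (U $ a $ b' + U $ e $ b')) * cnj (s * (U $ a $ f' + U $ e $ f'))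
      = (s * s) * (s * s) * ((U $ a $ b + U $ e $ b) * (U $ a $ f + U $ e $ f) * (cnj (U $ a $ b') + cnj (U $ e $ b')) * (cnj (U $ a $ f') + cnj (U $ e $ f')))"
      by (simp add: s(2) mult_ac)
    also have "\<dots> = 1 / 4 * (\<Sum>p\<in>{a, e}. \<Sum>q\<in>{a, e}. \<Sum>r\<in>{a, e}. \<Sum>s\<in>{a, e}. ?I p q r s U)"
      unfolding s(1) using ae by (simp add: algebra_simps)
    finally show "complex_of_real (1 / sqrt 2) * (U $ a $ b + U $ e $ b) * (complex_of_real (1 / sqrt 2) * (U $ a $ f + U $ e $ f)) *
       cnj (complex_of_real (1 / sqrt 2) * (U $ a $ b' + U $ e $ b')) * cnj (complex_of_real (1 / sqrt 2) * (U $ a $ f' + U $ e $ f'))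
      = 1 / 4 * (\<Sum>p\<in>{a, e}. \<Sum>q\<in>{a, e}. \<Sum>r\<in>{a, e}. \<Sum>s\<in>{a, e}. ?I p q r s U)"
      unfolding s_def .
  qed
  also have "\<dots> = 1 / 4 * (\<Sum>p\<in>{a, e}. \<Sum>q\<in>{a, e}. \<Sum>r\<in>{a, e}. \<Sum>s\<in>{a, e}. ?m p q r s)"
    unfolding moment4_def
    by (simp only: integral_mult_right_zero Bochner_Integration.integral_sum Bochner_Integration.integrable_sum int)
  also have "\<dots> = 1 / 4 * (?m a a a a + ?m e e e e + ?m a e a e + ?m e a e a + ?m a e e a + ?m e a a e)"
    using ae by (simp add: moment4_phase)
  finally have 1: "?m a a a a = 1 / 4 * (?m a a a a + ?m e e e e + ?m a e a e + ?m e a e a + ?m a e e a + ?m e a a e)" .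
  have bij: "bij (Transposition.transpose a e)" by simp
  have 2: "?m e e e e = ?m a a a a" "?m e a e a = ?m a e a e" "?m e a a e = ?m a e e a"
    using moment4_perm[OF bij, of b f b' f' a a a a] moment4_perm[OF bij, of b f b' f' a e a e] moment4_perm[OF bij, of b f b' f' a e e a]
    by simp_all
  have "x = p + s" if "x = 1 / 4 * (x + x + p + p + s + s)" for x p s :: complex
    using that by (simp add: complex_eq_iff)
  then show ?thesis using 1 unfolding 2 by blast
qed

text \<open>In the rows, the moment is a combination of the identity and the swap, as expected of an
  operator commuting with all \<open>U \<otimes> U\<close>. Two unknowns remain for each choice of
  columns.\<close>

lemma moment4_structure:
  fixes b f b' f' :: "'n::finite"
  assumes card: "CARD('n) \<ge> 2"
  obtains P S where "\<And>a e a' e'. moment4 b f b' f' a e a' e' = (if a = a' \<and> e = e' then P else 0) + (if a = e' \<and> e = a' then S else 0)"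
proof -
  let ?m = "moment4 b f b' f'"
  obtain a0 e0 :: 'n where ae0: "a0 \<noteq> e0"
  proof -
    have "\<not> card (UNIV :: 'n set) \<le> Suc 0" using card by simp
    then show ?thesis using that by (auto simp: card_le_Suc0_iff_eq)
  qed
  define P where "P = ?m a0 e0 a0 e0"
  define S where "S = ?m a0 e0 e0 a0"
  have PS: "?m a e a e = P" "?m a e e a = S" if ae: "a \<noteq> e" for a e
  proof -
    obtain \<pi> where "bij \<pi>" "\<pi> a0 = a" "\<pi> e0 = e" using bij_two_points[OF ae0 ae] by blast
    then show "?m a e a e = P" "?m a e e a = S"
      using moment4_perm[of \<pi> b f b' f' a0 e0] by (auto simp: P_def S_def)
  qed
  have D: "?m a a a a = P + S" for a
  proof -
    obtain e where "a \<noteq> e" using ae0 by metis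
    then show ?thesis using moment4_hadamard[of a e] PS by simp
  qed
  show ?thesis
  proof (rule that[of P S])
    fix a e a' e'
    show "?m a e a' e' = (if a = a' \<and> e = e' then P else 0) + (if a = e' \<and> e = a' then S else 0)"
    proof (cases "(a = a' \<and> e = e') \<or> (a = e' \<and> e = a')")
      case True
      then consider "a = e" "a' = a" "e' = a" | "a \<noteq> e" "a' = a" "e' = e" | "a \<noteq> e" "a' = e" "e' = a" by blast
      then show ?thesis
      proof cases
        case 1
        show ?thesis unfolding 1(2,3) unfolding 1(1)[symmetric] D by simp
      next
        case 2
        show ?thesis unfolding 2(2,3) PS(1)[OF 2(1)] using 2(1) by simp
      next
        case 3
        show ?thesis unfolding 3(2,3) PS(2)[OF 3(1)] using 3(1) by simp
      qed
    next
      case False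
      then have "?m a e a' e' = 0" by (intro moment4_phase) auto
      moreover have "\<not> (a = a' \<and> e = e')" "\<not> (a = e' \<and> e = a')" using False by blast+
      ultimately show ?thesis by (simp only: if_False add_0_right)
    qed
  qed
qed

lemma haar_integral_const_unitary:
  fixes g :: "'n::finite cmat \<Rightarrow> complex"
  assumes "continuous_on UNIV g" "\<And>U. unitary U \<Longrightarrow> g U = c"
  shows "(\<integral>U. g U \<partial>haar) = c"
proof -
  interpret prob_space "haar :: 'n cmat measure" by (rule haar_prob_space)
  have "(\<integral>U. g U \<partial>haar) = (\<integral>U. c \<partial>(haar :: 'n cmat measure))"
  proof (rule integral_cong_AE)
    show "AE U in haar. g U = c" using AE_haar_unitary by eventually_elim (rule assms(2))
  qed (use assms(1) in \<open>auto intro!: borel_measurable_integrable haar_integrable\<close>)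
  then show ?thesis by (simp add: prob_space)
qed

text \<open>The Weingarten formula. Contracting the rows in the two possible ways gives by unitarity
  \<open>d^2 P + d S = X\<close> and \<open>d P + d^2 S = Y\<close>, solvable as \<open>d\<close> is
  at least 2.\<close>

theorem moment4_eq:
  fixes b f b' f' :: "'n::finite"
  assumes card: "CARD('n) \<ge> 2"
  defines "X \<equiv> if b = b' \<and> f = f' then 1 else (0::complex)" and "Y \<equiv> if b = f' \<and> f = b' then 1 else (0::complex)"
    and "d \<equiv> of_nat CARD('n) :: complex"
  shows "moment4 b f b' f' a e a' e' =
    ((if a = a' \<and> e = e' then X - Y / d else 0) + (if a = e' \<and> e = a' then Y - X / d else 0)) / (d\<^sup>2 - 1)"
proof -
  obtain P S where PS: "\<And>a e a' e'. moment4 b f b' f' a e a' e' = (if a = a' \<and> e = e' then P else 0) + (if a = e' \<and> e = a' then S else 0)"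
    using moment4_structure[OF card, of b f b' f'] by blast
  have dlt: "(\<Sum>a\<in>UNIV. \<Sum>e\<in>(UNIV::'n set). if a = e \<and> e = a then c else 0) = d * c" "(\<Sum>a\<in>(UNIV::'n set). \<Sum>e\<in>(UNIV::'n set). c) = d\<^sup>2 * c" for c :: complex
  proof -
    have "(\<Sum>a\<in>UNIV. \<Sum>e\<in>(UNIV::'n set). if a = e \<and> e = a then c else 0) = (\<Sum>a\<in>UNIV. \<Sum>e\<in>(UNIV::'n set). if e = a then c else 0)"
      by (intro sum.cong refl) auto
    then show "(\<Sum>a\<in>UNIV. \<Sum>e\<in>(UNIV::'n set). if a = e \<and> e = a then c else 0) = d * c" by (simp add: d_def)
    show "(\<Sum>a\<in>(UNIV::'n set). \<Sum>e\<in>(UNIV::'n set). c) = d\<^sup>2 * c" by (simp add: d_def power2_eq_square)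
  qed
  have int4: "integrable haar (\<lambda>U. U $ p $ b * U $ q $ f * cnj (U $ r $ b') * cnj (U $ s $ f'))" for p q r s
    by (intro haar_integrable continuous_intros)
  have "(\<Sum>a\<in>UNIV. \<Sum>e\<in>UNIV. moment4 b f b' f' a e a e) =
     (\<integral>U. (\<Sum>a\<in>UNIV. \<Sum>e\<in>UNIV. U $ a $ b * U $ e $ f * cnj (U $ a $ b') * cnj (U $ e $ f')) \<partial>haar)"
    unfolding moment4_def
    by (simp only: Bochner_Integration.integral_sum Bochner_Integration.integrable_sum int4)
  also have "\<dots> = X"
  proof (rule haar_integral_const_unitary)
    fix U :: "'n cmat" assume U: "unitary U"
    have "(\<Sum>a\<in>UNIV. \<Sum>e\<in>UNIV. U $ a $ b * U $ e $ f * cnj (U $ a $ b') * cnj (U $ e $ f')) =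
       (\<Sum>a\<in>UNIV. U $ a $ b * cnj (U $ a $ b')) * (\<Sum>e\<in>UNIV. U $ e $ f * cnj (U $ e $ f'))"
      unfolding sum_product by (simp add: mult_ac)
    then show "(\<Sum>a\<in>UNIV. \<Sum>e\<in>UNIV. U $ a $ b * U $ e $ f * cnj (U $ a $ b') * cnj (U $ e $ f')) = X"
      by (simp add: unitary_rows[OF U] X_def)
  qed (intro continuous_intros)
  finally have e1: "d\<^sup>2 * P + d * S = X" by (simp add: PS sum.distrib dlt(1)) (simp add: d_def power2_eq_square mult.assoc)
  have "(\<Sum>a\<in>UNIV. \<Sum>e\<in>UNIV. moment4 b f b' f' a e e a) =
     (\<integral>U. (\<Sum>a\<in>UNIV. \<Sum>e\<in>UNIV. U $ a $ b * U $ e $ f * cnj (U $ e $ b') * cnj (U $ a $ f')) \<partial>haar)"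
    unfolding moment4_def
    by (simp only: Bochner_Integration.integral_sum Bochner_Integration.integrable_sum int4)
  also have "\<dots> = Y"
  proof (rule haar_integral_const_unitary)
    fix U :: "'n cmat" assume U: "unitary U"
    have "(\<Sum>a\<in>UNIV. \<Sum>e\<in>UNIV. U $ a $ b * U $ e $ f * cnj (U $ e $ b') * cnj (U $ a $ f')) =
       (\<Sum>a\<in>UNIV. U $ a $ b * cnj (U $ a $ f')) * (\<Sum>e\<in>UNIV. U $ e $ f * cnj (U $ e $ b'))"
      unfolding sum_product by (simp add: mult_ac)
    then show "(\<Sum>a\<in>UNIV. \<Sum>e\<in>UNIV. U $ a $ b * U $ e $ f * cnj (U $ e $ b') * cnj (U $ a $ f')) = Y"
      by (simp add: unitary_rows[OF U] Y_def)
  qed (intro continuous_intros)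
  finally have e2: "d * P + d\<^sup>2 * S = Y" by (simp add: PS sum.distrib dlt(1)) (simp add: d_def power2_eq_square mult.assoc)
  have d: "d \<noteq> 0" "d\<^sup>2 - 1 \<noteq> 0"
  proof -
    have "2\<^sup>2 \<le> (real CARD('n))\<^sup>2" using card by (intro power_mono) auto
    then have "(real CARD('n))\<^sup>2 \<noteq> 1" by auto
    then have "complex_of_real ((real CARD('n))\<^sup>2) \<noteq> complex_of_real 1" by (simp only: of_real_eq_iff not_False_eq_True)
    moreover have "complex_of_real ((real CARD('n))\<^sup>2) = d\<^sup>2" by (simp only: d_def of_real_power of_real_of_nat_eq)
    ultimately show "d\<^sup>2 - 1 \<noteq> 0" by (simp only: of_real_1 right_minus_eq not_False_eq_True)
  qed (simp add: d_def)
  have "Y = d * (P + d * S)" "X = d * (S + d * P)"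
    using e1 e2 by (simp_all add: power2_eq_square algebra_simps)
  then have YX: "Y / d = P + d * S" "X / d = S + d * P"
    using d(1) by (simp_all only: nonzero_mult_div_cancel_left not_False_eq_True)
  have P: "X - Y / d = (d\<^sup>2 - 1) * P"
    unfolding YX(1) e1[symmetric] by (simp only: left_diff_distrib) simp
  have S: "Y - X / d = (d\<^sup>2 - 1) * S"
    unfolding YX(2) e2[symmetric] by (simp only: left_diff_distrib) simp
  have div: "(X - Y / d) / (d\<^sup>2 - 1) = P" "(Y - X / d) / (d\<^sup>2 - 1) = S"
    unfolding P S using d(2) by (simp_all only: nonzero_mult_div_cancel_left not_False_eq_True)
  have "((if b1 then X - Y / d else 0) + (if b2 then Y - X / d else 0)) / (d\<^sup>2 - 1) = (if b1 then P else 0) + (if b2 then S else 0)" for b1 b2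
    unfolding add_divide_distrib by (cases b1; cases b2) (simp_all only: if_True if_False div_0 div)
  then show ?thesis unfolding PS by simp
qed

section \<open>The randomly coupled vectors\<close>

lemma sum_pair: "(\<Sum>p\<in>UNIV. F p) = (\<Sum>a\<in>UNIV. \<Sum>b\<in>UNIV. F (a, b))"
  by (simp add: sum.cartesian_product flip: UNIV_Times_UNIV)

text \<open>The component of \<open>x\<close> at the basis vectors \<open>fst p\<close> of the first
  copy of A and \<open>snd p\<close> of the second, a vector of CE.\<close>

definition slot :: "complex^(('a::finite \<times> 'c::finite) \<times> ('a \<times> 'e::finite)) \<Rightarrow> 'a \<times> 'a \<Rightarrow> complex^('c \<times> 'e)" where
  "slot x p = (\<chi> z. x $ ((fst p, fst z), (snd p, snd z)))"

text \<open>If \<open>x\<close> is a vector of \<open>A'C \<otimes> AE\<close>, then \<open>couple U x\<close> is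
  \<open>d \<langle>\<Phi>|\<^sub>A\<^sub>'\<^sub>A U\<^sub>A x\<close>, a vector of \<open>CE\<close>; the channel output is
  \<open>T(U \<rho> U\<^sup>\<dagger>) = couple U (\<omega> \<otimes> \<rho>) couple U\<^sup>\<dagger>\<close>.\<close>

definition couple :: "'a::finite cmat \<Rightarrow> complex^(('a \<times> 'c::finite) \<times> ('a \<times> 'e::finite)) \<Rightarrow> complex^('c \<times> 'e)" where
  "couple U x = complex_of_real (sqrt (real CARD('a))) *s (\<Sum>p\<in>UNIV. U $ fst p $ snd p *s slot x p)"

lemma slot_add: "slot (x + y) p = slot x p + slot y p"
  and slot_diff: "slot (x - y) p = slot x p - slot y p"
  and slot_scale: "slot (c *s x) p = c *s slot x p"
  by (simp_all add: slot_def vec_eq_iff)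

lemma couple_diff: "couple U (x - y) = couple U x - couple U y"
  by (simp add: couple_def slot_diff vec_eq_iff sum_subtractf algebra_simps)

lemma couple_add: "couple U (x + y) = couple U x + couple U y"
  by (simp add: couple_def slot_add vec_eq_iff sum.distrib algebra_simps)

lemma couple_scale: "couple U (c *s x) = c *s couple U x"
  by (simp add: couple_def slot_scale vec_eq_iff sum_distrib_left mult_ac)

lemma couple_zero: "couple U 0 = 0"
  using couple_scale[of U 0 0] by simp

lemma couple_sum: "couple U (\<Sum>k\<in>S. f k) = (\<Sum>k\<in>S. couple U (f k))"
  by (induction S rule: infinite_finite_induct) (simp_all add: couple_add couple_zero)

lemma cinner_slot: "cinner t x = (\<Sum>p\<in>UNIV. cinner (slot t p) (slot x p))"
proof -
  let ?g = "\<lambda>a c b e. cnj (t $ ((a, c), (b, e))) * x $ ((a, c), (b, e))"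
  have "cinner t x = (\<Sum>a\<in>UNIV. \<Sum>c\<in>UNIV. \<Sum>b\<in>UNIV. \<Sum>e\<in>UNIV. ?g a c b e)"
    by (simp add: cinner_def sum_pair)
  also have "\<dots> = (\<Sum>a\<in>UNIV. \<Sum>b\<in>UNIV. \<Sum>c\<in>UNIV. \<Sum>e\<in>UNIV. ?g a c b e)"
    by (intro sum.cong refl sum.swap)
  finally show ?thesis by (simp add: cinner_def sum_pair slot_def)
qed

lemma couple_form:
  "cinner (couple U t) (Y *v couple U x) =
    of_nat CARD('a) * (\<Sum>p\<in>UNIV. \<Sum>q\<in>UNIV. cnj (U $ fst p $ snd p) * U $ fst q $ snd q * cinner (slot t p) (Y *v slot x q))"
  for U :: "'a::finite cmat"
proof -
  define k where "k = complex_of_real (sqrt (real CARD('a)))"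
  have kk: "of_nat CARD('a) = k * k"
    unfolding k_def of_real_mult[symmetric] by simp
  have mv: "Y *v (\<Sum>q\<in>UNIV. f q) = (\<Sum>q\<in>UNIV. Y *v f q)" for f :: "'a \<times> 'a \<Rightarrow> _"
    by (simp add: matrix_vector_mult_def vec_eq_iff sum_distrib_left sum_component) (intro allI sum.swap)
  show ?thesis
    unfolding couple_def k_def[symmetric] vector_scalar_commute cinner_scale_left cinner_scale_right mv
      cinner_sum_left cinner_sum_right kk sum_distrib_left
    by (subst sum.swap, intro sum.cong refl) (simp add: k_def mult_ac)
qed

lemma continuous_couple [continuous_intros]:
  "continuous_on S (\<lambda>U. couple U x)"
  unfolding couple_def vector_scalar_mult_def by (intro continuous_intros)

text \<open>The mean of \<open>K\<^sup>\<dagger> Y K\<close> is \<open>Y\<close> tensored with the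
  identity of both copies of A; at \<open>Y = 1\<close> the Gram matrix has mean 1.\<close>

lemma couple_first_moment:
  "(\<integral>U. cinner (couple U t) (Y *v couple U x) \<partial>haar) = (\<Sum>p\<in>UNIV. cinner (slot t p) (Y *v slot x p))"
  for t :: "complex^(('a::finite \<times> 'c::finite) \<times> ('a \<times> 'e::finite))"
proof -
  let ?h = "\<lambda>p q. cinner (slot t p) (Y *v slot x q)"
  have m: "(\<integral>U. cnj (U $ fst p $ snd p) * U $ fst q $ snd q \<partial>haar) = (if p = q then 1 / of_nat CARD('a) else 0)" for p q :: "'a \<times> 'a"
    using moment2_eq[of "fst q" "snd q" "fst p" "snd p"] by (auto simp: moment2_def mult.commute prod_eq_iff)
  have int: "integrable haar (\<lambda>U :: 'a cmat. cnj (U $ fst p $ snd p) * U $ fst q $ snd q * c)" for p q :: "'a \<times> 'a" and c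
    by (intro haar_integrable continuous_intros)
  have "(\<integral>U. cinner (couple U t) (Y *v couple U x) \<partial>haar) =
     of_nat CARD('a) * (\<Sum>p\<in>UNIV. \<Sum>q\<in>UNIV. (\<integral>U. cnj (U $ fst p $ snd p) * U $ fst q $ snd q \<partial>haar) * ?h p q)"
    unfolding couple_form
    by (simp only: integral_mult_right_zero integral_mult_left_zero Bochner_Integration.integral_sum Bochner_Integration.integrable_sum int)
  also have "\<dots> = (\<Sum>p\<in>UNIV. ?h p p)"
    unfolding m by (simp add: mult_if_distribs sum_divide_distrib[symmetric] cong: if_cong)
  finally show ?thesis .
qed

lemma couple_inner_moment: "(\<integral>U. cinner (couple U t) (couple U x) \<partial>haar) = cinner t x"
  using couple_first_moment[of t "mat 1" x] by (simp add: cinner_slot)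

section \<open>The variance of the entries of the Gram matrix\<close>

lemma sum_if_const: "(\<Sum>x\<in>A. if c then f x else 0) = (if c then \<Sum>x\<in>A. f x else 0)"
  by simp

lemma cmod_sq_sum_product:
  "complex_of_real ((cmod (\<Sum>i\<in>I. z i))\<^sup>2) = (\<Sum>i\<in>I. \<Sum>j\<in>I. z i * cnj (z j))"
  unfolding complex_norm_square by (simp add: sum_product)

text \<open>The four Weingarten terms. Matching pairings of rows and columns give the squared trace
  and the squared Hilbert-Schmidt norm of \<open>m\<close>; mixed pairings give, with factor
  \<open>- 1 / d\<close>, the squared norms of its two partial traces.\<close>

lemma haar_quartic:
  fixes m :: "'a::finite \<times> 'a \<Rightarrow> 'a \<times> 'a \<Rightarrow> complex"
  assumes card: "CARD('a) \<ge> 2"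
  defines "d \<equiv> real CARD('a)"
  shows "(\<integral>U. (cmod (\<Sum>p\<in>UNIV. \<Sum>q\<in>UNIV. cnj (U $ fst p $ snd p) * U $ fst q $ snd q * m p q))\<^sup>2 \<partial>haar) =
    ((cmod (\<Sum>p\<in>UNIV. m p p))\<^sup>2 + (\<Sum>p\<in>UNIV. \<Sum>q\<in>UNIV. (cmod (m p q))\<^sup>2)
     - ((\<Sum>v\<in>UNIV. \<Sum>w\<in>UNIV. (cmod (\<Sum>u\<in>UNIV. m (u, v) (u, w)))\<^sup>2)
       + (\<Sum>u'\<in>UNIV. \<Sum>u\<in>UNIV. (cmod (\<Sum>v\<in>UNIV. m (u', v) (u, v)))\<^sup>2)) / d) / (d\<^sup>2 - 1)"
proof -
  let ?k = "\<lambda>U p q p' q'. U $ fst q $ snd q * U $ fst p' $ snd p' * cnj (U $ fst p $ snd p) * cnj (U $ fst q' $ snd q')"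
  let ?c = "\<lambda>p q p' q'. m p q * cnj (m p' q')"
  let ?D = "complex_of_real d"
  have int: "integrable haar (\<lambda>U :: 'a cmat. c * ?k U p q p' q')" for p q p' q' :: "'a \<times> 'a" and c
    by (intro haar_integrable continuous_intros)
  have ev: "(\<integral>U. ?k U p q p' q' \<partial>haar) =
     ((if q = p \<and> p' = q' then 1 else 0) + (if q = q' \<and> p' = p then 1 else 0)
      - ((if fst q = fst p \<and> fst p' = fst q' \<and> snd q = snd q' \<and> snd p' = snd p then 1 else 0)
        + (if fst q = fst q' \<and> fst p' = fst p \<and> snd q = snd p \<and> snd p' = snd q' then 1 else 0)) / ?D) / (?D\<^sup>2 - 1)" for p q p' q' :: "'a \<times> 'a"
  proof -
    have "(\<integral>U. ?k U p q p' q' \<partial>haar) = moment4 (snd q) (snd p') (snd p) (snd q') (fst q) (fst p') (fst p) (fst q')"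
      by (simp add: moment4_def)
    moreover have "(q = p \<and> p' = q') \<longleftrightarrow> (fst q = fst p \<and> fst p' = fst q') \<and> (snd q = snd p \<and> snd p' = snd q')"
      "(q = q' \<and> p' = p) \<longleftrightarrow> (fst q = fst q' \<and> fst p' = fst p) \<and> (snd q = snd q' \<and> snd p' = snd p)"
      by (auto simp only: prod_eq_iff)
    moreover have "((if ab then (if fg then 1 else 0) - (if hi then 1 else 0) / D else 0)
        + (if ce then (if hi then 1 else 0) - (if fg then 1 else 0) / D else 0)) =
        (if ab \<and> fg then 1 else 0) + (if ce \<and> hi then 1 else 0) - ((if ab \<and> hi then 1 else 0) + (if ce \<and> fg then 1 else 0)) / D"
      for ab ce fg hi and D :: complex
      by (cases ab; cases ce; cases fg; cases hi) (simp_all add: add_divide_distrib)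
    ultimately show ?thesis
      unfolding moment4_eq[OF card] d_def by (simp only: conj_assoc of_real_of_nat_eq)
  qed
  have exp: "complex_of_real ((cmod (\<Sum>p\<in>UNIV. \<Sum>q\<in>UNIV. cnj (U $ fst p $ snd p) * U $ fst q $ snd q * m p q))\<^sup>2)
     = (\<Sum>p\<in>UNIV. \<Sum>q\<in>UNIV. \<Sum>p'\<in>UNIV. \<Sum>q'\<in>UNIV. ?c p q p' q' * ?k U p q p' q')" for U :: "'a cmat"
  proof -
    have "complex_of_real ((cmod (\<Sum>p\<in>UNIV. \<Sum>q\<in>UNIV. cnj (U $ fst p $ snd p) * U $ fst q $ snd q * m p q))\<^sup>2) =
      (\<Sum>p\<in>UNIV. \<Sum>p'\<in>UNIV. \<Sum>q\<in>UNIV. \<Sum>q'\<in>UNIV. ?c p q p' q' * ?k U p q p' q')"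
      unfolding cmod_sq_sum_product by (simp add: sum_product mult_ac)
    also have "\<dots> = (\<Sum>p\<in>UNIV. \<Sum>q\<in>UNIV. \<Sum>p'\<in>UNIV. \<Sum>q'\<in>UNIV. ?c p q p' q' * ?k U p q p' q')"
      by (intro sum.cong refl sum.swap)
    finally show ?thesis .
  qed
  let ?S = "\<lambda>F. (\<Sum>p\<in>UNIV. \<Sum>q\<in>UNIV. \<Sum>p'\<in>UNIV. \<Sum>q'\<in>UNIV. (F p q p' q' :: complex))"
  have A1: "?S (\<lambda>p q p' q'. if q = p then if p' = q' then ?c p q p' q' else 0 else 0) = complex_of_real ((cmod (\<Sum>p\<in>UNIV. m p p))\<^sup>2)"
    unfolding cmod_sq_sum_product by (simp add: sum_if_const)
  have A2: "?S (\<lambda>p q p' q'. if q = q' then if p' = p then ?c p q p' q' else 0 else 0) = complex_of_real (\<Sum>p\<in>UNIV. \<Sum>q\<in>UNIV. (cmod (m p q))\<^sup>2)"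
    unfolding of_real_sum complex_norm_square by (simp add: sum_if_const)
  \<comment> \<open>Nested conditionals instead of conjunctions let the sums collapse one delta at a
    time.\<close>
  have A3: "?S (\<lambda>p q p' q'. if fst q = fst p then if fst p' = fst q' then if snd q = snd q' then if snd p' = snd p then ?c p q p' q' else 0 else 0 else 0 else 0)
     = complex_of_real (\<Sum>v\<in>UNIV. \<Sum>w\<in>UNIV. (cmod (\<Sum>u\<in>UNIV. m (u, v) (u, w)))\<^sup>2)" (is "?L = _")
  proof -
    have "?L = (\<Sum>u\<in>UNIV. \<Sum>v\<in>UNIV. \<Sum>w\<in>UNIV. \<Sum>u'\<in>UNIV. m (u, v) (u, w) * cnj (m (u', v) (u', w)))"
      unfolding sum_pair by (simp add: sum_if_const)
    also have "\<dots> = (\<Sum>v\<in>UNIV. \<Sum>u\<in>UNIV. \<Sum>w\<in>UNIV. \<Sum>u'\<in>UNIV. m (u, v) (u, w) * cnj (m (u', v) (u', w)))"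
      by (rule sum.swap)
    also have "\<dots> = (\<Sum>v\<in>UNIV. \<Sum>w\<in>UNIV. \<Sum>u\<in>UNIV. \<Sum>u'\<in>UNIV. m (u, v) (u, w) * cnj (m (u', v) (u', w)))"
      by (intro sum.cong refl sum.swap)
    finally show ?thesis unfolding of_real_sum cmod_sq_sum_product .
  qed
  have A4: "?S (\<lambda>p q p' q'. if fst q = fst q' then if fst p' = fst p then if snd q = snd p then if snd p' = snd q' then ?c p q p' q' else 0 else 0 else 0 else 0)
     = complex_of_real (\<Sum>u'\<in>UNIV. \<Sum>u\<in>UNIV. (cmod (\<Sum>v\<in>UNIV. m (u', v) (u, v)))\<^sup>2)" (is "?L = _")
  proof -
    have "?L = (\<Sum>u'\<in>UNIV. \<Sum>v\<in>UNIV. \<Sum>u\<in>UNIV. \<Sum>v'\<in>UNIV. m (u', v) (u, v) * cnj (m (u', v') (u, v')))"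
      unfolding sum_pair by (simp add: sum_if_const)
    also have "\<dots> = (\<Sum>u'\<in>UNIV. \<Sum>u\<in>UNIV. \<Sum>v\<in>UNIV. \<Sum>v'\<in>UNIV. m (u', v) (u, v) * cnj (m (u', v') (u, v')))"
      by (intro sum.cong refl sum.swap)
    finally show ?thesis unfolding of_real_sum cmod_sq_sum_product .
  qed
  have i: "c * (if P then x else 0) = (if P then c * x else 0)" "(if P \<and> Q then c else 0) = (if P then if Q then c else 0 else 0)"
    for P Q and c x :: complex by simp_all
  have di: "c * ((x + y - (z + w) / D) / E) = (c * x + c * y - (c * z + c * w) / D) / E" for c x y z w D E :: complex
    by (simp add: algebra_simps)
  have "complex_of_real (\<integral>U. (cmod (\<Sum>p\<in>UNIV. \<Sum>q\<in>UNIV. cnj (U $ fst p $ snd p) * U $ fst q $ snd q * m p q))\<^sup>2 \<partial>haar)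
     = ?S (\<lambda>p q p' q'. ?c p q p' q' * (\<integral>U. ?k U p q p' q' \<partial>haar))"
    unfolding integral_complex_of_real[symmetric] exp
    by (simp only: integral_mult_right_zero Bochner_Integration.integral_sum Bochner_Integration.integrable_sum int)
  also have "\<dots> = ?S (\<lambda>p q p' q'. ((if q = p then if p' = q' then ?c p q p' q' else 0 else 0) + (if q = q' then if p' = p then ?c p q p' q' else 0 else 0)
      - ((if fst q = fst p then if fst p' = fst q' then if snd q = snd q' then if snd p' = snd p then ?c p q p' q' else 0 else 0 else 0 else 0)
        + (if fst q = fst q' then if fst p' = fst p then if snd q = snd p then if snd p' = snd q' then ?c p q p' q' else 0 else 0 else 0 else 0)) / ?D) / (?D\<^sup>2 - 1))"
    unfolding ev
    by (intro sum.cong refl) (simp only: di i mult_1_right)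
  also have "\<dots> = (complex_of_real ((cmod (\<Sum>p\<in>UNIV. m p p))\<^sup>2) + complex_of_real (\<Sum>p\<in>UNIV. \<Sum>q\<in>UNIV. (cmod (m p q))\<^sup>2)
     - (complex_of_real (\<Sum>v\<in>UNIV. \<Sum>w\<in>UNIV. (cmod (\<Sum>u\<in>UNIV. m (u, v) (u, w)))\<^sup>2)
       + complex_of_real (\<Sum>u'\<in>UNIV. \<Sum>u\<in>UNIV. (cmod (\<Sum>v\<in>UNIV. m (u', v) (u, v)))\<^sup>2)) / ?D) / (?D\<^sup>2 - 1)"
    by (simp only: sum_divide_distrib[symmetric] sum_subtractf sum.distrib A1 A2 A3 A4)
  also have "\<dots> = complex_of_real (((cmod (\<Sum>p\<in>UNIV. m p p))\<^sup>2 + (\<Sum>p\<in>UNIV. \<Sum>q\<in>UNIV. (cmod (m p q))\<^sup>2)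
     - ((\<Sum>v\<in>UNIV. \<Sum>w\<in>UNIV. (cmod (\<Sum>u\<in>UNIV. m (u, v) (u, w)))\<^sup>2)
       + (\<Sum>u'\<in>UNIV. \<Sum>u\<in>UNIV. (cmod (\<Sum>v\<in>UNIV. m (u', v) (u, v)))\<^sup>2)) / d) / (d\<^sup>2 - 1))"
    by (simp only: of_real_add of_real_diff of_real_divide of_real_power of_real_1)
  finally show ?thesis
    by (simp only: of_real_eq_iff)
qed

text \<open>The squared mean enters the second moment with factor \<open>d^2 / (d^2 - 1)\<close>,
  slightly too large to be subtracted away. The negative partial trace terms make up exactly for
  this excess.\<close>

theorem couple_variance:
  fixes t x :: "complex^(('a::finite \<times> 'c::finite) \<times> ('a \<times> 'e::finite))"
  shows "(\<integral>U. (cmod (cinner (couple U t) (couple U x) - cinner t x))\<^sup>2 \<partial>haar)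
    \<le> 4 / 3 * (\<Sum>p\<in>UNIV. \<Sum>q\<in>UNIV. (cmod (cinner (slot t p) (slot x q)))\<^sup>2)"
proof (cases "CARD('a) \<ge> 2")
  case False
  moreover have "CARD('a) > 0" by simp
  ultimately have "CARD('a) = 1" by linarith
  then obtain a :: 'a where a: "UNIV = {a}" by (auto simp: card_1_singleton_iff)
  \<comment> \<open>In dimension one \<open>U\<close> is a phase, which cancels in the Gram
    matrix.\<close>
  have "cinner (couple U t) (couple U x) = cinner t x" if "unitary U" for U :: "'a cmat"
  proof -
    have "U $ a $ a * cnj (U $ a $ a) = 1" using unitary_rows[OF that, of a a] by (simp add: a)
    then show ?thesis
      using couple_form[of U t "mat 1" x] \<open>CARD('a) = 1\<close> unfolding cinner_slot sum_pair a
      by (simp add: mult.commute)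
  qed
  then have "(\<integral>U. (cmod (cinner (couple U t) (couple U x) - cinner t x))\<^sup>2 \<partial>haar) = (\<integral>U. 0 \<partial>(haar :: 'a cmat measure))"
  proof (intro integral_cong_AE)
    assume eq: "\<And>U :: 'a cmat. unitary U \<Longrightarrow> cinner (couple U t) (couple U x) = cinner t x"
    show "AE U in haar. (cmod (cinner (couple U t) (couple U x) - cinner t x))\<^sup>2 = 0"
      using AE_haar_unitary by eventually_elim (simp add: eq)
    show "(\<lambda>U. (cmod (cinner (couple U t) (couple U x) - cinner t x))\<^sup>2) \<in> borel_measurable haar"
      unfolding cinner_def by (intro borel_measurable_integrable haar_integrable continuous_intros)
  qed simp
  then show ?thesis by (simp add: sum_nonneg)
next
  case card: True
  define d where "d = real CARD('a)"
  define m where "m p q = cinner (slot t p) (slot x q)" for p q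
  define G where "G U = (\<Sum>p\<in>UNIV. \<Sum>q\<in>UNIV. cnj (U $ fst p $ snd p) * U $ fst q $ snd q * m p q)" for U :: "'a cmat"
  define w where "w = cinner t x"
  let ?N1 = "\<Sum>v\<in>UNIV. \<Sum>w\<in>UNIV. (cmod (\<Sum>u\<in>UNIV. m (u, v) (u, w)))\<^sup>2"
  let ?N2 = "\<Sum>u'\<in>UNIV. \<Sum>u\<in>UNIV. (cmod (\<Sum>v\<in>UNIV. m (u', v) (u, v)))\<^sup>2"
  let ?M = "\<Sum>p\<in>UNIV. \<Sum>q\<in>UNIV. (cmod (m p q))\<^sup>2"
  have d2: "d \<ge> 2" using of_nat_mono[OF card, where 'a=real] unfolding d_def of_nat_numeral .
  have form: "cinner (couple U t) (couple U x) = of_real d * G U" for U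
    using couple_form[of U t "mat 1" x] by (simp add: G_def m_def d_def)
  have w: "w = (\<Sum>p\<in>UNIV. m p p)" by (simp add: w_def m_def cinner_slot)
  have contG: "continuous_on UNIV G" unfolding G_def by (intro continuous_intros)
  have "(\<integral>U. of_real d * G U \<partial>haar) = w"
    unfolding form[symmetric] w_def by (rule couple_inner_moment)
  then have "(\<integral>U. of_real d * G U * cnj w \<partial>haar) = w * cnj w"
    by (simp only: integral_mult_left_zero)
  also have "\<dots> = complex_of_real ((cmod w)\<^sup>2)" by (simp only: complex_norm_square)
  finally have "Re (\<integral>U. of_real d * G U * cnj w \<partial>haar) = (cmod w)\<^sup>2" by (simp only: Re_complex_of_real)
  moreover have "integrable haar (\<lambda>U. of_real d * G U * cnj w)"
    by (intro haar_integrable continuous_intros contG)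
  ultimately have mean: "(\<integral>U. Re (of_real d * G U * cnj w) \<partial>haar) = (cmod w)\<^sup>2"
    by (simp only: integral_Re)
  \<comment> \<open>Cauchy-Schwarz for the trace of the \<open>d\<close> by \<open>d\<close> partial
    trace of \<open>m\<close>, whose full trace is \<open>w\<close>.\<close>
  have "(cmod w)\<^sup>2 \<le> d * ?N1"
  proof -
    have "cmod w \<le> (\<Sum>v\<in>UNIV. cmod (\<Sum>u\<in>UNIV. m (u, v) (u, v)))"
      unfolding w sum_pair by (subst sum.swap) (rule norm_sum)
    then have "(cmod w)\<^sup>2 \<le> (\<Sum>v\<in>UNIV. cmod (\<Sum>u\<in>UNIV. m (u, v) (u, v)))\<^sup>2"
      by (intro power_mono) auto
    also have "\<dots> \<le> d * (\<Sum>v\<in>UNIV. (cmod (\<Sum>u\<in>UNIV. m (u, v) (u, v)))\<^sup>2)"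
      unfolding d_def mult.commute[of "real CARD('a)"] by (rule sum_squared_le_sum_of_squares)
    also have "\<dots> \<le> d * ?N1"
      using d2 by (intro mult_left_mono sum_mono member_le_sum) auto
    finally show ?thesis .
  qed
  then have N1: "(cmod w)\<^sup>2 / d \<le> ?N1" using d2 by (simp add: field_simps)
  have N2: "?N2 \<ge> 0" by (intro sum_nonneg) auto
  have "(\<integral>U. (cmod (cinner (couple U t) (couple U x) - cinner t x))\<^sup>2 \<partial>haar) =
     (\<integral>U. d\<^sup>2 * (cmod (G U))\<^sup>2 - 2 * Re (of_real d * G U * cnj w) + (cmod w)\<^sup>2 \<partial>haar)"
  proof (intro arg_cong[where f="integral\<^sup>L haar"] ext)
    fix U
    show "(cmod (cinner (couple U t) (couple U x) - cinner t x))\<^sup>2 = d\<^sup>2 * (cmod (G U))\<^sup>2 - 2 * Re (of_real d * G U * cnj w) + (cmod w)\<^sup>2"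
      unfolding form w_def[symmetric] cmod_power2 by (simp add: power2_eq_square algebra_simps)
  qed
  also have "\<dots> = d\<^sup>2 * (\<integral>U. (cmod (G U))\<^sup>2 \<partial>haar) - 2 * (cmod w)\<^sup>2 + (cmod w)\<^sup>2"
  proof -
    interpret prob_space "haar :: 'a cmat measure" by (rule haar_prob_space)
    have "integrable haar (\<lambda>U. (cmod (G U))\<^sup>2)" "integrable haar (\<lambda>U. Re (of_real d * G U * cnj w))"
      using contG by (auto intro!: haar_integrable continuous_intros)
    moreover have "(\<integral>U. a * f U - 2 * h U + c \<partial>haar) = a * (\<integral>U. f U \<partial>haar) - 2 * (\<integral>U. h U \<partial>haar) + c"
      if "integrable haar f" "integrable haar h" for f h :: "'a cmat \<Rightarrow> real" and a c
      using that by (simp add: prob_space)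
    ultimately have "(\<integral>U. d\<^sup>2 * (cmod (G U))\<^sup>2 - 2 * Re (of_real d * G U * cnj w) + (cmod w)\<^sup>2 \<partial>haar) =
      d\<^sup>2 * (\<integral>U. (cmod (G U))\<^sup>2 \<partial>haar) - 2 * (\<integral>U. Re (of_real d * G U * cnj w) \<partial>haar) + (cmod w)\<^sup>2"
      by blast
    then show ?thesis unfolding mean .
  qed
  also have "(\<integral>U. (cmod (G U))\<^sup>2 \<partial>haar) = ((cmod w)\<^sup>2 + ?M - (?N1 + ?N2) / d) / (d\<^sup>2 - 1)"
    unfolding G_def haar_quartic[OF card] w d_def ..
  also have "d\<^sup>2 * (((cmod w)\<^sup>2 + ?M - (?N1 + ?N2) / d) / (d\<^sup>2 - 1)) - 2 * (cmod w)\<^sup>2 + (cmod w)\<^sup>2 \<le> 4 / 3 * ?M"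
  proof -
    \<comment> \<open>Makes \<open>d^2 / (d^2 - 1)\<close> at most \<open>4 / 3\<close>, with
      equality at \<open>d = 2\<close>.\<close>
    have d1: "d\<^sup>2 \<ge> 4" using power_mono[OF d2, of 2] by simp
    have "(cmod w)\<^sup>2 / d / d \<le> (?N1 + ?N2) / d"
      using N1 N2 d2 by (intro divide_right_mono) auto
    moreover have "W * (d\<^sup>2 - 1) / d\<^sup>2 = W - W / d / d" for W
      using d2 by (simp add: power2_eq_square field_simps)
    ultimately have "(cmod w)\<^sup>2 + ?M - (?N1 + ?N2) / d \<le> (cmod w)\<^sup>2 * (d\<^sup>2 - 1) / d\<^sup>2 + ?M"
      by simp
    then have "d\<^sup>2 * (((cmod w)\<^sup>2 + ?M - (?N1 + ?N2) / d) / (d\<^sup>2 - 1)) \<le> d\<^sup>2 * (((cmod w)\<^sup>2 * (d\<^sup>2 - 1) / d\<^sup>2 + ?M) / (d\<^sup>2 - 1))"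
      using d1 by (intro mult_left_mono divide_right_mono) auto
    also have "\<dots> = (cmod w)\<^sup>2 + d\<^sup>2 / (d\<^sup>2 - 1) * ?M"
    proof -
      have "D * ((W * E / D + M) / E) = W + D / E * M" if "D \<noteq> 0" "E \<noteq> 0" for D E W M :: real
        using that by (simp add: field_simps)
      then show ?thesis using d1 d2 by simp
    qed
    also have "\<dots> \<le> (cmod w)\<^sup>2 + 4 / 3 * ?M"
      using d1 by (intro add_left_mono mult_right_mono sum_nonneg) (auto simp: field_simps)
    finally show ?thesis by linarith
  qed
  finally show ?thesis by (simp add: m_def)
qed

section \<open>Tensor products and Choi matrices\<close>

lemma tensor_mult: "tensor A B ** tensor C D = tensor (A ** C) (B ** D)"
  by (simp add: tensor_def matrix_matrix_mult_def vec_eq_iff sum_pair sum_product mult_ac)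

lemma adj_tensor: "adj (tensor A B) = tensor (adj A) (adj B)"
  by (simp add: tensor_def adj_def vec_eq_iff)

lemma tensor_one: "tensor (mat 1) (mat 1) = mat 1"
  by (auto simp: tensor_def mat_def vec_eq_iff)

lemma tensor_rdiag: "tensor (rdiag d) (rdiag e) = rdiag (\<lambda>p. d (fst p) * e (snd p))"
  by (auto simp: tensor_def rdiag_def vec_eq_iff)

lemma qtr_tensor: "qtr (tensor A B) = qtr A * qtr B"
  by (simp add: tensor_def qtr_def sum_pair sum_product)

lemma unitary_tensor: "unitary U \<Longrightarrow> unitary V \<Longrightarrow> unitary (tensor U V)"
  by (simp add: unitary_def adj_tensor tensor_mult tensor_one)

lemma tensor_spectral:
  "tensor (U ** rdiag d ** adj U) (V ** rdiag e ** adj V) =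
    tensor U V ** rdiag (\<lambda>p. d (fst p) * e (snd p)) ** adj (tensor U V)"
  by (simp add: adj_tensor tensor_mult flip: tensor_rdiag)

lemma psd_tensor:
  assumes "psd A" "psd B"
  shows "psd (tensor A B)"
proof -
  obtain U d where U: "unitary U" "A = U ** rdiag d ** adj U" "\<And>k. d k \<ge> 0" using psd_spectral assms(1) by blast
  obtain V e where V: "unitary V" "B = V ** rdiag e ** adj V" "\<And>k. e k \<ge> 0" using psd_spectral assms(2) by blast
  show ?thesis
    unfolding U(2) V(2) tensor_spectral using U V by (simp add: psd_spectral_iff unitary_tensor)
qed

lemma mfun_tensor:
  assumes "psd A" "psd B" and f: "\<And>x y. x \<ge> 0 \<Longrightarrow> y \<ge> 0 \<Longrightarrow> f (x * y) = f x * f y"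
  shows "mfun f (tensor A B) = tensor (mfun f A) (mfun f B)"
proof -
  obtain U d where U: "unitary U" "A = U ** rdiag d ** adj U" "\<And>k. d k \<ge> 0" using psd_spectral assms(1) by blast
  obtain V e where V: "unitary V" "B = V ** rdiag e ** adj V" "\<And>k. e k \<ge> 0" using psd_spectral assms(2) by blast
  have "f \<circ> (\<lambda>p. d (fst p) * e (snd p)) = (\<lambda>p. (f \<circ> d) (fst p) * (f \<circ> e) (snd p))"
    using f U(3) V(3) by auto
  moreover have "tensor A B = tensor U V ** rdiag (\<lambda>p. d (fst p) * e (snd p)) ** adj (tensor U V)"
    unfolding U(2) V(2) tensor_spectral ..
  ultimately show ?thesis
    by (simp only: mfun_spectral[OF U(1,2)] mfun_spectral[OF V(1,2)] tensor_spectral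
        mfun_spectral[OF unitary_tensor[OF U(1) V(1)]])
qed

lemma psd_mat1: "psd (mat 1)"
  by (simp add: psd_def cinner_self)

text \<open>The form of the marginal at \<open>v\<close> is the sum of the forms of \<open>M\<close>
  at the vectors \<open>u v i\<close>, which are \<open>v\<close> tensored with the basis vectors of
  the traced factor.\<close>

lemma psd_ptr1:
  fixes M :: "('a::finite \<times> 'b::finite) cmat"
  assumes "psd M"
  shows "psd (ptr1 M)"
proof -
  define u where "u v i = (\<chi> p. if fst p = i then v $ snd p else 0)" for v :: "complex^'b" and i :: 'a
  have "cinner v (ptr1 M *v v) = (\<Sum>i\<in>UNIV. cinner (u v i) (M *v u v i))" for v
  proof -
    have "cinner (u v i) (M *v u v i)
       = (\<Sum>k\<in>UNIV. \<Sum>l\<in>UNIV. cnj (v $ k) * (M $ (i, k) $ (i, l) * v $ l))" for i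
      unfolding u_def cinner_def matrix_vector_mult_def sum_pair
      by (simp add: if_distrib[where f=cnj] mult_if_distribs
          sum_if_const sum_distrib_left cong: if_cong)
    then have "(\<Sum>i\<in>UNIV. cinner (u v i) (M *v u v i))
       = (\<Sum>i\<in>UNIV. \<Sum>k\<in>UNIV. \<Sum>l\<in>UNIV. cnj (v $ k) * (M $ (i, k) $ (i, l) * v $ l))" by simp
    also have "\<dots> = (\<Sum>k\<in>UNIV. \<Sum>l\<in>UNIV. \<Sum>i\<in>UNIV. cnj (v $ k) * (M $ (i, k) $ (i, l) * v $ l))"
      by (subst sum.swap) (intro sum.cong refl sum.swap)
    finally show ?thesis
      by (simp add: cinner_def ptr1_def matrix_vector_mult_def sum_distrib_left sum_distrib_right)
  qed
  then show ?thesis using assms by (auto simp: psd_def intro!: sum_nonneg)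
qed

lemma qtr_ptr1: "qtr (ptr1 M) = qtr M"
  unfolding qtr_def ptr1_def sum_pair by simp (rule sum.swap)

section \<open>The Choi matrix of a channel\<close>

definition unit_mat :: "'a::finite \<Rightarrow> 'a \<Rightarrow> 'a cmat" where
  "unit_mat a b = (\<chi> i j. if i = a \<and> j = b then 1 else 0)"

lemma clinear_sum:
  assumes "clinear_map T"
  shows "T (\<Sum>i\<in>I. f i) = (\<Sum>i\<in>I. T (f i))"
proof -
  have add: "T (X + Y) = T X + T Y" for X Y using assms by (simp add: clinear_map_def)
  have zero: "T 0 = 0" using add[of 0 0] by simp
  show ?thesis by (induction I rule: infinite_finite_induct) (simp_all add: add zero)
qed

lemma clinear_entries:
  assumes "clinear_map T"
  shows "T M $ c $ c' = (\<Sum>a\<in>UNIV. \<Sum>b\<in>UNIV. M $ a $ b * T (unit_mat a b) $ c $ c')"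
proof -
  have sc: "T (cscale z X) = cscale z (T X)" for z X using assms by (simp add: clinear_map_def)
  have "M = (\<Sum>a\<in>UNIV. \<Sum>b\<in>UNIV. cscale (M $ a $ b) (unit_mat a b))"
  proof -
    have "(\<Sum>a\<in>UNIV. \<Sum>b\<in>UNIV. cscale (M $ a $ b) (unit_mat a b)) $ i $ j = M $ i $ j" for i j
    proof -
      have "(\<Sum>a\<in>UNIV. \<Sum>b\<in>UNIV. cscale (M $ a $ b) (unit_mat a b)) $ i $ j = (\<Sum>a\<in>UNIV. \<Sum>b\<in>UNIV. if i = a then if j = b then M $ a $ b else 0 else 0)"
        by (simp add: sum_component cscale_def unit_mat_def if_distrib cong: if_cong) (intro sum.cong refl, auto)
      then show ?thesis by (simp add: sum_if_const)
    qed
    then show ?thesis by (simp add: vec_eq_iff)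
  qed
  then have "T M = (\<Sum>a\<in>UNIV. \<Sum>b\<in>UNIV. cscale (M $ a $ b) (T (unit_mat a b)))"
    by (metis (no_types, lifting) clinear_sum[OF assms] sc sum.cong)
  then show ?thesis by (simp add: sum_component cscale_def)
qed

text \<open>Recovers the map from its Choi state; the dimension factor undoes the normalisation of
  \<open>max_ent\<close>.\<close>

lemma choi_entries:
  fixes T :: "'a::finite cmat \<Rightarrow> 'c::finite cmat"
  assumes "clinear_map T"
  shows "T (unit_mat a b) $ c $ c' = of_nat CARD('a) * choi T $ (a, c) $ (b, c')"
proof -
  have "max_ent $ (a, i) $ (b, j) = 1 / of_nat CARD('a) * unit_mat a b $ i $ j" for i j
    unfolding max_ent_def unit_mat_def by (cases "a = i"; cases "b = j") auto
  then have me: "(\<chi> i j. max_ent $ (a, i) $ (b, j)) = cscale (1 / of_nat CARD('a)) (unit_mat a b)"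
    unfolding cscale_def by simp
  have "T (cscale (1 / of_nat CARD('a)) (unit_mat a b)) = cscale (1 / of_nat CARD('a)) (T (unit_mat a b))"
    using assms unfolding clinear_map_def by blast
  then have "choi T $ (a, c) $ (b, c') = 1 / of_nat CARD('a) * T (unit_mat a b) $ c $ c'"
    unfolding choi_def map_right_def by (simp add: me) (simp add: cscale_def)
  moreover have "of_nat CARD('a) \<noteq> (0 :: complex)" by simp
  ultimately show ?thesis by simp
qed

text \<open>Identifies the decoupled state on C in the theorem with the marginal occurring in the
  entropy of the Choi state.\<close>

lemma ptr1_choi:
  fixes T :: "'a::finite cmat \<Rightarrow> 'c::finite cmat"
  assumes "clinear_map T"
  shows "ptr1 (choi T) = T maximally_mixed"
proof -
  have "T maximally_mixed $ c $ c' = ptr1 (choi T) $ c $ c'" for c c'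
  proof -
    have "T maximally_mixed $ c $ c' = (\<Sum>a\<in>UNIV. \<Sum>b\<in>UNIV. if a = b then choi T $ (a, c) $ (b, c') else 0)"
      unfolding clinear_entries[OF assms, of maximally_mixed] choi_entries[OF assms]
      by (intro sum.cong refl) (simp add: maximally_mixed_def cscale_def mat_def)
    then show ?thesis by (simp add: ptr1_def)
  qed
  then show ?thesis by (simp add: vec_eq_iff)
qed

lemma qtr_choi:
  fixes T :: "'a::finite cmat \<Rightarrow> 'c::finite cmat"
  assumes "channel T"
  shows "qtr (choi T) = 1"
proof -
  have lin: "clinear_map T" and tp: "qtr (T X) = qtr X" for X
    using assms by (auto simp: channel_def trace_preserving_def)
  have "qtr (choi T) = qtr (maximally_mixed :: 'a cmat)"
    unfolding qtr_ptr1[symmetric] ptr1_choi[OF lin] by (rule tp)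
  also have "\<dots> = (\<Sum>i\<in>(UNIV :: 'a set). 1 / of_nat CARD('a))"
    unfolding maximally_mixed_def cscale_def mat_def qtr_def by (intro sum.cong) simp_all
  also have "\<dots> = 1" by simp
  finally show ?thesis .
qed

text \<open>Complete positivity is stated for blocks numbered by naturals, so \<open>h\<close>
  enumerates the basis. The block matrix of matrix units is positive because its form is the squared
  modulus of one sum, and its image under \<open>T\<close> is the Choi matrix up to the factor
  \<open>CARD('a)\<close>.\<close>

lemma psd_choi:
  fixes T :: "'a::finite cmat \<Rightarrow> 'c::finite cmat"
  assumes "channel T"
  shows "psd (choi T)"
proof -
  let ?n = "CARD('a)"
  have lin: "clinear_map T" and cp: "completely_positive T" using assms by (auto simp: channel_def)
  obtain h :: "nat \<Rightarrow> 'a" where h: "bij_betw h {..<?n} UNIV"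
    using ex_bij_betw_nat_finite[of "UNIV :: 'a set"] by (auto simp: atLeast0LessThan)
  define X where "X k l = unit_mat (h k) (h l)" for k l
  have "block_psd ?n X"
    unfolding block_psd_def
  proof
    fix v :: "nat \<Rightarrow> complex^'a"
    have "cinner (v k) (X k l *v v l) = cnj (v k $ h k) * v l $ h l" for k l
    proof -
      have "(X k l *v v l) $ i = (if i = h k then v l $ h l else 0)" for i
        unfolding matrix_vector_mult_def X_def unit_mat_def
        by (cases "i = h k") (simp_all add: mult_if_distribs cong: if_cong)
      then show ?thesis by (simp add: cinner_def mult_if_distribs cong: if_cong)
    qed
    then have "(\<Sum>k<?n. \<Sum>l<?n. cinner (v k) (X k l *v v l)) = cnj (\<Sum>k<?n. v k $ h k) * (\<Sum>l<?n. v l $ h l)"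
      by (simp add: sum_product)
    also have "\<dots> = complex_of_real ((cmod (\<Sum>k<?n. v k $ h k))\<^sup>2)"
      by (simp only: complex_norm_square mult.commute)
    finally show "Im (\<Sum>k<?n. \<Sum>l<?n. cinner (v k) (X k l *v v l)) = 0 \<and> Re (\<Sum>k<?n. \<Sum>l<?n. cinner (v k) (X k l *v v l)) \<ge> 0"
      by (simp only: Re_complex_of_real Im_complex_of_real zero_le_power2 simp_thms)
  qed
  then have pos: "block_psd ?n (\<lambda>k l. T (X k l))" using cp by (simp add: completely_positive_def)
  have "of_nat ?n * cinner w (choi T *v w) = (\<Sum>k<?n. \<Sum>l<?n. cinner (\<chi> c. w $ (h k, c)) (T (X k l) *v (\<chi> c. w $ (h l, c))))" for w
  proof -
    let ?F = "\<lambda>a b. (\<Sum>c\<in>UNIV. \<Sum>c'\<in>UNIV. cnj (w $ (a, c)) * (of_nat ?n * choi T $ (a, c) $ (b, c') * w $ (b, c')))"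
    have "(\<Sum>k<?n. \<Sum>l<?n. cinner (\<chi> c. w $ (h k, c)) (T (X k l) *v (\<chi> c. w $ (h l, c)))) = (\<Sum>k<?n. \<Sum>l<?n. ?F (h k) (h l))"
      by (simp add: cinner_def matrix_vector_mult_def X_def choi_entries[OF lin] sum_distrib_left)
    also have "\<dots> = (\<Sum>a\<in>UNIV. \<Sum>b\<in>UNIV. ?F a b)"
      by (subst sum.reindex_bij_betw[OF h]) (subst sum.reindex_bij_betw[OF h], rule refl)
    also have "\<dots> = (\<Sum>a\<in>UNIV. \<Sum>c\<in>UNIV. \<Sum>b\<in>UNIV. \<Sum>c'\<in>UNIV. cnj (w $ (a, c)) * (of_nat ?n * choi T $ (a, c) $ (b, c') * w $ (b, c')))"
      by (intro sum.cong refl sum.swap)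
    also have "\<dots> = of_nat ?n * cinner w (choi T *v w)"
      by (simp add: cinner_def matrix_vector_mult_def sum_pair sum_distrib_left mult_ac)
    finally show ?thesis by simp
  qed
  then have sc: "complex_of_real (real ?n) * cinner w (choi T *v w) = (\<Sum>k<?n. \<Sum>l<?n. cinner (\<chi> c. w $ (h k, c)) (T (X k l) *v (\<chi> c. w $ (h l, c))))" for w
    by simp
  show ?thesis
    unfolding psd_def
  proof
    fix w
    have "Im (complex_of_real (real ?n) * cinner w (choi T *v w)) = 0" "Re (complex_of_real (real ?n) * cinner w (choi T *v w)) \<ge> 0"
      unfolding sc using pos[unfolded block_psd_def, THEN spec, of "\<lambda>k. \<chi> c. w $ (h k, c)"] by simp_all
    then show "Im (cinner w (choi T *v w)) = 0 \<and> Re (cinner w (choi T *v w)) \<ge> 0"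
      by (simp add: zero_le_mult_iff)
  qed
qed

section \<open>The channel output as a random mixture\<close>

lemma spectral_entries:
  "(U ** rdiag d ** adj U) $ i $ j = (\<Sum>k\<in>UNIV. complex_of_real (d k) * (U $ i $ k * cnj (U $ j $ k)))"
  by (simp add: matrix_matrix_mult_def rdiag_def adj_def mult_if_distribs mult_ac cong: if_cong)

text \<open>Expanding \<open>T\<close> in matrix units and inserting Choi entries gives, entry by
  entry, the conjugation of \<open>choi T \<otimes> \<rho>\<close> by \<open>K\<close>.\<close>

lemma map_left_entries:
  fixes T :: "'a::finite cmat \<Rightarrow> 'c::finite cmat" and \<rho> :: "('a \<times> 'e::finite) cmat"
  assumes "clinear_map T"
  shows "map_left T (tensor U (mat 1) ** \<rho> ** adj (tensor U (mat 1))) $ z $ w =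
    of_nat CARD('a) * (\<Sum>p\<in>UNIV. \<Sum>q\<in>UNIV. U $ fst p $ snd p * cnj (U $ fst q $ snd q) *
      (choi T $ (fst p, fst z) $ (fst q, fst w) * \<rho> $ (snd p, snd z) $ (snd q, snd w)))"
proof -
  have conj: "(tensor U (mat 1) ** \<rho> ** adj (tensor U (mat 1))) $ (a, e) $ (b, f) = (\<Sum>i\<in>UNIV. \<Sum>j\<in>UNIV. U $ a $ i * \<rho> $ (i, e) $ (j, f) * cnj (U $ b $ j))" for a b e f
  proof -
    have 1: "(tensor U (mat 1) ** \<rho>) $ (a, e) $ q = (\<Sum>i\<in>UNIV. U $ a $ i * \<rho> $ (i, e) $ q)" for q
      by (simp add: matrix_matrix_mult_def sum_pair tensor_def mat_def mult_if_distribs cong: if_cong)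
    have "(tensor U (mat 1) ** \<rho> ** adj (tensor U (mat 1))) $ (a, e) $ (b, f) = (\<Sum>j\<in>UNIV. (tensor U (mat 1) ** \<rho>) $ (a, e) $ (j, f) * cnj (U $ b $ j))"
      by (subst matrix_matrix_mult_def) (simp add: sum_pair tensor_def adj_def mat_def mult_if_distribs if_distrib[where f=cnj] cong: if_cong)
    also have "\<dots> = (\<Sum>j\<in>UNIV. \<Sum>i\<in>UNIV. U $ a $ i * \<rho> $ (i, e) $ (j, f) * cnj (U $ b $ j))"
      by (simp add: 1 sum_distrib_right)
    also have "\<dots> = (\<Sum>i\<in>UNIV. \<Sum>j\<in>UNIV. U $ a $ i * \<rho> $ (i, e) $ (j, f) * cnj (U $ b $ j))"
      by (rule sum.swap)
    finally show ?thesis .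
  qed
  obtain c e c' e' where zw: "z = (c, e)" "w = (c', e')" by (metis surj_pair)
  let ?t = "\<lambda>a b i j. U $ a $ i * cnj (U $ b $ j) * (choi T $ (a, c) $ (b, c') * \<rho> $ (i, e) $ (j, e'))"
  have "map_left T (tensor U (mat 1) ** \<rho> ** adj (tensor U (mat 1))) $ z $ w = of_nat CARD('a) * (\<Sum>a\<in>UNIV. \<Sum>b\<in>UNIV. \<Sum>i\<in>UNIV. \<Sum>j\<in>UNIV. ?t a b i j)"
    unfolding map_left_def vec_lambda_beta zw fst_conv snd_conv
    by (subst clinear_entries[OF assms])
       (simp add: choi_entries[OF assms] conj sum_distrib_left sum_distrib_right mult_ac)
  also have "(\<Sum>a\<in>UNIV. \<Sum>b\<in>UNIV. \<Sum>i\<in>UNIV. \<Sum>j\<in>UNIV. ?t a b i j) = (\<Sum>a\<in>UNIV. \<Sum>i\<in>UNIV. \<Sum>b\<in>UNIV. \<Sum>j\<in>UNIV. ?t a b i j)"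
    by (intro sum.cong refl sum.swap)
  finally show ?thesis by (simp add: sum_pair zw)
qed

context
  fixes \<omega> :: "('a::finite \<times> 'c::finite) cmat" and \<rho> :: "('a \<times> 'e::finite) cmat" and W r
  assumes R: "tensor \<omega> \<rho> = W ** rdiag r ** adj W"
begin

lemma tensor_columns:
  "\<omega> $ (fst p, fst z) $ (fst q, fst w) * \<rho> $ (snd p, snd z) $ (snd q, snd w) =
    (\<Sum>i\<in>UNIV. complex_of_real (r i) * (slot (column i W) p $ z * cnj (slot (column i W) q $ w)))"
proof -
  have "\<omega> $ (fst p, fst z) $ (fst q, fst w) * \<rho> $ (snd p, snd z) $ (snd q, snd w) =
     tensor \<omega> \<rho> $ ((fst p, fst z), (snd p, snd z)) $ ((fst q, fst w), (snd q, snd w))"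
    by (simp add: tensor_def)
  then show ?thesis unfolding R spectral_entries by (simp add: slot_def column_def)
qed

text \<open>Spectral decomposition before conjugation: the output is the mixture, with weights
  \<open>r i\<close>, of the projectors onto the unnormalised vectors
  \<open>couple U (column i W)\<close>.\<close>

lemma couple_mixture:
  "of_nat CARD('a) * (\<Sum>p\<in>UNIV. \<Sum>q\<in>UNIV. U $ fst p $ snd p * cnj (U $ fst q $ snd q) *
      (\<omega> $ (fst p, fst z) $ (fst q, fst w) * \<rho> $ (snd p, snd z) $ (snd q, snd w)))
   = (\<Sum>i\<in>UNIV. complex_of_real (r i) * (couple U (column i W) $ z * cnj (couple U (column i W) $ w)))"
proof -
  let ?s = "complex_of_real (sqrt (real CARD('a)))"
  let ?t = "\<lambda>i p q. complex_of_real (r i) * ((U $ fst p $ snd p * slot (column i W) p $ z) * cnj (U $ fst q $ snd q * slot (column i W) q $ w))"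
  have s: "of_nat CARD('a) = ?s * cnj ?s" by (simp flip: of_real_mult)
  have "(\<Sum>p\<in>UNIV. \<Sum>q\<in>UNIV. U $ fst p $ snd p * cnj (U $ fst q $ snd q) *
      (\<omega> $ (fst p, fst z) $ (fst q, fst w) * \<rho> $ (snd p, snd z) $ (snd q, snd w))) = (\<Sum>p\<in>UNIV. \<Sum>q\<in>UNIV. \<Sum>i\<in>UNIV. ?t i p q)"
    unfolding tensor_columns by (simp add: sum_distrib_left mult_ac)
  also have "\<dots> = (\<Sum>p\<in>UNIV. \<Sum>i\<in>UNIV. \<Sum>q\<in>UNIV. ?t i p q)"
    by (intro sum.cong refl sum.swap)
  also have "\<dots> = (\<Sum>i\<in>UNIV. \<Sum>p\<in>UNIV. \<Sum>q\<in>UNIV. ?t i p q)"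
    by (rule sum.swap)
  also have "\<dots> = (\<Sum>i\<in>UNIV. complex_of_real (r i) * ((\<Sum>p\<in>UNIV. U $ fst p $ snd p * slot (column i W) p $ z) * cnj (\<Sum>q\<in>UNIV. U $ fst q $ snd q * slot (column i W) q $ w)))"
    unfolding cnj_sum sum_product by (simp add: sum_distrib_left)
  finally show ?thesis
    unfolding s by (simp add: couple_def sum_component sum_distrib_left mult_ac)
qed

text \<open>Tracing out both copies of A turns each eigenvector into its slots. Read from right to
  left, this sums the variance bounds to a form of the product of marginals.\<close>

lemma marginal_form:
  "cinner v (tensor (ptr1 \<omega>) (ptr1 \<rho>) *v v) =
    complex_of_real (\<Sum>i\<in>UNIV. r i * (\<Sum>q\<in>UNIV. (cmod (cinner v (slot (column i W) q)))\<^sup>2))"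
proof -
  have Y: "tensor (ptr1 \<omega>) (ptr1 \<rho>) $ z $ w = (\<Sum>q\<in>UNIV. \<Sum>i\<in>UNIV. complex_of_real (r i) * (slot (column i W) q $ z * cnj (slot (column i W) q $ w)))" for z w
    unfolding tensor_columns[symmetric] by (simp add: tensor_def ptr1_def sum_pair sum_product)
  let ?t = "\<lambda>z w q i. complex_of_real (r i) * ((cnj (v $ z) * slot (column i W) q $ z) * cnj (cnj (v $ w) * slot (column i W) q $ w))"
  have "cinner v (tensor (ptr1 \<omega>) (ptr1 \<rho>) *v v) = (\<Sum>z\<in>UNIV. \<Sum>w\<in>UNIV. \<Sum>q\<in>UNIV. \<Sum>i\<in>UNIV. ?t z w q i)"
    by (simp add: cinner_def matrix_vector_mult_def Y sum_distrib_left sum_distrib_right mult_ac)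
  also have "\<dots> = (\<Sum>z\<in>UNIV. \<Sum>q\<in>UNIV. \<Sum>w\<in>UNIV. \<Sum>i\<in>UNIV. ?t z w q i)"
    by (intro sum.cong refl sum.swap)
  also have "\<dots> = (\<Sum>z\<in>UNIV. \<Sum>q\<in>UNIV. \<Sum>i\<in>UNIV. \<Sum>w\<in>UNIV. ?t z w q i)"
    by (intro sum.cong refl sum.swap)
  also have "\<dots> = (\<Sum>q\<in>UNIV. \<Sum>z\<in>UNIV. \<Sum>i\<in>UNIV. \<Sum>w\<in>UNIV. ?t z w q i)"
    by (rule sum.swap)
  also have "\<dots> = (\<Sum>q\<in>UNIV. \<Sum>i\<in>UNIV. \<Sum>z\<in>UNIV. \<Sum>w\<in>UNIV. ?t z w q i)"
    by (intro sum.cong refl sum.swap)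
  also have "\<dots> = (\<Sum>i\<in>UNIV. \<Sum>q\<in>UNIV. \<Sum>z\<in>UNIV. \<Sum>w\<in>UNIV. ?t z w q i)"
    by (rule sum.swap)
  also have "\<dots> = (\<Sum>i\<in>UNIV. complex_of_real (r i) * (\<Sum>q\<in>UNIV. complex_of_real ((cmod (cinner v (slot (column i W) q)))\<^sup>2)))"
    unfolding complex_norm_square cinner_def cnj_sum sum_product by (simp add: sum_distrib_left)
  finally show ?thesis by simp
qed

end

text \<open>The operator on the left is the identity on both copies of A tensored with that on CE,
  but with factors in the order A'C, AE; taking slots performs the reordering.\<close>

lemma slot_marginal:
  "slot (tensor (tensor (mat 1) A) (tensor (mat 1) B) *v x) p = tensor A B *v slot x p"
proof -
  have "slot (tensor (tensor (mat 1) A) (tensor (mat 1) B) *v x) p $ z = (tensor A B *v slot x p) $ z" for z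
  proof -
    obtain a b c e where pz: "p = (a, b)" "z = (c, e)" by (metis surj_pair)
    let ?g = "\<lambda>c' e'. A $ c $ c' * B $ e $ e' * x $ ((a, c'), (b, e'))"
    have ent: "tensor (tensor (mat 1) A) (tensor (mat 1) B) $ ((a, c), (b, e)) $ ((a', c'), (b', e')) * y =
      (if a = a' then if b = b' then A $ c $ c' * B $ e $ e' * y else 0 else 0)" for a' c' b' e' y
      by (simp add: tensor_def mat_def)
    have "slot (tensor (tensor (mat 1) A) (tensor (mat 1) B) *v x) p $ z =
      (\<Sum>a'\<in>UNIV. \<Sum>c'\<in>UNIV. \<Sum>b'\<in>UNIV. \<Sum>e'\<in>UNIV. if a = a' then if b = b' then A $ c $ c' * B $ e $ e' * x $ ((a', c'), (b', e')) else 0 else 0)"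
      unfolding ent[symmetric] by (simp only: slot_def pz vec_lambda_beta fst_conv snd_conv matrix_vector_mult_def sum_pair)
    also have "\<dots> = (\<Sum>c'\<in>UNIV. \<Sum>e'\<in>UNIV. ?g c' e')"
      by (simp add: sum_if_const)
    finally show ?thesis
      by (simp add: slot_def matrix_vector_mult_def tensor_def sum_pair pz)
  qed
  then show ?thesis by (simp add: vec_eq_iff)
qed

section \<open>The strong converse bound\<close>

lemma cinner_column: "(adj W *v v) $ k = cinner (column k W) v"
  by (simp add: cinner_def column_def adj_def matrix_vector_mult_def)

lemma cmod_cinner_commute: "cmod (cinner v w) = cmod (cinner w v)"
  by (metis cinner_commute complex_mod_cnj)

lemma norm_residual_orthonormal:
  fixes t :: "'k \<Rightarrow> complex^'n::finite"
  assumes S: "finite S" and t: "\<And>k l. cinner (t k) (t l) = (if k = l then 1 else 0)"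
  shows "(norm (x - (\<Sum>k\<in>S. cinner (t k) x *s t k)))\<^sup>2 = (norm x)\<^sup>2 - (\<Sum>k\<in>S. (cmod (cinner (t k) x))\<^sup>2)"
proof -
  let ?s = "\<Sum>k\<in>S. cinner (t k) x *s t k"
  have xs: "cinner x ?s = complex_of_real (\<Sum>k\<in>S. (cmod (cinner (t k) x))\<^sup>2)"
    unfolding cinner_sum_right cinner_scale_right of_real_sum complex_norm_square cinner_commute[of x] ..
  have ts: "cinner (t k) ?s = cinner (t k) x" if "k \<in> S" for k
    using S that by (simp add: cinner_sum_right cinner_scale_right t mult_if_distribs cong: if_cong)
  have ss: "cinner ?s ?s = complex_of_real (\<Sum>k\<in>S. (cmod (cinner (t k) x))\<^sup>2)"
  proof -
    have "cinner ?s ?s = (\<Sum>k\<in>S. cnj (cinner (t k) x) * cinner (t k) ?s)"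
      by (subst cinner_sum_left) (simp only: cinner_scale_left)
    also have "\<dots> = (\<Sum>k\<in>S. cinner (t k) x * cnj (cinner (t k) x))"
      by (intro sum.cong refl) (simp only: ts mult.commute)
    finally show ?thesis by (simp only: of_real_sum complex_norm_square)
  qed
  have sx: "cinner ?s x = complex_of_real (\<Sum>k\<in>S. (cmod (cinner (t k) x))\<^sup>2)"
    using xs cinner_commute[of ?s x] by (simp only: complex_cnj_complex_of_real)
  have "complex_of_real ((norm (x - ?s))\<^sup>2) = complex_of_real ((norm x)\<^sup>2 - (\<Sum>k\<in>S. (cmod (cinner (t k) x))\<^sup>2))"
    unfolding cinner_self[symmetric] cinner_diff_left cinner_diff_right xs ss sx of_real_diff by simp
  then show ?thesis by (simp only: of_real_eq_iff)
qed

lemma couple_norm_moment: "(\<integral>U. (norm (couple U x))\<^sup>2 \<partial>haar) = (norm x)\<^sup>2"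
  for x :: "complex^(('a::finite \<times> 'c::finite) \<times> ('a \<times> 'e::finite))"
proof -
  have "complex_of_real (\<integral>U. (norm (couple U x))\<^sup>2 \<partial>haar) = (\<integral>U. cinner (couple U x) (couple U x) \<partial>haar)"
    unfolding cinner_self by (rule integral_complex_of_real[symmetric])
  also have "\<dots> = complex_of_real ((norm x)\<^sup>2)"
    unfolding couple_inner_moment by (rule cinner_self)
  finally show ?thesis by (simp only: of_real_eq_iff)
qed

lemma qtr_map_left:
  assumes "trace_preserving T"
  shows "qtr (map_left T X) = qtr X"
proof -
  have "qtr (map_left T X) = (\<Sum>c\<in>UNIV. \<Sum>e\<in>UNIV. T (\<chi> a a'. X $ (a, e) $ (a', e)) $ c $ c)"
    by (simp add: qtr_def map_left_def sum_pair)
  also have "\<dots> = (\<Sum>e\<in>UNIV. qtr (T (\<chi> a a'. X $ (a, e) $ (a', e))))"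
    unfolding qtr_def by (rule sum.swap)
  also have "\<dots> = (\<Sum>e\<in>UNIV. \<Sum>a\<in>UNIV. X $ (a, e) $ (a, e))"
    using assms by (simp add: trace_preserving_def) (simp add: qtr_def)
  also have "\<dots> = qtr X"
    unfolding qtr_def sum_pair by (rule sum.swap)
  finally show ?thesis .
qed

theorem decoupling_test_bound:
  fixes \<rho> :: "('a::finite \<times> 'e::finite) cmat"
    and T :: "'a cmat \<Rightarrow> 'c::finite cmat"
  assumes \<rho>: "density \<rho>" and T: "channel T"
  defines "R \<equiv> tensor (choi T) \<rho>"
    and "y \<equiv> tensor (tensor (mat 1) (ptr1 (choi T))) (tensor (mat 1) (ptr1 \<rho>))"
  assumes V: "unitary V" "R - (4 / 3) *\<^sub>R y = V ** rdiag e ** adj V"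
  shows "1 - 1 / 2 * (\<integral>U. trace_norm (map_left T (tensor U (mat 1) ** \<rho> ** adj (tensor U (mat 1)))
            - tensor (T maximally_mixed) (ptr1 \<rho>)) \<partial>haar)
      \<le> 2 * (Re (qtr R) - (\<Sum>k\<in>UNIV. max 0 (e k)))"
proof -
  interpret prob_space "haar :: 'a cmat measure" by (rule haar_prob_space)
  have lin: "clinear_map T" and tp: "trace_preserving T" using T by (auto simp: channel_def)
  have psd\<rho>: "psd \<rho>" and tr\<rho>: "qtr \<rho> = 1" using \<rho> by (auto simp: density_def)
  note psd\<omega> = psd_choi[OF T] and tr\<omega> = qtr_choi[OF T]
  have psdR: "psd R" unfolding R_def by (intro psd_tensor psd\<omega> psd\<rho>)
  obtain W r where W: "unitary W" "R = W ** rdiag r ** adj W" and r: "\<And>k. r k \<ge> 0"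
    using psd_spectral[OF psdR] by blast
  note R = W(2)[unfolded R_def]
  define Y where "Y = tensor (ptr1 (choi T)) (ptr1 \<rho>)"
  have psdY: "psd Y" unfolding Y_def by (intro psd_tensor psd_ptr1 psd\<omega> psd\<rho>)
  have trY: "qtr Y = 1" unfolding Y_def qtr_tensor qtr_ptr1 tr\<omega> tr\<rho> by simp
  have Y: "tensor (T maximally_mixed) (ptr1 \<rho>) = Y" unfolding Y_def ptr1_choi[OF lin] ..
  define X where "X U = map_left T (tensor U (mat 1) ** \<rho> ** adj (tensor U (mat 1)))" for U :: "'a cmat"
  define u where "u i = column i W" for i
  define t where "t k = column k V" for k
  \<comment> \<open>The vectors \<open>t k\<close> with \<open>k\<close> in \<open>S\<close> span
    the range of the optimal projection for \<open>R\<close> against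
    \<open>(4 / 3) y\<close>.\<close>
  define S where "S = {k. e k > 0}"
  \<comment> \<open>The mean of the Gram entry of \<open>couple U (t k)\<close> and
    \<open>couple U (u i)\<close>: it makes \<open>A\<close> a squared deviation from the mean and
    \<open>B\<close> the squared norm of the coupled part of \<open>u i\<close> outside the
    projection.\<close>
  define x where "x i k = cinner (t k) (u i)" for i k
  have X: "X U $ z $ w = (\<Sum>i\<in>UNIV. complex_of_real (r i) * (couple U (u i) $ z * cnj (couple U (u i) $ w)))" for U z w
    unfolding X_def map_left_entries[OF lin] couple_mixture[OF R] u_def ..
  have trX: "qtr (X U) = 1" if "unitary U" for U
    unfolding X_def qtr_map_left[OF tp] using that
    by (subst qtr_unitary_conj) (auto intro!: unitary_tensor simp: tr\<rho> unitary_def[of "mat 1"])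
  have t: "cinner (t k) (t l) = (if k = l then 1 else 0)" for k l
    unfolding t_def by (rule unitary_column[OF V(1)])
  define A where "A U i k = (cmod (cinner (couple U (t k)) (couple U (u i)) - x i k))\<^sup>2" for U i k
  define B where "B U i = (norm (couple U (u i) - (\<Sum>k\<in>S. x i k *s couple U (t k))))\<^sup>2" for U i
  define C where "C U k = Re (cinner (couple U (t k)) (Y *v couple U (t k)))" for U k
  let ?G = "\<lambda>U. (\<Sum>i\<in>UNIV. r i * (3 / 4 * (\<Sum>k\<in>S. A U i k) + 2 * B U i)) + 5 / 3 * (\<Sum>k\<in>S. C U k)"
  have pw: "1 - 1 / 2 * trace_norm (X U - Y) \<le> ?G U"
    if "unitary U" for U
    unfolding A_def B_def C_def
    by (rule trace_distance_frame_bound[OF _ X r psdY trX[OF that] trY]) simp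
  have int: "integrable haar (\<lambda>U. A U i k)" "integrable haar (\<lambda>U. B U i)" "integrable haar (\<lambda>U. C U k)" for i k
    unfolding A_def B_def C_def cinner_def matrix_vector_mult_def vector_scalar_mult_def
    by (intro haar_integrable continuous_intros)+
  have intT: "integrable haar (\<lambda>U. trace_norm (X U - Y))"
  proof (intro haar_integrable continuous_on_trace_norm)
    have "X = (\<lambda>U. \<chi> z w. \<Sum>i\<in>UNIV. complex_of_real (r i) * (couple U (u i) $ z * cnj (couple U (u i) $ w)))"
      by (simp add: fun_eq_iff vec_eq_iff X)
    then have "continuous_on UNIV X" by (simp only:) (intro continuous_intros)
    then show "continuous_on UNIV (\<lambda>U. X U - Y)" by (intro continuous_intros)
    show "adj (X U - Y) = X U - Y" for U
    proof -
      have "adj (X U) = X U" by (simp add: vec_eq_iff adj_def X mult_ac)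
      then show ?thesis by (simp add: adj_diff psd_adj[OF psdY])
    qed
  qed
  have y_form: "Re (cinner (t k) (y *v t k)) = (\<Sum>p\<in>UNIV. Re (cinner (slot (t k) p) (Y *v slot (t k) p)))" for k
    unfolding y_def Y_def cinner_slot[of "t k"] slot_marginal by simp
  have EA: "(\<integral>U. A U i k \<partial>haar) \<le> 4 / 3 * (\<Sum>p\<in>UNIV. \<Sum>q\<in>UNIV. (cmod (cinner (slot (t k) p) (slot (u i) q)))\<^sup>2)" for i k
    unfolding A_def x_def by (rule couple_variance)
  have EB: "(\<integral>U. B U i \<partial>haar) = 1 - (\<Sum>k\<in>S. (cmod (x i k))\<^sup>2)" for i
  proof -
    have "couple U (u i) - (\<Sum>k\<in>S. x i k *s couple U (t k)) = couple U (u i - (\<Sum>k\<in>S. x i k *s t k))" for U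
      by (simp only: couple_diff couple_sum couple_scale)
    then have "(\<integral>U. B U i \<partial>haar) = (norm (u i - (\<Sum>k\<in>S. x i k *s t k)))\<^sup>2"
      unfolding B_def by (simp only: couple_norm_moment)
    also have "\<dots> = (norm (u i))\<^sup>2 - (\<Sum>k\<in>S. (cmod (x i k))\<^sup>2)"
      unfolding x_def by (rule norm_residual_orthonormal[OF finite t])
    finally show ?thesis by (simp add: u_def unitary_column_norm[OF W(1)])
  qed
  have EC: "(\<integral>U. C U k \<partial>haar) = Re (cinner (t k) (y *v t k))" for k
  proof -
    have "integrable haar (\<lambda>U. cinner (couple U (t k)) (Y *v couple U (t k)))"
      unfolding cinner_def matrix_vector_mult_def by (intro haar_integrable continuous_intros)
    then have "(\<integral>U. C U k \<partial>haar) = Re (\<integral>U. cinner (couple U (t k)) (Y *v couple U (t k)) \<partial>haar)"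
      unfolding C_def by (rule integral_Re)
    then show ?thesis unfolding couple_first_moment y_form by simp
  qed
  have Rk: "(\<Sum>i\<in>UNIV. r i * (cmod (x i k))\<^sup>2) = Re (cinner (t k) (R *v t k))" for k
    unfolding W(2) spectral_form cinner_column x_def u_def by (simp add: cmod_cinner_commute[of "t k"])
  have ek: "Re (cinner (t k) (R *v t k)) - 4 / 3 * Re (cinner (t k) (y *v t k)) = e k" for k
  proof -
    have "cinner (t k) ((R - (4 / 3) *\<^sub>R y) *v t k) = complex_of_real (e k)"
    proof -
      have "adj V ** (V ** rdiag e ** adj V) ** V = (adj V ** V) ** rdiag e ** (adj V ** V)"
        by (simp only: matrix_mul_assoc)
      then show ?thesis
        using V(1) unfolding t_def V(2) column_conj unitary_def by (simp add: rdiag_def)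
    qed
    moreover have "((4 / 3) *\<^sub>R y) *v t k = complex_of_real (4 / 3) *s (y *v t k)"
      by (simp add: vec_eq_iff matrix_vector_mult_def scaleR_conv_of_real[where 'a=complex] sum_distrib_left mult.assoc)
    ultimately have "cinner (t k) (R *v t k) - complex_of_real (4 / 3) * cinner (t k) (y *v t k) = complex_of_real (e k)"
      by (simp only: matrix_vector_mult_diff_rdistrib cinner_diff_right cinner_scale_right)
    then have "Re (cinner (t k) (R *v t k) - complex_of_real (4 / 3) * cinner (t k) (y *v t k)) = e k"
      by (simp only: Re_complex_of_real)
    then show ?thesis by simp
  qed
  \<comment> \<open>Weighted by \<open>r\<close>, the squares from the variance bound again add up
    to the form of \<open>y\<close>, the same quantity as the mean of \<open>C\<close>.\<close>
  have Yk: "(\<Sum>i\<in>UNIV. r i * (\<Sum>p\<in>UNIV. \<Sum>q\<in>UNIV. (cmod (cinner (slot (t k) p) (slot (u i) q)))\<^sup>2)) = Re (cinner (t k) (y *v t k))" for k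
    unfolding y_form Y_def marginal_form[OF R] Re_complex_of_real u_def
    by (subst sum.swap) (simp only: sum_distrib_left)
  have "1 - 1 / 2 * (\<integral>U. trace_norm (X U - Y) \<partial>haar) = (\<integral>U. 1 - 1 / 2 * trace_norm (X U - Y) \<partial>haar)"
    using intT by (simp add: prob_space)
  also have "\<dots> \<le> (\<integral>U. ?G U \<partial>haar)"
  proof (rule integral_mono_AE)
    show "AE U in haar. 1 - 1 / 2 * trace_norm (X U - Y) \<le> ?G U"
      using AE_haar_unitary by eventually_elim (rule pw)
  qed (use int intT in \<open>auto intro!: Bochner_Integration.integrable_add Bochner_Integration.integrable_diff integrable_mult_right Bochner_Integration.integrable_sum\<close>)
  also have "\<dots> = (\<Sum>i\<in>UNIV. r i * (3 / 4 * (\<Sum>k\<in>S. \<integral>U. A U i k \<partial>haar) + 2 * (\<integral>U. B U i \<partial>haar))) + 5 / 3 * (\<Sum>k\<in>S. \<integral>U. C U k \<partial>haar)"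
    by (simp only: Bochner_Integration.integral_add Bochner_Integration.integral_sum integral_mult_right_zero
        Bochner_Integration.integrable_add Bochner_Integration.integrable_sum integrable_mult_right int)
  also have "\<dots> \<le> (\<Sum>i\<in>UNIV. r i * (3 / 4 * (\<Sum>k\<in>S. 4 / 3 * (\<Sum>p\<in>UNIV. \<Sum>q\<in>UNIV. (cmod (cinner (slot (t k) p) (slot (u i) q)))\<^sup>2))
      + 2 * (1 - (\<Sum>k\<in>S. (cmod (x i k))\<^sup>2)))) + 5 / 3 * (\<Sum>k\<in>S. Re (cinner (t k) (y *v t k)))"
    unfolding EB EC using r EA by (intro add_mono mult_left_mono sum_mono order_refl) auto
  also have "\<dots> = 2 * (\<Sum>i\<in>UNIV. r i) + (\<Sum>k\<in>S. \<Sum>i\<in>UNIV. r i * (\<Sum>p\<in>UNIV. \<Sum>q\<in>UNIV. (cmod (cinner (slot (t k) p) (slot (u i) q)))\<^sup>2))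
      - 2 * (\<Sum>k\<in>S. \<Sum>i\<in>UNIV. r i * (cmod (x i k))\<^sup>2) + 5 / 3 * (\<Sum>k\<in>S. Re (cinner (t k) (y *v t k)))"
  proof -
    have "(\<Sum>i\<in>UNIV. r i * (3 / 4 * (\<Sum>k\<in>S. 4 / 3 * a i k) + 2 * (1 - (\<Sum>k\<in>S. b i k)))) =
      2 * (\<Sum>i\<in>UNIV. r i) + (\<Sum>k\<in>S. \<Sum>i\<in>UNIV. r i * a i k) - 2 * (\<Sum>k\<in>S. \<Sum>i\<in>UNIV. r i * b i k)" for a b
    proof -
      have "(\<Sum>i\<in>UNIV. r i * (3 / 4 * (\<Sum>k\<in>S. 4 / 3 * a i k) + 2 * (1 - (\<Sum>k\<in>S. b i k)))) =
        (\<Sum>i\<in>UNIV. 2 * r i + (\<Sum>k\<in>S. r i * a i k) - 2 * (\<Sum>k\<in>S. r i * b i k))"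
      proof (intro sum.cong refl)
        fix i
        have "3 / 4 * (\<Sum>k\<in>S. 4 / 3 * a i k) = (\<Sum>k\<in>S. a i k)" by (simp add: sum_distrib_left)
        then show "r i * (3 / 4 * (\<Sum>k\<in>S. 4 / 3 * a i k) + 2 * (1 - (\<Sum>k\<in>S. b i k))) = 2 * r i + (\<Sum>k\<in>S. r i * a i k) - 2 * (\<Sum>k\<in>S. r i * b i k)"
          unfolding sum_distrib_left[symmetric] by (simp only:) (simp add: algebra_simps)
      qed
      also have "\<dots> = 2 * (\<Sum>i\<in>UNIV. r i) + (\<Sum>i\<in>UNIV. \<Sum>k\<in>S. r i * a i k) - 2 * (\<Sum>i\<in>UNIV. \<Sum>k\<in>S. r i * b i k)"
        by (simp only: sum.distrib sum_subtractf sum_distrib_left)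
      finally show ?thesis by (simp only: sum.swap[of _ _ UNIV])
    qed
    then show ?thesis by simp
  qed
  \<comment> \<open>The forms of \<open>y\<close> occur with total factor
    \<open>1 + 5 / 3 = 2 * (4 / 3)\<close> and those of \<open>R\<close> with factor -2, so together
    they are twice the eigenvalue \<open>e k\<close>, with a minus sign.\<close>
  also have "\<dots> = 2 * ((\<Sum>i\<in>UNIV. r i) - (\<Sum>k\<in>S. e k))"
  proof -
    have "(\<Sum>k\<in>S. a k - 4 / 3 * b k) = (\<Sum>k\<in>S. a k) - 4 / 3 * (\<Sum>k\<in>S. b k)" for a b :: "_ \<Rightarrow> real"
      by (simp only: sum_subtractf sum_distrib_left)
    then show ?thesis unfolding Yk Rk ek[symmetric] by (simp only:) (simp add: algebra_simps)
  qed
  also have "(\<Sum>k\<in>S. e k) = (\<Sum>k\<in>UNIV. max 0 (e k))"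
    unfolding S_def by (rule sum.mono_neutral_cong_left) auto
  also have "(\<Sum>i\<in>UNIV. r i) = Re (qtr R)"
    unfolding W(2) qtr_spectral[OF W(1)] by simp
  finally show ?thesis unfolding X_def Y .
qed

section \<open>From the test error to the entropic exponent\<close>

lemma psd_scaleR: "psd A \<Longrightarrow> c \<ge> 0 \<Longrightarrow> psd (c *\<^sub>R A)"
proof -
  assume A: "psd A" and c: "c \<ge> 0"
  obtain U d where U: "unitary U" "A = U ** rdiag d ** adj U" "\<And>k. d k \<ge> 0" using psd_spectral A by blast
  show ?thesis unfolding U(2) scaleR_spectral using U c by (simp add: psd_spectral_iff)
qed

lemma mfun_powr_scaleR:
  assumes A: "psd A" and c: "c \<ge> 0"
  shows "mfun (\<lambda>x. x powr s) (c *\<^sub>R A) = (c powr s) *\<^sub>R mfun (\<lambda>x. x powr s) A"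
proof -
  obtain U d where U: "unitary U" "A = U ** rdiag d ** adj U" "\<And>k. d k \<ge> 0" using psd_spectral A by blast
  have e: "c *\<^sub>R A = U ** rdiag (\<lambda>i. c * d i) ** adj U" unfolding U(2) scaleR_spectral ..
  have "(\<lambda>x. x powr s) \<circ> (\<lambda>i. c * d i) = (\<lambda>i. c powr s * ((\<lambda>x. x powr s) \<circ> d) i)"
    using c U(3) by (auto simp: powr_mult)
  then show ?thesis
    unfolding mfun_spectral[OF U(1) e] mfun_spectral[OF U(1,2)] scaleR_spectral by (simp only:)
qed

lemma qtr_mult_scaleR: "qtr (A ** (c *\<^sub>R B)) = complex_of_real c * qtr (A ** B)"
  by (simp add: qtr_def matrix_matrix_mult_def scaleR_conv_of_real[where 'a=complex] sum_distrib_left mult_ac)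

lemma psd_qtr_mult_real: "psd A \<Longrightarrow> psd B \<Longrightarrow> Im (qtr (A ** B)) = 0"
proof -
  assume A: "psd A" and B: "psd B"
  obtain U d where U: "unitary U" "A = U ** rdiag d ** adj U" using psd_spectral A by blast
  show ?thesis using B unfolding U(2) qtr_spectral_mult psd_def by simp
qed

definition petz_trace :: "real \<Rightarrow> ('a::finite \<times> 'b::finite) cmat \<Rightarrow> real" where
  "petz_trace \<alpha> \<rho> = Re (qtr (mfun (\<lambda>x. x powr \<alpha>) \<rho> ** mfun (\<lambda>x. x powr (1 - \<alpha>)) (tensor (mat 1) (ptr1 \<rho>))))"

lemma petz_cond_entropy_trace: "\<alpha> < 1 \<Longrightarrow> (1 - \<alpha>) * petz_cond_entropy \<alpha> \<rho> = ln (petz_trace \<alpha> \<rho>)"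
  by (simp add: petz_cond_entropy_def petz_trace_def)

theorem decoupling_converse:
  fixes \<rho> :: "('a::finite \<times> 'e::finite) cmat"
    and T :: "'a cmat \<Rightarrow> 'c::finite cmat"
  assumes \<rho>: "density \<rho>" and T: "channel T" and \<alpha>: "0 < \<alpha>" "\<alpha> < 1"
  shows "1 / 2 * (\<integral>U. trace_norm (map_left T (tensor U (mat 1) ** \<rho> ** adj (tensor U (mat 1)))
            - tensor (T maximally_mixed) (ptr1 \<rho>)) \<partial>haar)
      \<ge> 1 - 2 * exp ((1 - \<alpha>) * (petz_cond_entropy \<alpha> (choi T) + petz_cond_entropy \<alpha> \<rho> + ln (4 / 3)))"
proof -
  let ?\<omega> = "choi T"
  let ?s = "\<lambda>s x. x powr s :: real"
  let ?A = "tensor (mat 1 :: 'a cmat) (ptr1 ?\<omega>)" and ?B = "tensor (mat 1 :: 'a cmat) (ptr1 \<rho>)"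
  have psd\<rho>: "psd \<rho>" using \<rho> by (simp add: density_def)
  note psd\<omega> = psd_choi[OF T]
  have psdA: "psd ?A" and psdB: "psd ?B" by (intro psd_tensor psd_mat1 psd_ptr1 psd\<rho> psd\<omega>)+
  define R where "R = tensor ?\<omega> \<rho>"
  define y where "y = tensor ?A ?B"
  have psdR: "psd R" and psdy: "psd y" unfolding R_def y_def by (intro psd_tensor psd\<omega> psd\<rho> psdA psdB)+
  have psdcy: "psd ((4 / 3) *\<^sub>R y)" using psdy by (rule psd_scaleR) simp
  have "adj (R - (4 / 3) *\<^sub>R y) = R - (4 / 3) *\<^sub>R y"
    by (simp only: adj_diff psd_adj[OF psdR] psd_adj[OF psdcy])
  then obtain V e where V: "unitary V" "R - (4 / 3) *\<^sub>R y = V ** rdiag e ** adj V"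
    using spectral_theorem by blast
  have powr_mult': "(x * z) powr s = x powr s * z powr s" if "x \<ge> 0" "z \<ge> 0" for x z s :: real
    using that by (simp add: powr_mult)
  have Q: "petz_trace \<alpha> \<sigma> \<ge> 0" "qtr (mfun (?s \<alpha>) \<sigma> ** mfun (?s (1 - \<alpha>)) (tensor (mat 1) (ptr1 \<sigma>))) = complex_of_real (petz_trace \<alpha> \<sigma>)"
    if "psd \<sigma>" for \<sigma> :: "('a \<times> 'k::finite) cmat"
  proof -
    have 1: "psd (mfun (?s \<alpha>) \<sigma>)" using that by (rule psd_mfun) simp
    have 2: "psd (mfun (?s (1 - \<alpha>)) (tensor (mat 1) (ptr1 \<sigma>)))"
      using psd_tensor[OF psd_mat1 psd_ptr1[OF that]] by (rule psd_mfun) simp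
    show "petz_trace \<alpha> \<sigma> \<ge> 0" unfolding petz_trace_def by (rule psd_qtr_mult_nonneg[OF 1 2])
    show "qtr (mfun (?s \<alpha>) \<sigma> ** mfun (?s (1 - \<alpha>)) (tensor (mat 1) (ptr1 \<sigma>))) = complex_of_real (petz_trace \<alpha> \<sigma>)"
      unfolding petz_trace_def using psd_qtr_mult_real[OF 1 2] by (simp add: complex_eq_iff)
  qed
  have "mfun (?s \<alpha>) R = tensor (mfun (?s \<alpha>) ?\<omega>) (mfun (?s \<alpha>) \<rho>)"
    unfolding R_def by (rule mfun_tensor[OF psd\<omega> psd\<rho> powr_mult'])
  \<comment> \<open>The scalar leaves as \<open>(4 / 3) powr (1 - \<alpha>)\<close>, the source of
    \<open>ln (4 / 3)\<close> in the exponent.\<close>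
  moreover have "mfun (?s (1 - \<alpha>)) ((4 / 3) *\<^sub>R y) = ((4 / 3) powr (1 - \<alpha>)) *\<^sub>R tensor (mfun (?s (1 - \<alpha>)) ?A) (mfun (?s (1 - \<alpha>)) ?B)"
  proof -
    have "mfun (?s (1 - \<alpha>)) y = tensor (mfun (?s (1 - \<alpha>)) ?A) (mfun (?s (1 - \<alpha>)) ?B)"
      unfolding y_def by (rule mfun_tensor[OF psdA psdB powr_mult'])
    then show ?thesis by (simp add: mfun_powr_scaleR[OF psdy])
  qed
  ultimately have tr: "Re (qtr (mfun (?s \<alpha>) R ** mfun (?s (1 - \<alpha>)) ((4 / 3) *\<^sub>R y))) =
     (4 / 3) powr (1 - \<alpha>) * (petz_trace \<alpha> ?\<omega> * petz_trace \<alpha> \<rho>)"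
    by (simp only: qtr_mult_scaleR tensor_mult qtr_tensor Q(2)[OF psd\<omega>] Q(2)[OF psd\<rho>] of_real_mult[symmetric] Re_complex_of_real)
  have "1 - 1 / 2 * (\<integral>U. trace_norm (map_left T (tensor U (mat 1) ** \<rho> ** adj (tensor U (mat 1)))
            - tensor (T maximally_mixed) (ptr1 \<rho>)) \<partial>haar) \<le> 2 * (Re (qtr R) - (\<Sum>k\<in>UNIV. max 0 (e k)))"
    unfolding R_def by (rule decoupling_test_bound[OF \<rho> T V[unfolded R_def y_def]])
  also have "\<dots> \<le> 2 * ((4 / 3) powr (1 - \<alpha>) * (petz_trace \<alpha> ?\<omega> * petz_trace \<alpha> \<rho>))"
    using Audenaert_inequality[OF psdR psdcy \<alpha> V] unfolding tr by (intro mult_left_mono) auto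
  also have "\<dots> \<le> 2 * ((4 / 3) powr (1 - \<alpha>) * (exp (ln (petz_trace \<alpha> ?\<omega>)) * exp (ln (petz_trace \<alpha> \<rho>))))"
  proof -
    \<comment> \<open>At \<open>x = 0\<close> this is \<open>0 <= 1\<close>, by the convention
      \<open>ln 0 = 0\<close>.\<close>
    have "x \<le> exp (ln x)" if "x \<ge> 0" for x :: real
      using that by (cases "x = 0") auto
    then show ?thesis
      using Q(1)[OF psd\<omega>] Q(1)[OF psd\<rho>] by (intro mult_left_mono mult_mono) auto
  qed
  also have "\<dots> = 2 * exp ((1 - \<alpha>) * (petz_cond_entropy \<alpha> ?\<omega> + petz_cond_entropy \<alpha> \<rho> + ln (4 / 3)))"
    using \<alpha>(2) by (simp add: ring_distribs(1) exp_add petz_cond_entropy_trace powr_def)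
  finally show ?thesis by simp
qed

section \<open>The sign of the exponent\<close>

text \<open>The kernel of \<open>1 \<otimes> \<rho>_B\<close> is orthogonal to the support of
  \<open>\<rho>\<close>. The form at \<open>v\<close> is a nonnegative sum over all pairs of
  A-blocks of \<open>v\<close> and of an eigenvector; if it vanishes, so do the terms with equal
  blocks, which make up the inner product.\<close>

lemma marginal_kernel:
  fixes \<rho> :: "('a::finite \<times> 'b::finite) cmat"
  assumes U: "\<rho> = U ** rdiag r ** adj U" and r: "\<And>k. r k \<ge> 0"
    and v: "cinner v (tensor (mat 1 :: 'a cmat) (ptr1 \<rho>) *v v) = 0" and i: "r i \<noteq> 0"
  shows "cinner (column i U) v = 0"
proof -
  define b where "b a x = (\<chi> k. x $ (a, k))" for a and x :: "complex^('a \<times> 'b)"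
  let ?t = "\<lambda>a c i. cinner (b a v) (b c (column i U))"
  have pt: "ptr1 \<rho> $ k $ l = (\<Sum>c\<in>UNIV. \<Sum>i\<in>UNIV. complex_of_real (r i) * (b c (column i U) $ k * cnj (b c (column i U) $ l)))" for k l
    unfolding U ptr1_def spectral_entries by (simp add: b_def column_def)
  have one: "cinner w (ptr1 \<rho> *v w) = complex_of_real (\<Sum>c\<in>UNIV. \<Sum>i\<in>UNIV. r i * (cmod (cinner w (b c (column i U))))\<^sup>2)" for w
  proof -
    let ?g = "\<lambda>k l c i. complex_of_real (r i) * ((cnj (w $ k) * b c (column i U) $ k) * cnj (cnj (w $ l) * b c (column i U) $ l))"
    have "cinner w (ptr1 \<rho> *v w) = (\<Sum>k\<in>UNIV. \<Sum>l\<in>UNIV. \<Sum>c\<in>UNIV. \<Sum>i\<in>UNIV. ?g k l c i)"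
      by (simp add: cinner_def matrix_vector_mult_def pt sum_distrib_left sum_distrib_right mult_ac)
    also have "\<dots> = (\<Sum>k\<in>UNIV. \<Sum>c\<in>UNIV. \<Sum>l\<in>UNIV. \<Sum>i\<in>UNIV. ?g k l c i)"
      by (intro sum.cong refl sum.swap)
    also have "\<dots> = (\<Sum>k\<in>UNIV. \<Sum>c\<in>UNIV. \<Sum>i\<in>UNIV. \<Sum>l\<in>UNIV. ?g k l c i)"
      by (intro sum.cong refl sum.swap)
    also have "\<dots> = (\<Sum>c\<in>UNIV. \<Sum>k\<in>UNIV. \<Sum>i\<in>UNIV. \<Sum>l\<in>UNIV. ?g k l c i)"
      by (rule sum.swap)
    also have "\<dots> = (\<Sum>c\<in>UNIV. \<Sum>i\<in>UNIV. \<Sum>k\<in>UNIV. \<Sum>l\<in>UNIV. ?g k l c i)"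
      by (intro sum.cong refl sum.swap)
    also have "\<dots> = (\<Sum>c\<in>UNIV. \<Sum>i\<in>UNIV. complex_of_real (r i) * complex_of_real ((cmod (cinner w (b c (column i U))))\<^sup>2))"
      unfolding complex_norm_square cinner_def cnj_sum sum_product by (simp add: sum_distrib_left)
    finally show ?thesis by simp
  qed
  have "cinner v (tensor (mat 1 :: 'a cmat) (ptr1 \<rho>) *v v) = (\<Sum>a\<in>UNIV. cinner (b a v) (ptr1 \<rho> *v b a v))"
  proof -
    have ent: "tensor (mat 1 :: 'a cmat) (ptr1 \<rho>) $ (a, k) $ (c, l) * z = (if a = c then ptr1 \<rho> $ k $ l * z else 0)" for a k c l z
      by (simp add: tensor_def mat_def)
    have "(tensor (mat 1 :: 'a cmat) (ptr1 \<rho>) *v v) $ (a, k) = (\<Sum>c\<in>UNIV. \<Sum>l\<in>UNIV. if a = c then ptr1 \<rho> $ k $ l * v $ (c, l) else 0)" for a k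
      unfolding ent[symmetric] by (simp only: matrix_vector_mult_def vec_lambda_beta sum_pair)
    then have "(tensor (mat 1 :: 'a cmat) (ptr1 \<rho>) *v v) $ (a, k) = (ptr1 \<rho> *v b a v) $ k" for a k
      by (simp add: sum_if_const matrix_vector_mult_def b_def)
    then show ?thesis by (simp add: cinner_def sum_pair b_def)
  qed
  then have "complex_of_real (\<Sum>a\<in>UNIV. \<Sum>c\<in>UNIV. \<Sum>i\<in>UNIV. r i * (cmod (?t a c i))\<^sup>2) = 0"
    unfolding v one by (simp only: of_real_sum)
  then have "(\<Sum>a\<in>UNIV. \<Sum>c\<in>UNIV. \<Sum>i\<in>UNIV. r i * (cmod (?t a c i))\<^sup>2) = 0"
    by (simp only: of_real_eq_0_iff)
  note z0 = this
  have nn: "0 \<le> r i * (cmod (?t a c i))\<^sup>2" for a c i using r by simp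
  have z1: "(\<Sum>c\<in>UNIV. \<Sum>i\<in>UNIV. r i * (cmod (?t a c i))\<^sup>2) = 0" for a
    by (rule sum_nonneg_0[OF finite _ z0]) (intro sum_nonneg nn, rule UNIV_I)
  have z2: "(\<Sum>i\<in>UNIV. r i * (cmod (?t a c i))\<^sup>2) = 0" for a c
    by (rule sum_nonneg_0[OF finite _ z1]) (intro sum_nonneg nn, rule UNIV_I)
  have "r i * (cmod (?t a c i))\<^sup>2 = 0" for a c
    by (rule sum_nonneg_0[OF finite _ z2]) (rule nn, rule UNIV_I)
  then have "?t a a i = 0" for a using i by simp
  moreover have "cinner v (column i U) = (\<Sum>a\<in>UNIV. ?t a a i)"
    by (simp add: cinner_def sum_pair b_def)
  ultimately have "cinner v (column i U) = 0" by simp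
  then show ?thesis using cinner_commute[of "column i U" v] by simp
qed

lemma qtr_spectral_product:
  "qtr ((U ** rdiag d ** adj U) ** (V ** rdiag s ** adj V)) =
    complex_of_real (\<Sum>i\<in>UNIV. \<Sum>j\<in>UNIV. d i * s j * (cmod (cinner (column j V) (column i U)))\<^sup>2)"
  unfolding qtr_spectral_mult spectral_form cinner_column by (simp add: sum_distrib_left mult.assoc)

text \<open>The Nussbaum-Szkola distribution: both entropies become moments of one real random
  variable \<open>l\<close>.\<close>

lemma cond_entropy_distribution:
  fixes \<sigma> :: "('a::finite \<times> 'b::finite) cmat"
  assumes "density \<sigma>"
  shows "\<exists>p l :: ('a \<times> 'b) \<times> ('a \<times> 'b) \<Rightarrow> real. (\<forall>x. p x \<ge> 0) \<and> (\<Sum>x\<in>UNIV. p x) = 1 \<and>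
    (\<forall>\<alpha>. petz_trace \<alpha> \<sigma> = (\<Sum>x\<in>UNIV. p x * exp ((1 - \<alpha>) * l x))) \<and>
    cond_entropy \<sigma> = (\<Sum>x\<in>UNIV. p x * l x)"
proof -
  have psd: "psd \<sigma>" and tr: "qtr \<sigma> = 1" using assms by (auto simp: density_def)
  obtain U r where U: "unitary U" "\<sigma> = U ** rdiag r ** adj U" and r: "\<And>k. r k \<ge> 0"
    using psd_spectral[OF psd] by blast
  let ?\<tau> = "tensor (mat 1 :: 'a cmat) (ptr1 \<sigma>)"
  obtain V s where V: "unitary V" "?\<tau> = V ** rdiag s ** adj V" and s: "\<And>k. s k \<ge> 0"
    using psd_spectral[OF psd_tensor[OF psd_mat1 psd_ptr1[OF psd]]] by blast
  \<comment> \<open>Squared overlaps of the two eigenbases: the conditional law of \<open>j\<close>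
    given \<open>i\<close> in the joint distribution \<open>p\<close>.\<close>
  define w where "w i j = (cmod (cinner (column j V) (column i U)))\<^sup>2" for i j
  have sw: "(\<Sum>j\<in>UNIV. w i j) = 1" for i
    unfolding w_def cinner_column[symmetric] unitary_norm[OF V(1)] by (simp add: unitary_column_norm[OF U(1)])
  \<comment> \<open>Pairs for which \<open>ln (s j)\<close> would be minus infinity carry no weight,
    so the convention \<open>ln 0 = 0\<close> does no harm.\<close>
  have w0: "w i j = 0" if "r i \<noteq> 0" "s j = 0" for i j
  proof -
    have "adj V ** ?\<tau> ** V = (adj V ** V) ** rdiag s ** (adj V ** V)"
      unfolding V(2) by (simp only: matrix_mul_assoc)
    then have "cinner (column j V) (?\<tau> *v column j V) = 0"
      using V(1) that(2) by (simp add: column_conj unitary_def rdiag_def)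
    from marginal_kernel[OF U(2) r this that(1)] show ?thesis
      unfolding w_def cmod_cinner_commute[of "column j V"] by simp
  qed
  define p where "p x = r (fst x) * w (fst x) (snd x)" for x
  define l where "l x = ln (s (snd x)) - ln (r (fst x))" for x
  have p0: "p x \<ge> 0" for x using r by (simp add: p_def w_def)
  have sr: "(\<Sum>i\<in>UNIV. r i) = 1"
    using tr unfolding U(2) qtr_spectral[OF U(1)] by (simp only: of_real_eq_1_iff)
  have p1: "(\<Sum>x\<in>UNIV. p x) = 1"
    unfolding sum_pair[of p] by (simp add: p_def sw sr flip: sum_distrib_left)
  have Q: "petz_trace \<alpha> \<sigma> = (\<Sum>x\<in>UNIV. p x * exp ((1 - \<alpha>) * l x))" for \<alpha>
  proof -
    have "petz_trace \<alpha> \<sigma> = (\<Sum>i\<in>UNIV. \<Sum>j\<in>UNIV. r i powr \<alpha> * s j powr (1 - \<alpha>) * w i j)"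
      unfolding petz_trace_def mfun_spectral[OF U] mfun_spectral[OF V] qtr_spectral_product Re_complex_of_real w_def
      by simp
    also have "\<dots> = (\<Sum>i\<in>UNIV. \<Sum>j\<in>UNIV. p (i, j) * exp ((1 - \<alpha>) * l (i, j)))"
    proof (intro sum.cong refl)
      fix i j
      show "r i powr \<alpha> * s j powr (1 - \<alpha>) * w i j = p (i, j) * exp ((1 - \<alpha>) * l (i, j))"
      proof (cases "r i = 0 \<or> s j = 0")
        \<comment> \<open>Both sides vanish: \<open>0 powr\<close> anything is 0, and
          \<open>p\<close> is zero because \<open>r i = 0\<close> or else by
          \<open>w0\<close>.\<close>
        case True
        then show ?thesis using w0[of i j] by (auto simp: p_def)
      next
        case False
        then have "r i > 0" "s j > 0" using r[of i] s[of j] by auto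
        have e: "\<alpha> * ln (r i) + (1 - \<alpha>) * ln (s j) = ln (r i) + (1 - \<alpha>) * l (i, j)"
          by (simp add: l_def algebra_simps)
        have "r i powr \<alpha> * s j powr (1 - \<alpha>) = exp (\<alpha> * ln (r i)) * exp ((1 - \<alpha>) * ln (s j))"
          using \<open>r i > 0\<close> \<open>s j > 0\<close> by (simp add: powr_def)
        also have "\<dots> = exp (ln (r i)) * exp ((1 - \<alpha>) * l (i, j))"
          by (simp only: exp_add[symmetric] e)
        finally show ?thesis using \<open>r i > 0\<close> by (simp add: p_def)
      qed
    qed
    finally show ?thesis by (simp add: sum_pair)
  qed
  have "cond_entropy \<sigma> = (\<Sum>x\<in>UNIV. p x * l x)"
  proof -
    have self: "qtr (\<sigma> ** mfun ln \<sigma>) = complex_of_real (\<Sum>i\<in>UNIV. r i * ln (r i))"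
    proof -
      have "\<sigma> ** mfun ln \<sigma> = mfun (\<lambda>x. x) \<sigma> ** mfun ln \<sigma>" by (simp add: mfun_id[OF psd])
      also have "\<dots> = mfun (\<lambda>x. x * ln x) \<sigma>" using psd by (rule mfun_mult) simp
      also have "qtr \<dots> = complex_of_real (\<Sum>i\<in>UNIV. r i * ln (r i))"
        unfolding mfun_spectral[OF U] qtr_spectral[OF U(1)] by (simp only: comp_def)
      finally show ?thesis .
    qed
    have cross: "qtr (\<sigma> ** mfun ln ?\<tau>) = complex_of_real (\<Sum>i\<in>UNIV. \<Sum>j\<in>UNIV. r i * ln (s j) * w i j)"
      unfolding mfun_spectral[OF V] by (subst U(2)) (simp add: qtr_spectral_product w_def)
    have "cond_entropy \<sigma> = (\<Sum>i\<in>UNIV. \<Sum>j\<in>UNIV. r i * ln (s j) * w i j) - (\<Sum>i\<in>UNIV. r i * ln (r i))"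
      unfolding cond_entropy_def matrix_diff_ldistrib qtr_diff self cross by simp
    also have "(\<Sum>i\<in>UNIV. r i * ln (r i)) = (\<Sum>i\<in>UNIV. \<Sum>j\<in>UNIV. r i * ln (r i) * w i j)"
      by (simp add: sw flip: sum_distrib_left)
    finally show ?thesis
      by (simp add: sum_pair p_def l_def sum_subtractf[symmetric] algebra_simps)
  qed
  then show ?thesis using p0 p1 Q by (intro exI[of _ p] exI[of _ l]) simp
qed

section \<open>Exponential moments and their behaviour near zero\<close>

lemma exp_moment_ge:
  fixes p l :: "'i::finite \<Rightarrow> real"
  assumes p: "\<And>x. p x \<ge> 0" "(\<Sum>x\<in>UNIV. p x) = 1"
  shows "exp (t * (\<Sum>x\<in>UNIV. p x * l x)) \<le> (\<Sum>x\<in>UNIV. p x * exp (t * l x))"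
proof -
  define m where "m = (\<Sum>x\<in>UNIV. p x * l x)"
  \<comment> \<open>Jensen through the tangent of the exponential at the mean: the linear correction
    has expectation zero.\<close>
  have "exp (t * m) = exp (t * m) * (\<Sum>x\<in>UNIV. p x * (1 + t * (l x - m)))"
  proof -
    have "(\<Sum>x\<in>UNIV. p x * (1 + t * (l x - m))) = (\<Sum>x\<in>UNIV. p x) + t * ((\<Sum>x\<in>UNIV. p x * l x) - m * (\<Sum>x\<in>UNIV. p x))"
      by (simp add: sum_distrib_left sum.distrib sum_subtractf algebra_simps)
    then show ?thesis by (simp add: p(2) m_def[symmetric])
  qed
  also have "\<dots> \<le> exp (t * m) * (\<Sum>x\<in>UNIV. p x * exp (t * (l x - m)))"
    using p(1) by (intro mult_left_mono sum_mono exp_ge_add_one_self) auto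
  also have "\<dots> = (\<Sum>x\<in>UNIV. p x * exp (t * l x))"
    by (simp add: sum_distrib_left mult.left_commute[of "exp _"] mult_exp_exp algebra_simps)
  finally show ?thesis by (simp add: m_def)
qed

lemma has_derivative_ln_exp_moment:
  fixes p l :: "'i::finite \<Rightarrow> real"
  assumes "(\<Sum>x\<in>UNIV. p x) = 1"
  shows "((\<lambda>t. ln (\<Sum>x\<in>UNIV. p x * exp (t * l x))) has_real_derivative (\<Sum>x\<in>UNIV. p x * l x)) (at 0)"
proof -
  have "((\<lambda>t. \<Sum>x\<in>UNIV. p x * exp (t * l x)) has_real_derivative (\<Sum>x\<in>UNIV. p x * l x)) (at 0)"
    by (auto intro!: derivative_eq_intros simp: mult.commute)
  moreover have "(ln has_real_derivative 1) (at (\<Sum>x\<in>UNIV. p x * exp (0 * l x)))"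
    using DERIV_ln[of 1] assms by simp
  ultimately show ?thesis
    using DERIV_chain2[of ln 1 "\<lambda>t. \<Sum>x\<in>UNIV. p x * exp (t * l x)" 0 "\<Sum>x\<in>UNIV. p x * l x" UNIV] by simp
qed

theorem exponent_positive_iff:
  fixes \<omega> :: "('a::finite \<times> 'c::finite) cmat" and \<rho> :: "('b::finite \<times> 'e::finite) cmat"
  assumes "density \<omega>" "density \<rho>"
  shows "(SUP \<alpha>\<in>{0<..<1::real}. (\<alpha> - 1) * (petz_cond_entropy \<alpha> \<omega> + petz_cond_entropy \<alpha> \<rho>)) > 0
    \<longleftrightarrow> cond_entropy \<omega> + cond_entropy \<rho> < 0"
proof -
  obtain p1 l1 :: "('a \<times> 'c) \<times> ('a \<times> 'c) \<Rightarrow> real" where "(\<forall>x. p1 x \<ge> 0) \<and> (\<Sum>x\<in>UNIV. p1 x) = 1 \<and>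
    (\<forall>\<alpha>. petz_trace \<alpha> \<omega> = (\<Sum>x\<in>UNIV. p1 x * exp ((1 - \<alpha>) * l1 x))) \<and>
    cond_entropy \<omega> = (\<Sum>x\<in>UNIV. p1 x * l1 x)"
    using cond_entropy_distribution[OF assms(1)] by (elim exE) (rule that)
  then have 1: "\<And>x. p1 x \<ge> 0" "(\<Sum>x\<in>UNIV. p1 x) = 1"
    "\<And>\<alpha>. petz_trace \<alpha> \<omega> = (\<Sum>x\<in>UNIV. p1 x * exp ((1 - \<alpha>) * l1 x))" "cond_entropy \<omega> = (\<Sum>x\<in>UNIV. p1 x * l1 x)"
    by blast+
  obtain p2 l2 :: "('b \<times> 'e) \<times> ('b \<times> 'e) \<Rightarrow> real" where "(\<forall>x. p2 x \<ge> 0) \<and> (\<Sum>x\<in>UNIV. p2 x) = 1 \<and>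
    (\<forall>\<alpha>. petz_trace \<alpha> \<rho> = (\<Sum>x\<in>UNIV. p2 x * exp ((1 - \<alpha>) * l2 x))) \<and>
    cond_entropy \<rho> = (\<Sum>x\<in>UNIV. p2 x * l2 x)"
    using cond_entropy_distribution[OF assms(2)] by (elim exE) (rule that)
  then have 2: "\<And>x. p2 x \<ge> 0" "(\<Sum>x\<in>UNIV. p2 x) = 1"
    "\<And>\<alpha>. petz_trace \<alpha> \<rho> = (\<Sum>x\<in>UNIV. p2 x * exp ((1 - \<alpha>) * l2 x))" "cond_entropy \<rho> = (\<Sum>x\<in>UNIV. p2 x * l2 x)"
    by blast+
  define H where "H = cond_entropy \<omega> + cond_entropy \<rho>"
  define \<phi> where "\<phi> t = ln (\<Sum>x\<in>UNIV. p1 x * exp (t * l1 x)) + ln (\<Sum>x\<in>UNIV. p2 x * exp (t * l2 x))" for t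
  define g where "g \<alpha> = (\<alpha> - 1) * (petz_cond_entropy \<alpha> \<omega> + petz_cond_entropy \<alpha> \<rho>)" for \<alpha>
  have g: "g \<alpha> = - \<phi> (1 - \<alpha>)" if "\<alpha> < 1" for \<alpha>
  proof -
    have "g \<alpha> = - ((1 - \<alpha>) * petz_cond_entropy \<alpha> \<omega> + (1 - \<alpha>) * petz_cond_entropy \<alpha> \<rho>)"
      by (simp add: g_def algebra_simps)
    then show ?thesis
      unfolding petz_cond_entropy_trace[OF that] 1(3) 2(3) \<phi>_def by simp
  qed
  have ln_ge: "t * (\<Sum>x\<in>UNIV. p x * l x) \<le> ln (\<Sum>x\<in>UNIV. p x * exp (t * l x))"
    if "\<And>x. p x \<ge> 0" "(\<Sum>x\<in>UNIV. p x) = 1" for p l :: "'i::finite \<Rightarrow> real" and t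
  proof -
    note ge = exp_moment_ge[OF that, of t l]
    have "t * (\<Sum>x\<in>UNIV. p x * l x) = ln (exp (t * (\<Sum>x\<in>UNIV. p x * l x)))" by simp
    also have "\<dots> \<le> ln (\<Sum>x\<in>UNIV. p x * exp (t * l x))"
      using ge less_le_trans[OF exp_gt_zero ge] by (intro ln_mono) auto
    finally show ?thesis .
  qed
  have \<phi>_ge: "t * H \<le> \<phi> t" for t
    using ln_ge[OF 1(1,2), of t l1] ln_ge[OF 2(1,2), of t l2] by (simp add: H_def \<phi>_def 1(4) 2(4) distrib_left)
  \<comment> \<open>Needed to read the real supremum as a least upper bound; the tangent bound for
    \<open>\<phi>\<close> supplies the constant.\<close>
  have bdd: "bdd_above (g ` {0<..<1})"
  proof (rule bdd_aboveI2)
    fix \<alpha> :: real assume "\<alpha> \<in> {0<..<1}"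
    then have a: "0 < \<alpha>" "\<alpha> < 1" by auto
    have "g \<alpha> \<le> (1 - \<alpha>) * (- H)" using g[OF a(2)] \<phi>_ge[of "1 - \<alpha>"] by simp
    also have "\<dots> \<le> (1 - \<alpha>) * \<bar>H\<bar>" using a by (intro mult_left_mono) auto
    also have "\<dots> \<le> 1 * \<bar>H\<bar>" using a by (intro mult_right_mono) auto
    finally show "g \<alpha> \<le> 1 * \<bar>H\<bar>" .
  qed
  have sup: "(SUP \<alpha>\<in>{0<..<1}. g \<alpha>) > 0 \<longleftrightarrow> (\<exists>\<alpha>\<in>{0<..<1}. g \<alpha> > 0)"
    by (rule less_cSUP_iff[OF _ bdd]) simp
  have "(\<exists>\<alpha>\<in>{0<..<1}. g \<alpha> > 0) \<longleftrightarrow> H < 0"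
  proof
    assume "\<exists>\<alpha>\<in>{0<..<1}. g \<alpha> > 0"
    then obtain \<alpha> where a: "0 < \<alpha>" "\<alpha> < 1" "g \<alpha> > 0" by auto
    then have "(1 - \<alpha>) * H < 0" using g[OF a(2)] \<phi>_ge[of "1 - \<alpha>"] by linarith
    then show "H < 0" using a by (simp add: mult_less_0_iff)
  next
    assume H: "H < 0"
    \<comment> \<open>The converse direction uses the slope at zero: as \<open>\<phi> 0 = 0\<close>,
      a negative \<open>H\<close> makes \<open>\<phi>\<close> negative just to the right.\<close>
    have "(\<phi> has_real_derivative H) (at 0)"
      unfolding \<phi>_def H_def 1(4) 2(4) by (intro DERIV_add has_derivative_ln_exp_moment 1(2) 2(2))
    then obtain d where d: "d > 0" "\<And>h. 0 < h \<Longrightarrow> h < d \<Longrightarrow> \<phi> (0 + h) < \<phi> 0"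
      using DERIV_neg_dec_right[OF _ H] by blast
    \<comment> \<open>Below \<open>d\<close> for the derivative argument, and below 1 so that
      \<open>1 - h\<close> lies in the open unit interval.\<close>
    define h where "h = min (d / 2) (1 / 2)"
    have h: "0 < h" "h < d" "h < 1" using d(1) by (auto simp: h_def)
    have "\<phi> 0 = 0" by (simp add: \<phi>_def 1(2) 2(2))
    then have "g (1 - h) > 0" using g[of "1 - h"] d(2)[OF h(1,2)] h(1) by simp
    then show "\<exists>\<alpha>\<in>{0<..<1}. g \<alpha> > 0" using h by (intro bexI[of _ "1 - h"]) auto
  qed
  then show ?thesis using sup by (simp only: g_def H_def)
qed

theorem theorem1p3:
  fixes \<rho> :: "('a::finite \<times> 'e::finite) cmat"
    and T :: "'a cmat \<Rightarrow> 'c::finite cmat"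
  assumes "density \<rho>" and "channel T"
  shows "(\<forall>\<alpha>\<in>{0<..<1::real}.
           1 / 2 * (\<integral>U. trace_norm (map_left T (tensor U (mat 1) ** \<rho> ** adj (tensor U (mat 1)))
                                   - tensor (T maximally_mixed) (ptr1 \<rho>)) \<partial>haar)
           \<ge> 1 - 2 * exp ((1 - \<alpha>) * (petz_cond_entropy \<alpha> (choi T) + petz_cond_entropy \<alpha> \<rho>
                                     + ln (4 / 3))))
       \<and> ((SUP \<alpha>\<in>{0<..<1::real}. (\<alpha> - 1) * (petz_cond_entropy \<alpha> (choi T) + petz_cond_entropy \<alpha> \<rho>)) > 0
           \<longleftrightarrow> cond_entropy (choi T) + cond_entropy \<rho> < 0)"
proof -
  have "density (choi T)"
    using psd_choi[OF assms(2)] qtr_choi[OF assms(2)] by (simp add: density_def)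
  then show ?thesis
    using decoupling_converse[OF assms] exponent_positive_iff[OF _ assms(1)] by auto
qed

end
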